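(* Let $t\geq 3$ and $n\geq t+1$ be integers, and let $G^*$ be a graph attaining the maximum spectral radius over all $n$-vertex connected $K_{1,t}$-minor free graphs. Then $$ G^*\cong \begin{cases} \overline{H_{1,t}} & \text{if } n=t+1;\\ S^{n-t}(K_t) & \text{if } n\geq t+2. \end{cases}$$
   Context: All graphs are finite and simple. A graph $H$ is a minor of $G$ if $H$ can be obtained from a subgraph of $G$ by contracting edges; $G$ is $H$-minor free if $H$ is not a minor of $G$. The spectral radius is that of the adjacency matrix. $\overline{G}$ is the complement of $G$. $H_{1,t}$ is the star forest of order $t+1$ that is the disjoint union of $\lfloor\frac{t+1}{2}\rfloor$ stars, all but at most one isomorphic to $K_{1,1}$ (so $\frac{t+1}{2}K_{1,1}$ if $t+1$ is even, and $K_{1,2}\cup\frac{t-2}{2}K_{1,1}$ if $t+1$ is odd). $S^{k}(K_t)$ is the graph obtained from the complete graph $K_t$ by subdividing one edge $k$ times (replacing the edge by a path with $k$ new internal vertices). *)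

theory Defs
  imports "Graph_Theory.Graph_Theory" "Jordan_Normal_Form.Spectral_Radius"
begin

text \<open>
  A finite simple graph is a \<^locale>\<open>pair_graph\<close> of the Graph Theory entry: a finite vertex set together
  with a finite, symmetric, irreflexive set of arcs, an edge being a pair of opposite arcs.
  \<^const>\<open>subgraph\<close>, \<^const>\<open>Digraph_Component.connected\<close>, \<^const>\<open>digraph_iso\<close> and \<^const>\<open>subdivide\<close> are
  those of that entry; the coercion \<^const>\<open>with_proj\<close> is inserted silently.
\<close>


section \<open>Spectral radius\<close>

definition adjacency_mat :: "'a pair_pre_digraph \<Rightarrow> 'a list \<Rightarrow> complex mat" where
  "adjacency_mat G vs =
     mat (length vs) (length vs) (\<lambda>(i, j). if (vs ! i, vs ! j) \<in> parcs G then 1 else 0)"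

text \<open>
  The vertices are listed in an arbitrary order; the value does not depend on it
  (lemma \<open>graph_spectral_radius_eq\<close> below).
\<close>

definition graph_spectral_radius :: "'a pair_pre_digraph \<Rightarrow> real" where
  "graph_spectral_radius G =
     spectral_radius (adjacency_mat G (SOME vs. distinct vs \<and> set vs = pverts G))"

lemma eigenvalue_adjacency_mat_reorder:
  assumes "distinct vs" "distinct ws" "set vs = set ws"
    and "eigenvalue (adjacency_mat G vs) k"
  shows "eigenvalue (adjacency_mat G ws) k"
proof -
  define n where "n = length vs"
  have n': "length ws = n"
    using assms(1-3) by (metis distinct_card n_def)
  have dim: "adjacency_mat G vs \<in> carrier_mat n n" "adjacency_mat G ws \<in> carrier_mat n n"
    by (auto simp: adjacency_mat_def n_def n')
  define p where "p i = (THE j. j < n \<and> vs ! j = ws ! i)" for i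
  have p: "p i < n \<and> vs ! p i = ws ! i" if "i < n" for i
  proof -
    have "ws ! i \<in> set vs"
      using that assms(3) n' by auto
    then have "\<exists>!j. j < n \<and> vs ! j = ws ! i"
      using assms(1) unfolding n_def by (metis distinct_Ex1)
    then show ?thesis
      unfolding p_def by (rule theI')
  qed
  have inj: "inj_on p {..<n}"
    by (rule inj_onI) (metis assms(2) lessThan_iff n' nth_eq_iff_index_eq p)
  have im: "p ` {..<n} = {..<n}"
    by (rule endo_inj_surj) (use p inj in auto)
  have bij: "bij_betw p {0..<n} {0..<n}"
    using inj im by (simp add: bij_betw_def lessThan_atLeast0)
  from assms(4) obtain x where x: "x \<in> carrier_vec n" "x \<noteq> 0\<^sub>v n"
    "adjacency_mat G vs *\<^sub>v x = k \<cdot>\<^sub>v x"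
    using dim(1) unfolding eigenvalue_def eigenvector_def by auto
  define y where "y = vec n (\<lambda>i. x $ p i)"
  have entry: "(\<Sum>j\<in>{0..<n}. (if (vs ! i, vs ! j) \<in> parcs G then 1 else 0) * x $ j) = k * x $ i"
    if "i < n" for i
    using arg_cong[OF x(3), of "\<lambda>v. v $ i"] that x(1)
    by (simp add: adjacency_mat_def scalar_prod_def n_def[symmetric])
  have "adjacency_mat G ws *\<^sub>v y = k \<cdot>\<^sub>v y"
  proof (rule eq_vecI)
    fix i assume "i < dim_vec (k \<cdot>\<^sub>v y)"
    then have i: "i < n" by (simp add: y_def)
    have "(adjacency_mat G ws *\<^sub>v y) $ i
        = (\<Sum>j\<in>{0..<n}. (if (ws ! i, ws ! j) \<in> parcs G then 1 else 0) * x $ p j)"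
      using i by (simp add: adjacency_mat_def scalar_prod_def n' y_def)
    also have "\<dots> = (\<Sum>j\<in>{0..<n}. (if (vs ! p i, vs ! p j) \<in> parcs G then 1 else 0) * x $ p j)"
      using p i by (intro sum.cong) auto
    also have "\<dots> = (\<Sum>j\<in>{0..<n}. (if (vs ! p i, vs ! j) \<in> parcs G then 1 else 0) * x $ j)"
      by (rule sum.reindex_bij_betw[OF bij])
    also have "\<dots> = k * x $ p i"
      using entry p i by blast
    finally show "(adjacency_mat G ws *\<^sub>v y) $ i = (k \<cdot>\<^sub>v y) $ i"
      using i by (simp add: y_def)
  qed (simp add: y_def adjacency_mat_def n')
  moreover have "y \<noteq> 0\<^sub>v n"
  proof
    assume y0: "y = 0\<^sub>v n"
    have "x $ i = 0" if "i < n" for i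
    proof -
      from that im obtain j where "j < n" "i = p j" by auto
      then show ?thesis
        using arg_cong[OF y0, of "\<lambda>v. v $ j"] by (simp add: y_def)
    qed
    then have "x = 0\<^sub>v n"
      using x(1) by (intro eq_vecI) auto
    then show False using x(2) by simp
  qed
  ultimately show ?thesis
    using dim(2) unfolding eigenvalue_def eigenvector_def
    by (intro exI[of _ y]) (auto simp: y_def)
qed

lemma graph_spectral_radius_eq:
  assumes "distinct vs" "set vs = pverts G"
  shows "graph_spectral_radius G = spectral_radius (adjacency_mat G vs)"
proof -
  let ?ws = "SOME ws. distinct ws \<and> set ws = pverts G"
  have "distinct ?ws \<and> set ?ws = pverts G"
    by (rule someI[of _ vs]) (use assms in simp)
  then have "spectrum (adjacency_mat G ?ws) = spectrum (adjacency_mat G vs)"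
    using assms unfolding spectrum_def by (auto intro: eigenvalue_adjacency_mat_reorder)
  then show ?thesis
    by (simp add: graph_spectral_radius_def spectral_radius_def)
qed


section \<open>Minors\<close>

text \<open>
  Contraction of the edge \<open>uv\<close>: \<open>v\<close> is merged into \<open>u\<close>, and the resulting loops and parallel edges
  are deleted.
\<close>

definition contract_edge :: "'a pair_pre_digraph \<Rightarrow> 'a \<Rightarrow> 'a \<Rightarrow> 'a pair_pre_digraph" where
  "contract_edge G u v =
     (let f = (\<lambda>x. if x = v then u else x)
      in \<lparr> pverts = f ` pverts G, parcs = {(f x, f y) |x y. (x, y) \<in> parcs G \<and> f x \<noteq> f y} \<rparr>)"

definition contracts_to :: "'a pair_pre_digraph \<Rightarrow> 'a pair_pre_digraph \<Rightarrow> bool" where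
  "contracts_to G H \<longleftrightarrow> (\<exists>(u, v) \<in> parcs G. H = contract_edge G u v)"

definition is_minor :: "'b pair_pre_digraph \<Rightarrow> 'a pair_pre_digraph \<Rightarrow> bool" where
  "is_minor H G \<longleftrightarrow>
     (\<exists>G' K. pair_graph G' \<and> subgraph G' G \<and> contracts_to\<^sup>*\<^sup>* G' K \<and> digraph_iso K H)"

abbreviation minor_free :: "'b pair_pre_digraph \<Rightarrow> 'a pair_pre_digraph \<Rightarrow> bool" where
  "minor_free H G \<equiv> \<not> is_minor H G"

lemma pair_graph_contract_edge:
  assumes "pair_graph G" "(u, v) \<in> parcs G"
  shows "pair_graph (contract_edge G u v)"
proof -
  interpret pair_graph G by fact
  define f where "f = (\<lambda>x. if x = v then u else x)"
  have V: "pverts (contract_edge G u v) = f ` pverts G"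
    and E: "parcs (contract_edge G u v) = {(f x, f y) |x y. (x, y) \<in> parcs G \<and> f x \<noteq> f y}"
    by (simp_all add: contract_edge_def f_def Let_def)
  have "parcs (contract_edge G u v) \<subseteq> (\<lambda>(x, y). (f x, f y)) ` parcs G"
    unfolding E by force
  then have "finite (parcs (contract_edge G u v))"
    using finite_subset pair_finite_arcs by blast
  moreover have "sym (parcs (contract_edge G u v))"
    unfolding E sym_def by simp (metis arcs_symmetric)
  ultimately show ?thesis
    using pair_finite_verts
    by unfold_locales (auto simp: V E symmetric_def dest: in_arcsD1 in_arcsD2)
qed


section \<open>The graphs of the theorem\<close>

definition complement :: "'a pair_pre_digraph \<Rightarrow> 'a pair_pre_digraph" where
  "complement G =
     \<lparr> pverts = pverts G, parcs = {(u, v) \<in> pverts G \<times> pverts G. u \<noteq> v} - parcs G \<rparr>"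

definition complete_graph :: "nat \<Rightarrow> nat pair_pre_digraph" where
  "complete_graph t = \<lparr> pverts = {..<t}, parcs = {(u, v) \<in> {..<t} \<times> {..<t}. u \<noteq> v} \<rparr>"

text \<open>The star \<open>K\<^bsub>1,t\<^esub>\<close> with centre \<open>0\<close>.\<close>

definition star :: "nat \<Rightarrow> nat pair_pre_digraph" where
  "star t = \<lparr> pverts = {..t}, parcs = {0} \<times> {1..t} \<union> {1..t} \<times> {0} \<rparr>"

text \<open>The disjoint union of the stars \<open>K\<^bsub>1,k\<^esub>\<close> for \<open>k\<close> in the list \<open>ks\<close>; the \<open>i\<close>-th copy is tagged by \<open>i\<close>.\<close>

definition star_forest :: "nat list \<Rightarrow> (nat \<times> nat) pair_pre_digraph" where
  "star_forest ks =
     \<lparr> pverts = {(i, x) |i x. i < length ks \<and> x \<in> pverts (star (ks ! i))},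
       parcs = {((i, x), (i, y)) |i x y. i < length ks \<and> (x, y) \<in> parcs (star (ks ! i))} \<rparr>"

definition H_graph :: "nat \<Rightarrow> (nat \<times> nat) pair_pre_digraph" where
  "H_graph t = star_forest
     (if even (t + 1) then replicate ((t + 1) div 2) 1 else 2 # replicate ((t - 2) div 2) 1)"

text \<open>
  Replaces the edge \<open>uv\<close> by the path through \<open>u\<close>, the new vertices \<open>ws\<close> (in this order) and \<open>v\<close>.
\<close>

fun subdivide_edge :: "'a pair_pre_digraph \<Rightarrow> 'a \<times> 'a \<Rightarrow> 'a list \<Rightarrow> 'a pair_pre_digraph" where
  "subdivide_edge G (u, v) [] = G"
| "subdivide_edge G (u, v) (w # ws) = subdivide_edge (subdivide G (u, v) w) (w, v) ws"

text \<open>\<open>S\<^sup>k(K\<^sub>t)\<close> for \<open>t \<ge> 2\<close>; by symmetry of \<open>K\<^sub>t\<close> the choice of the edge does not matter.\<close>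

definition subdivided_complete_graph :: "nat \<Rightarrow> nat \<Rightarrow> nat pair_pre_digraph" where
  "subdivided_complete_graph k t = subdivide_edge (complete_graph t) (0, 1) [t..<t + k]"

lemma complete_digraph_complete_graph: "K\<^bsub>t\<^esub> (with_proj (complete_graph t))"
  by (auto simp: complete_digraph_pair_def complete_graph_def)

lemma complete_bipartite_digraph_star: "K\<^bsub>1,t\<^esub> (with_proj (star t))"
  unfolding complete_bipartite_digraph_pair_def
  by (intro conjI exI[of _ "{0}"] exI[of _ "{1..t}"]) (auto simp: star_def)

lemma pair_graph_complement:
  assumes "pair_graph G"
  shows "pair_graph (complement G)"
proof -
  interpret pair_graph G by fact
  have "finite (parcs (complement G))"
    by (rule finite_subset[of _ "pverts G \<times> pverts G"])
      (use pair_finite_verts in \<open>auto simp: complement_def\<close>)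
  moreover have "sym (parcs (complement G))"
    by (auto simp: complement_def sym_def intro: arcs_symmetric)
  ultimately show ?thesis
    using pair_finite_verts by unfold_locales (auto simp: complement_def symmetric_def)
qed

lemma pair_graph_star_forest: "pair_graph (star_forest ks)"
proof -
  have V: "pverts (star_forest ks) = (SIGMA i:{..<length ks}. {..ks ! i})"
    by (auto simp: star_forest_def star_def)
  have "finite (pverts (star_forest ks))"
    unfolding V by simp
  moreover have "parcs (star_forest ks) \<subseteq> pverts (star_forest ks) \<times> pverts (star_forest ks)"
    by (auto simp: star_forest_def star_def)
  ultimately have "finite (parcs (star_forest ks))"
    by (meson finite_SigmaI finite_subset)
  moreover have "sym (parcs (star_forest ks))"
    by (auto simp: star_forest_def star_def sym_def)
  ultimately show ?thesis
    using \<open>finite (pverts _)\<close>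
    by unfold_locales (auto simp: star_forest_def star_def symmetric_def)
qed

lemma card_H_graph:
  assumes "t \<ge> 2"
  shows "card (pverts (H_graph t)) = t + 1"
proof -
  have *: "card (pverts (star_forest ks)) = (\<Sum>k\<leftarrow>ks. k + 1)" for ks
  proof -
    have "pverts (star_forest ks) = (SIGMA i:{..<length ks}. {..ks ! i})"
      by (auto simp: star_forest_def star_def)
    then show ?thesis
      by (simp add: sum_list_sum_nth atLeast0LessThan)
  qed
  show ?thesis
    using assms unfolding H_graph_def by (auto simp: * sum_list_replicate elim!: evenE oddE)
qed

lemma pair_graph_subdivide_edge:
  assumes "pair_graph G" "(u, v) \<in> parcs G" "distinct ws" "set ws \<inter> pverts G = {}"
  shows "pair_graph (subdivide_edge G (u, v) ws)
    \<and> pverts (subdivide_edge G (u, v) ws) = pverts G \<union> set ws"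
  using assms
proof (induction ws arbitrary: G u)
  case (Cons w ws)
  interpret pair_graph G by fact
  have "pair_graph (subdivide G (u, v) w)"
    using Cons.prems by (intro pair_graph_subdivide) auto
  moreover have "(w, v) \<in> parcs (subdivide G (u, v) w)"
    and "pverts (subdivide G (u, v) w) = insert w (pverts G)"
    by (auto simp: subdivide.simps)
  ultimately show ?case
    using Cons.IH[of "subdivide G (u, v) w" w] Cons.prems by auto
qed simp

end

theory Submission
  imports Defs "HOL-Analysis.Function_Topology"
begin

text \<open>
  A connected graph has a \<open>K\<^bsub>1,t\<^esub>\<close> minor iff some connected vertex set \<open>B\<close> has at least \<open>t\<close>
  neighbours outside \<open>B\<close>. Let \<open>\<rho>\<close> be the maximal spectral radius and \<open>x\<close> the Perron vector of an
  extremal graph.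

  If \<open>n \<ge> t + 2\<close>, let \<open>x\<close> be normalised to have maximum \<open>1 = x u\<close>. The candidate \<open>S\<^sup>k(K\<^sub>t)\<close> gives
  \<open>\<rho> > t - 2\<close>, so \<open>u\<close> has \<open>t - 1\<close> neighbours, forming the set \<open>N\<close>; let \<open>R\<close> consist of the
  remaining vertices. Applied to small sets \<open>B\<close> around \<open>u\<close>, the star condition shows that \<open>R\<close>
  induces disjoint paths, that every vertex of \<open>N\<close> has at most one neighbour in \<open>R\<close>, and that
  vertices of \<open>N\<close> attached to \<open>R\<close> force non-adjacent pairs inside \<open>N\<close>. Summing the eigenvalue
  equations over \<open>N\<close> shows that non-adjacent pairs cost
  \<open>(\<rho> + 1)(t - 1 - \<rho>) = \<Sum>v\<in>N. (\<rho> + 1)(1 - x v)\<close>, and a test vector on \<open>S\<^sup>k(K\<^sub>t)\<close> bounds this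
  quantity by \<open>2\<rho> / (\<rho> + 2)\<close>. All attachments to \<open>R\<close> are thereby excluded except those
  at one or two vertices of a single non-adjacent pair. Hence the graph is a spanning subgraph
  of \<open>S\<^sup>k(K\<^sub>t)\<close>, and the spectral radius of a connected graph is strictly increasing in the edges.

  If \<open>n = t + 1\<close>, the graph is \<open>K\<^bsub>1,t\<^esub>\<close>-minor free iff every vertex has degree at least \<open>1\<close> in the
  complement. Writing \<open>d v\<close> for this degree, \<open>(t - 1 - \<rho>) \<Sum>v. x v = \<Sum>v. (d v - 1) x v\<close>, and comparison
  with a test vector on the candidate forces all \<open>d v\<close> to be \<open>1\<close>, up to a single
  \<open>2\<close> if the order is odd.
\<close>

section \<open>The largest eigenvalue of a finite graph\<close>

text \<open>The number \<rho> is never computed. Maximality enters only through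
  \<open>test_vector\<close>: a nonnegative vector \<open>y\<close> on a competitor whose neighbour
  sums are at least \<open>\<rho> * y\<close> must attain equality wherever it is positive. Suitable
  vectors on the candidates yield inequalities between \<rho> and \<open>t\<close>; the Perron
  vector itself, carried to a graph containing G, shows that no edge can be added. The obstacle for
  n \<ge> t + 2 is that a vertex of N attached to R regains up to 1 from R, so a non-adjacency there
  may cost almost nothing. The net cost at \<open>v\<close> is
  \<open>card (F v) - \<omega> v\<close>, against a budget \<open>D < 2\<close>. Two uncompensated
  units are impossible outright; compensated ones require the neighbour in R to be heavy, hence to
  have many neighbours, and the sharper form \<open>D * (\<rho> + 2) \<le> 2 * \<rho>\<close>. This
  is why attached vertices are grouped by their neighbour in R. For n = t + 1 and even t the
  candidate is not regular, and the estimates have no slack at \<open>d v = 2\<close>: the bound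
  from the candidate and the lower bound on \<open>x v\<close> have to match exactly.\<close>

definition nb :: "('a \<times> 'a) set \<Rightarrow> 'a \<Rightarrow> 'a set" where
  "nb E v = E `` {v}"

lemma mem_nb [simp]: "w \<in> nb E v \<longleftrightarrow> (v, w) \<in> E"
  by (simp add: nb_def)

lemma nb_subset: "E \<subseteq> V \<times> V \<Longrightarrow> nb E v \<subseteq> V"
  by (auto simp: nb_def)

lemma sum_nb_indicator:
  fixes y :: "'a \<Rightarrow> 'b::semiring_1"
  assumes "finite V" "E \<subseteq> V \<times> V"
  shows "(\<Sum>w\<in>V. (if (v, w) \<in> E then 1 else 0) * y w) = (\<Sum>w\<in>nb E v. y w)"
proof -
  have "(\<Sum>w\<in>V. (if (v, w) \<in> E then 1 else 0) * y w) = (\<Sum>w\<in>V. if w \<in> nb E v then y w else 0)"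
    by (intro sum.cong) auto
  also have "\<dots> = (\<Sum>w\<in>V \<inter> nb E v. y w)"
    using assms(1) by (simp add: sum.inter_restrict)
  also have "V \<inter> nb E v = nb E v"
    using nb_subset[OF assms(2)] by blast
  finally show ?thesis .
qed

text \<open>The quadratic form of the adjacency matrix; every edge contributes twice, once from each
  end.\<close>

definition qform :: "'a set \<Rightarrow> ('a \<times> 'a) set \<Rightarrow> ('a \<Rightarrow> real) \<Rightarrow> real" where
  "qform V E y = (\<Sum>v\<in>V. y v * (\<Sum>w\<in>nb E v. y w))"

lemma continuous_on_coordinate: "continuous_on S (\<lambda>f::'a \<Rightarrow> real. f i)"
  by (rule continuous_on_subset[OF continuous_on_product_coordinates]) simp

text \<open>Vectors are functions on the whole type that vanish off \<open>V\<close>. The sphere is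
  therefore a closed subset of a product of intervals and points, which is compact by
  Tychonoff.\<close>

lemma compact_unit_sphere:
  assumes "finite V"
  shows "compact {y::'a \<Rightarrow> real. (\<forall>v. v \<notin> V \<longrightarrow> y v = 0) \<and> (\<Sum>v\<in>V. (y v)\<^sup>2) = 1}"
proof -
  let ?K = "\<lambda>v. if v \<in> V then {-1..1} else {0::real}"
  have "compactin (product_topology (\<lambda>_. euclidean) UNIV) (PiE UNIV ?K)"
    by (subst compactin_PiE) auto
  then have 1: "compact (PiE UNIV ?K)"
    by (simp add: euclidean_product_topology)
  have 2: "closed {y::'a \<Rightarrow> real. (\<Sum>v\<in>V. (y v)\<^sup>2) = 1}"
    by (intro closed_Collect_eq continuous_intros continuous_on_coordinate)
  have "{y::'a \<Rightarrow> real. (\<forall>v. v \<notin> V \<longrightarrow> y v = 0) \<and> (\<Sum>v\<in>V. (y v)\<^sup>2) = 1}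
      = PiE UNIV ?K \<inter> {y. (\<Sum>v\<in>V. (y v)\<^sup>2) = 1}"
  proof -
    have "\<bar>y v\<bar> \<le> 1" if "(\<Sum>v\<in>V. (y v)\<^sup>2) = 1" "v \<in> V" for y :: "'a \<Rightarrow> real" and v
    proof -
      have "(y v)\<^sup>2 \<le> (\<Sum>v\<in>V. (y v)\<^sup>2)"
        by (rule member_le_sum) (use that assms in auto)
      then show ?thesis
        using that(1) by (simp add: abs_square_le_1)
    qed
    then show ?thesis
      by (fastforce simp: PiE_def Pi_def abs_le_iff split: if_splits)
  qed
  then show ?thesis
    using compact_Int_closed[OF 1 2] by simp
qed

text \<open>First-order condition at a maximum: the increment \<open>a / (2*c)\<close> has the sign
  of \<open>a\<close> and is small enough, as \<open>c\<close> exceeds the modulus of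
  \<open>b\<close>, for the linear term to win.\<close>

lemma quadratic_nonpos_imp_linear_zero:
  fixes a b :: real
  assumes "\<And>e. a * e + b * e\<^sup>2 \<le> 0"
  shows "a = 0"
proof (rule ccontr)
  assume "a \<noteq> 0"
  define c where "c = \<bar>b\<bar> + 1"
  have c: "c > 0" "b + c > 0" by (auto simp: c_def)
  have "a * (a / (2*c)) + b * (a / (2*c))\<^sup>2 = a\<^sup>2 * (2*c + b) / (4 * c\<^sup>2)"
    using c by (simp add: field_simps power2_eq_square)
  moreover have "\<dots> > 0"
    using c \<open>a \<noteq> 0\<close> by (intro divide_pos_pos mult_pos_pos) auto
  ultimately show False
    using assms[of "a / (2*c)"] by simp
qed

locale fin_graph =
  fixes V :: "'a set" and E :: "('a \<times> 'a) set"
  assumes finV: "finite V" and EV: "E \<subseteq> V \<times> V" and symE: "(v, w) \<in> E \<Longrightarrow> (w, v) \<in> E"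
    and irrefl: "(v, v) \<notin> E"
begin

lemma E_sym: "(v, w) \<in> E \<longleftrightarrow> (w, v) \<in> E"
  using symE by blast

lemma E_verts: "(v, w) \<in> E \<Longrightarrow> v \<in> V" "(v, w) \<in> E \<Longrightarrow> w \<in> V"
  using EV by auto

lemma finite_nb [simp, intro]: "finite (nb E v)"
  using nb_subset[OF EV] finV finite_subset by blast

lemma qform_eq_indicator: "qform V E y = (\<Sum>v\<in>V. \<Sum>w\<in>V. (if (v, w) \<in> E then y v * y w else 0))"
proof -
  have "y v * (\<Sum>w\<in>nb E v. y w) = (\<Sum>w\<in>V. (if (v, w) \<in> E then y v * y w else 0))" for v
    unfolding sum_nb_indicator[OF finV EV, of v y, symmetric] sum_distrib_left
    by (intro sum.cong) auto
  then show ?thesis by (simp add: qform_def)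
qed

text \<open>Self-adjointness of the adjacency operator, by symmetry of \<open>E\<close>.\<close>

lemma sum_nb_swap:
  "(\<Sum>v\<in>V. y v * (\<Sum>w\<in>nb E v. z w)) = (\<Sum>v\<in>V. z v * (\<Sum>w\<in>nb E v. y w :: real))"
proof -
  have *: "y v * (\<Sum>w\<in>nb E v. z w) = (\<Sum>w\<in>V. (if (v, w) \<in> E then y v * z w else 0))"
    for v and y z :: "'a \<Rightarrow> real"
    unfolding sum_nb_indicator[OF finV EV, of v z, symmetric] sum_distrib_left
    by (intro sum.cong) auto
  show ?thesis
    unfolding * by (subst sum.swap) (intro sum.cong, auto simp: E_sym)
qed

lemma qform_add:
  "qform V E (\<lambda>v. y v + z v) = qform V E y + 2 * (\<Sum>v\<in>V. z v * (\<Sum>w\<in>nb E v. y w)) + qform V E z"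
  using sum_nb_swap[of y z]
  by (simp add: qform_def sum.distrib algebra_simps)

lemma qform_scale: "qform V E (\<lambda>v. c * y v) = c\<^sup>2 * qform V E y"
  by (simp add: qform_def sum_distrib_left power2_eq_square algebra_simps)

lemma qform_cong: "(\<And>v. v \<in> V \<Longrightarrow> y v = z v) \<Longrightarrow> qform V E y = qform V E z"
  using E_verts by (auto simp: qform_def intro!: sum.cong arg_cong2[where f = "(*)"])

lemma qform_le_abs: "qform V E y \<le> qform V E (\<lambda>v. \<bar>y v\<bar>)"
  unfolding qform_eq_indicator by (intro sum_mono) (auto simp: abs_mult[symmetric])

text \<open>A variational form of Perron's theorem. The form attains its maximum \<open>r\<close> on
  the sphere; passing to absolute values does not decrease it, so a maximiser may be taken
  nonnegative, and stationarity in each coordinate is the eigenvalue equation.\<close>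

lemma qform_maximizer:
  assumes "V \<noteq> {}"
  obtains x r where "\<And>v. 0 \<le> x v" "(\<Sum>v\<in>V. (x v)\<^sup>2) = 1"
    and "\<And>v. v \<in> V \<Longrightarrow> (\<Sum>w\<in>nb E v. x w) = r * x v"
    and "\<And>y. qform V E y \<le> r * (\<Sum>v\<in>V. (y v)\<^sup>2)"
proof -
  let ?S = "{y::'a \<Rightarrow> real. (\<forall>v. v \<notin> V \<longrightarrow> y v = 0) \<and> (\<Sum>v\<in>V. (y v)\<^sup>2) = 1}"
  obtain a where a: "a \<in> V" using assms by blast
  have "(\<Sum>v\<in>V. (if v = a then 1 else 0::real)\<^sup>2) = 1"
    using a finV by (simp add: if_distrib[where f = "\<lambda>x. x\<^sup>2"] cong: if_cong)
  then have "(\<lambda>v. if v = a then 1 else 0) \<in> ?S"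
    using a by auto
  then have ne: "?S \<noteq> {}" by (metis (no_types, lifting) empty_iff)
  have "continuous_on ?S (\<lambda>y. qform V E y)"
    unfolding qform_def by (intro continuous_intros continuous_on_coordinate)
  then obtain z where z: "z \<in> ?S" "\<And>y. y \<in> ?S \<Longrightarrow> qform V E y \<le> qform V E z"
    using continuous_attains_sup[OF compact_unit_sphere[OF finV] ne] by blast
  define r where "r = qform V E z"
  define x where "x v = \<bar>z v\<bar>" for v
  have xS: "x \<in> ?S" using z(1) by (simp add: x_def)
  have xr: "qform V E x = r"
    using z(2)[OF xS] qform_le_abs[of z] by (simp add: r_def x_def[abs_def])
  have bound: "qform V E y \<le> r * (\<Sum>v\<in>V. (y v)\<^sup>2)" for y
  proof (cases "(\<Sum>v\<in>V. (y v)\<^sup>2) = 0")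
    case True
    then have "\<And>v. v \<in> V \<Longrightarrow> y v = 0"
      using finV by (simp add: sum_nonneg_eq_0_iff)
    then show ?thesis using True by (simp add: qform_def)
  next
    case False
    define s where "s = (\<Sum>v\<in>V. (y v)\<^sup>2)"
    have s: "s > 0" using False by (simp add: s_def sum_nonneg less_le)
    define y' where "y' v = (if v \<in> V then (1 / sqrt s) * y v else 0)" for v
    have sq: "(\<Sum>v\<in>V. (y' v)\<^sup>2) = (1 / sqrt s)\<^sup>2 * s"
      unfolding s_def sum_distrib_left
      by (intro sum.cong) (auto simp: y'_def power_mult_distrib s_def power_divide)
    have "y' \<in> ?S" using sq s by (simp add: y'_def power_divide)
    then have "qform V E y' \<le> r" using z(2) r_def by blast
    moreover have "qform V E y' = qform V E (\<lambda>v. (1 / sqrt s) * y v)"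
      by (rule qform_cong) (simp add: y'_def)
    ultimately have "(1 / s) * qform V E y \<le> r"
      using qform_scale[of "1 / sqrt s" y] s by (simp add: power_divide)
    then show ?thesis using s by (simp add: field_simps s_def)
  qed
  have eig: "(\<Sum>w\<in>nb E v. x w) = r * x v" if v: "v \<in> V" for v
  proof -
    \<comment> \<open>The maximiser is perturbed in the coordinate \<open>v\<close> alone. As there
      are no loops, the form changes linearly in \<open>e\<close>, and the quadratic term
      \<open>- r * e\<^sup>2\<close> comes from the norm only.\<close>
    define d where "d u = (if u = v then 1 else 0::real)" for u
    have "2 * ((\<Sum>w\<in>nb E v. x w) - r * x v) * e + (- r) * e\<^sup>2 \<le> 0" for e
    proof -
      have single: "(\<Sum>u\<in>V. e * d u * f u) = e * f v" for f
      proof -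
        have "(\<Sum>u\<in>V. e * d u * f u) = (\<Sum>u\<in>V. if u = v then e * f v else 0)"
          by (rule sum.cong) (auto simp: d_def)
        then show ?thesis using v finV by simp
      qed
      have "qform V E (\<lambda>u. e * d u) = 0"
        unfolding qform_def single using irrefl by (auto simp: d_def intro!: sum.neutral)
      then have 1: "qform V E (\<lambda>u. x u + e * d u) = r + 2 * (e * (\<Sum>w\<in>nb E v. x w))"
        by (subst qform_add) (simp add: single xr)
      have "(\<Sum>u\<in>V. (x u + e * d u)\<^sup>2) = (\<Sum>u\<in>V. (x u)\<^sup>2 + e * d u * (2 * x u + e * d u))"
        by (rule sum.cong) (auto simp: power2_eq_square algebra_simps)
      also have "\<dots> = 1 + e * (2 * x v + e)"
        using xS unfolding sum.distrib single by (simp add: d_def)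
      finally have "qform V E (\<lambda>u. x u + e * d u) \<le> r * (1 + e * (2 * x v + e))"
        using bound by metis
      then show ?thesis
        unfolding 1 by (simp add: algebra_simps power2_eq_square)
    qed
    from quadratic_nonpos_imp_linear_zero[OF this] show ?thesis by simp
  qed
  show ?thesis
    by (rule that[of x r]) (use xS eig bound in \<open>auto simp: x_def\<close>)
qed

end

text \<open>By the triangle inequality the moduli of a complex eigenvector satisfy
  \<open>norm k * norm (c v) \<le> (\<Sum>w\<in>nb E v. norm (c w))\<close>; pairing with the moduli
  themselves bounds \<open>norm k\<close> by a Rayleigh quotient.\<close>

lemma (in fin_graph) eigenvalue_norm_le:
  fixes c :: "'a \<Rightarrow> complex"
  assumes "\<And>v. v \<in> V \<Longrightarrow> (\<Sum>w\<in>nb E v. c w) = k * c v"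
    and "a \<in> V" "c a \<noteq> 0"
    and "\<And>y. qform V E y \<le> r * (\<Sum>v\<in>V. (y v)\<^sup>2)"
  shows "norm k \<le> r"
proof -
  let ?s = "\<Sum>v\<in>V. (norm (c v))\<^sup>2"
  have "norm k * norm (c v) \<le> (\<Sum>w\<in>nb E v. norm (c w))" if "v \<in> V" for v
    using assms(1)[OF that] by (metis norm_mult norm_sum)
  then have "(\<Sum>v\<in>V. norm (c v) * (norm k * norm (c v))) \<le> qform V E (\<lambda>v. norm (c v))"
    unfolding qform_def by (intro sum_mono mult_left_mono) auto
  also have "\<dots> \<le> r * ?s" by (rule assms(4))
  finally have "norm k * ?s \<le> r * ?s"
    by (simp add: sum_distrib_left power2_eq_square algebra_simps)
  moreover have "0 < (norm (c a))\<^sup>2" using assms(3) by simp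
  then have "?s > 0"
    using member_le_sum[of a V "\<lambda>v. (norm (c v))\<^sup>2"] assms(2) finV
    by (meson less_le_trans zero_le_power2)
  ultimately show ?thesis by simp
qed

section \<open>The spectral radius as the maximum of the Rayleigh quotient\<close>

lemma fin_graph_pair_graph:
  assumes "pair_graph G"
  shows "fin_graph (pverts G) (parcs G)"
proof -
  interpret pair_graph G by fact
  show ?thesis
    by unfold_locales
      (use pair_finite_verts in_arcsD1 in_arcsD2 pair_no_loops arcs_symmetric in fastforce)+
qed

lemma adjacency_mat_mult_vec:
  assumes "fin_graph (pverts G) (parcs G)" "distinct vs" "set vs = pverts G" "i < length vs"
    and "\<And>j. j < length vs \<Longrightarrow> vec_index x j = c (vs ! j)" "dim_vec x = length vs"
  shows "vec_index (adjacency_mat G vs *\<^sub>v x) i = (\<Sum>w\<in>nb (parcs G) (vs ! i). c w)"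
proof -
  interpret fin_graph "pverts G" "parcs G" by fact
  have "vec_index (adjacency_mat G vs *\<^sub>v x) i
      = (\<Sum>j\<in>{0..<length vs}. (if (vs ! i, vs ! j) \<in> parcs G then 1 else 0) * c (vs ! j))"
    using assms(4,5,6) by (simp add: adjacency_mat_def scalar_prod_def)
  also have "\<dots> = (\<Sum>w\<in>pverts G. (if (vs ! i, w) \<in> parcs G then 1 else 0) * c w)"
    by (rule sum.reindex_bij_betw) (use bij_betw_nth[OF assms(2)] assms(3) in \<open>simp add: lessThan_atLeast0\<close>)
  also have "\<dots> = (\<Sum>w\<in>nb (parcs G) (vs ! i). c w)"
    by (rule sum_nb_indicator[OF finV EV])
  finally show ?thesis .
qed

text \<open>The maximum \<open>r\<close> of the Rayleigh quotient is an eigenvalue and dominates the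
  modulus of every complex eigenvalue, so it is the spectral radius of the complex matrix. From here
  on matrices no longer occur.\<close>

lemma graph_spectral_radius_eigenvector:
  assumes "pair_graph G" "pverts G \<noteq> {}"
  obtains x where "\<And>v. 0 \<le> x v" "(\<Sum>v\<in>pverts G. (x v)\<^sup>2) = 1"
    and "\<And>v. v \<in> pverts G \<Longrightarrow> (\<Sum>w\<in>nb (parcs G) v. x w) = graph_spectral_radius G * x v"
    and "\<And>y. qform (pverts G) (parcs G) y \<le> graph_spectral_radius G * (\<Sum>v\<in>pverts G. (y v)\<^sup>2)"
proof -
  note fg = fin_graph_pair_graph[OF assms(1)]
  interpret fin_graph "pverts G" "parcs G" by fact
  obtain x r where x: "\<And>v. 0 \<le> x v" "(\<Sum>v\<in>pverts G. (x v)\<^sup>2) = 1"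
    "\<And>v. v \<in> pverts G \<Longrightarrow> (\<Sum>w\<in>nb (parcs G) v. x w) = r * x v"
    "\<And>y. qform (pverts G) (parcs G) y \<le> r * (\<Sum>v\<in>pverts G. (y v)\<^sup>2)"
    using qform_maximizer[OF assms(2)] by metis
  obtain vs where vs: "distinct vs" "set vs = pverts G"
    using finite_distinct_list[OF finV] by blast
  let ?A = "adjacency_mat G vs" and ?n = "length vs"
  have dim: "?A \<in> carrier_mat ?n ?n" by (simp add: adjacency_mat_def)
  have n: "?n > 0" using vs assms(2) by auto
  have le: "norm k \<le> r" if "eigenvalue ?A k" for k
  proof -
    from that obtain z where z: "z \<in> carrier_vec ?n" "z \<noteq> 0\<^sub>v ?n" "?A *\<^sub>v z = k \<cdot>\<^sub>v z"
      using dim unfolding eigenvalue_def eigenvector_def by auto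
    \<comment> \<open>\<open>p\<close> inverts the enumeration \<open>vs\<close>, turning a vector
      indexed by positions into a function on vertices.\<close>
    define p where "p v = (THE i. i < ?n \<and> vs ! i = v)" for v
    have p: "p (vs ! i) = i" if "i < ?n" for i
      unfolding p_def by (rule the_equality) (use that vs(1) in \<open>auto simp: nth_eq_iff_index_eq\<close>)
    define c where "c v = vec_index z (p v)" for v
    have c: "vec_index z i = c (vs ! i)" if "i < ?n" for i
      using that by (simp add: c_def p)
    have "(\<Sum>w\<in>nb (parcs G) v. c w) = k * c v" if v: "v \<in> pverts G" for v
    proof -
      obtain i where i: "i < ?n" "vs ! i = v" using v vs(2) by (metis in_set_conv_nth)
      then show ?thesis
        using adjacency_mat_mult_vec[OF fg vs i(1), of z c] c z by simp
    qed
    moreover obtain i where "i < ?n" "vec_index z i \<noteq> 0"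
      using z(1,2) by (metis carrier_vecD eq_vecI index_zero_vec(1) index_zero_vec(2))
    ultimately show ?thesis
      using eigenvalue_norm_le[of c k "vs ! i" r] x(4) c vs(2) by (metis nth_mem)
  qed
  have "eigenvalue ?A (of_real r)"
  proof -
    define z where "z = vec ?n (\<lambda>i. complex_of_real (x (vs ! i)))"
    have "?A *\<^sub>v z = of_real r \<cdot>\<^sub>v z"
    proof (rule eq_vecI)
      fix i assume "i < dim_vec (complex_of_real r \<cdot>\<^sub>v z)"
      then have i: "i < ?n" by (simp add: z_def)
      have "vec_index (?A *\<^sub>v z) i = (\<Sum>w\<in>nb (parcs G) (vs ! i). complex_of_real (x w))"
        by (rule adjacency_mat_mult_vec[OF fg vs i]) (auto simp: z_def)
      also have "\<dots> = complex_of_real (r * x (vs ! i))"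
        using x(3)[of "vs ! i"] i vs(2) by (metis nth_mem of_real_sum)
      finally show "vec_index (?A *\<^sub>v z) i = vec_index (of_real r \<cdot>\<^sub>v z) i"
        using i by (simp add: z_def)
    qed (use dim in \<open>simp add: z_def\<close>)
    moreover have "z \<noteq> 0\<^sub>v ?n"
    proof
      assume "z = 0\<^sub>v ?n"
      then have "x (vs ! i) = 0" if "i < ?n" for i
        using that by (metis index_vec index_zero_vec(1) of_real_eq_0_iff z_def)
      then have "x v = 0" if "v \<in> pverts G" for v
        using that vs(2) by (metis in_set_conv_nth)
      then show False using x(2) by simp
    qed
    ultimately show ?thesis
      using dim unfolding eigenvalue_def eigenvector_def
      by (intro exI[of _ z]) (auto simp: z_def)
  qed
  \<comment> \<open>The bound \<open>norm r \<le> r\<close> says that \<open>r\<close> is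
    nonnegative, hence itself the modulus of an eigenvalue.\<close>
  moreover from this le have "norm (complex_of_real r) \<le> r" by blast
  ultimately have mem: "r \<in> norm ` spectrum ?A"
    using le[of "of_real r"] unfolding spectrum_def by (intro image_eqI[of _ _ "of_real r"]) auto
  have "spectral_radius ?A = r"
  proof (rule antisym)
    show "spectral_radius ?A \<le> r"
      using spectral_radius_mem_max(1)[OF dim n] le by (auto simp: spectrum_def)
    show "r \<le> spectral_radius ?A"
      by (rule spectral_radius_mem_max(2)[OF dim n mem])
  qed
  then have "graph_spectral_radius G = r"
    using graph_spectral_radius_eq[OF vs] by simp
  then show ?thesis using that x by blast
qed

section \<open>Connected vertex sets and star minors\<close>

text \<open>Connectedness without paths: no nonempty proper subset of \<open>B\<close> is closed
  under neighbours in \<open>B\<close>. Later arguments exhibit a closed set and conclude that it is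
  everything.\<close>

definition conn :: "('a \<times> 'a) set \<Rightarrow> 'a set \<Rightarrow> bool" where
  "conn E B \<longleftrightarrow> B \<noteq> {} \<and> (\<forall>X. X \<subseteq> B \<longrightarrow> X \<noteq> {} \<longrightarrow> E `` X \<inter> B \<subseteq> X \<longrightarrow> X = B)"

definition spreads :: "nat \<Rightarrow> ('a \<times> 'a) set \<Rightarrow> 'a set \<Rightarrow> bool" where
  "spreads t E V \<longleftrightarrow> (\<exists>B \<subseteq> V. conn E B \<and> t \<le> card (E `` B - B))"

lemma conn_closed_eq: "conn E B \<Longrightarrow> X \<subseteq> B \<Longrightarrow> X \<noteq> {} \<Longrightarrow> E `` X \<inter> B \<subseteq> X \<Longrightarrow> X = B"
  by (simp add: conn_def)

lemma conn_singleton: "conn E {v}"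
  by (auto simp: conn_def)

lemma conn_mono:
  assumes "conn E B" "E \<subseteq> E'"
  shows "conn E' B"
  unfolding conn_def
proof (intro conjI allI impI)
  show "B \<noteq> {}" using assms(1) by (simp add: conn_def)
  fix X assume "X \<subseteq> B" "X \<noteq> {}" "E' `` X \<inter> B \<subseteq> X"
  moreover from this have "E `` X \<inter> B \<subseteq> X" using assms(2) by blast
  ultimately show "X = B" using conn_closed_eq[OF assms(1)] by blast
qed

text \<open>A closed set meets each of \<open>A\<close> and \<open>B\<close> in nothing or in
  everything, and the edge between them forces the same alternative for both.\<close>

lemma conn_Un:
  assumes "conn E A" "conn E B" "a \<in> A" "b \<in> B" "(a, b) \<in> E" "(b, a) \<in> E"
  shows "conn E (A \<union> B)"
  unfolding conn_def
proof (intro conjI allI impI)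
  show "A \<union> B \<noteq> {}" using assms(3) by blast
  fix X assume X: "X \<subseteq> A \<union> B" "X \<noteq> {}" "E `` X \<inter> (A \<union> B) \<subseteq> X"
  have "X \<inter> A = {} \<or> X \<inter> A = A"
    using conn_closed_eq[OF assms(1), of "X \<inter> A"] X(3) by blast
  moreover have "X \<inter> B = {} \<or> X \<inter> B = B"
    using conn_closed_eq[OF assms(2), of "X \<inter> B"] X(3) by blast
  moreover have "a \<in> X \<longleftrightarrow> b \<in> X"
    using X(3) assms(3-6) by blast
  ultimately show "X = A \<union> B"
    using X(1,2) assms(3,4) by blast
qed

lemma conn_insert:
  assumes "conn E B" "b \<in> B" "(b, c) \<in> E" "(c, b) \<in> E"
  shows "conn E (insert c B)"
  using conn_Un[OF assms(1) conn_singleton[of E c] assms(2) _ assms(3,4)] by simp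

text \<open>The arcs are already symmetric, so \<open>mk_symmetric\<close> changes nothing. The set
  reachable from a vertex is closed, and a closed set contains all that is reachable from
  it.\<close>

lemma connected_iff_conn:
  assumes "pair_graph G"
  shows "Digraph_Component.connected (with_proj G) \<longleftrightarrow> conn (parcs G) (pverts G)"
proof -
  interpret pair_graph G by fact
  have arcs: "parcs (mk_symmetric (with_proj G)) = parcs G"
    using arcs_symmetric by (force simp: mk_symmetric_def)
  have verts: "pverts (mk_symmetric (with_proj G)) = pverts G"
    by (simp add: mk_symmetric_def)
  have eq: "Digraph_Component.connected (with_proj G) \<longleftrightarrow>
      pverts G \<noteq> {} \<and> (\<forall>u\<in>pverts G. \<forall>v\<in>pverts G. (u, v) \<in> rtrancl_on (pverts G) (parcs G))"
    by (simp add: connected_def strongly_connected_def reachable_def arcs verts)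
  show ?thesis
    unfolding eq
  proof
    assume "pverts G \<noteq> {}
      \<and> (\<forall>u\<in>pverts G. \<forall>v\<in>pverts G. (u, v) \<in> rtrancl_on (pverts G) (parcs G))"
    then have ne: "pverts G \<noteq> {}"
      and r: "\<forall>u\<in>pverts G. \<forall>v\<in>pverts G. (u, v) \<in> rtrancl_on (pverts G) (parcs G)"
      by blast+
    show "conn (parcs G) (pverts G)"
      unfolding conn_def
    proof (intro conjI allI impI ne)
      fix X assume X: "X \<subseteq> pverts G" "X \<noteq> {}" "parcs G `` X \<inter> pverts G \<subseteq> X"
      then obtain u where u: "u \<in> X" by blast
      have "v \<in> X" if "v \<in> pverts G" for v
      proof -
        have "(u, v) \<in> rtrancl_on (pverts G) (parcs G)" using r u X(1) that by blast
        then show ?thesis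
          by (induct rule: rtrancl_on_induct) (use u X(3) in auto)
      qed
      then show "X = pverts G" using X(1) by blast
    qed
  next
    assume c: "conn (parcs G) (pverts G)"
    have "(u, v) \<in> rtrancl_on (pverts G) (parcs G)" if "u \<in> pverts G" "v \<in> pverts G" for u v
    proof -
      let ?X = "{w. (u, w) \<in> rtrancl_on (pverts G) (parcs G)}"
      have "?X = pverts G"
        by (rule conn_closed_eq[OF c])
          (use that in \<open>auto dest: in_rtrancl_on_in_F intro: rtrancl_on_into_rtrancl_on\<close>)
      then show ?thesis using that by blast
    qed
    then show "pverts G \<noteq> {} \<and> (\<forall>u\<in>pverts G. \<forall>v\<in>pverts G. (u, v) \<in> rtrancl_on (pverts G) (parcs G))"
      using c by (simp add: conn_def)
  qed
qed

section \<open>Isomorphisms as injective vertex maps\<close>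

lemma digraph_iso_pairI:
  assumes "pair_graph G" "inj_on f (pverts G)" "pverts H = f ` pverts G"
    and "parcs H = map_prod f f ` parcs G"
  shows "digraph_iso (with_proj G) (with_proj H)"
proof -
  interpret pair_graph G by fact
  have inj: "inj_on (map_prod f f) (parcs G)"
  proof (rule inj_on_subset)
    show "inj_on (map_prod f f) (pverts G \<times> pverts G)"
      using assms(2) by (auto simp: inj_on_def)
    show "parcs G \<subseteq> pverts G \<times> pverts G"
      using in_arcsD1 in_arcsD2 by auto
  qed
  let ?h = "\<lparr>iso_verts = f, iso_arcs = map_prod f f, iso_head = snd, iso_tail = fst\<rparr>"
  have "digraph_isomorphism ?h"
    unfolding digraph_isomorphism_def using assms(2) inj wf_digraph by auto
  moreover have "with_proj H = app_iso ?h (with_proj G)"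
    using assms(3,4) by (simp add: with_proj_def app_iso_def)
  ultimately show ?thesis unfolding digraph_iso_def by blast
qed

text \<open>Arcs are pairs of vertices, so the arc component of an isomorphism is determined by its
  vertex component.\<close>

lemma digraph_iso_pairE:
  assumes "digraph_iso (with_proj G) (with_proj H)"
  obtains f where "inj_on f (pverts G)" "pverts H = f ` pverts G" "parcs H = map_prod f f ` parcs G"
proof -
  from assms obtain h where h: "pre_digraph.digraph_isomorphism (with_proj G) h"
    "with_proj H = app_iso h (with_proj G)"
    unfolding digraph_iso_def by blast
  have eq: "iso_tail h = fst" "iso_head h = snd" "pverts H = iso_verts h ` pverts G"
    "parcs H = iso_arcs h ` parcs G"
    using h(2) by (auto simp: with_proj_def app_iso_def)
  have "iso_arcs h a = map_prod (iso_verts h) (iso_verts h) a" if "a \<in> parcs G" for a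
    using h(1) that eq unfolding pre_digraph.digraph_isomorphism_def
    by (auto simp: prod_eq_iff)
  then have "parcs H = map_prod (iso_verts h) (iso_verts h) ` parcs G"
    unfolding eq(4) by (rule image_cong[OF refl])
  moreover have "inj_on (iso_verts h) (pverts G)"
    using h(1) unfolding pre_digraph.digraph_isomorphism_def by simp
  ultimately show ?thesis using that eq(3) by blast
qed

section \<open>Contractions and star minors\<close>

lemma verts_contract_edge:
  "pverts (contract_edge G u v) = (\<lambda>x. if x = v then u else x) ` pverts G"
  by (simp add: contract_edge_def Let_def)

lemma arcs_contract_edge:
  "(a, b) \<in> parcs (contract_edge G u v) \<longleftrightarrow>
    a \<noteq> b \<and> (\<exists>x y. (x, y) \<in> parcs G \<and> (if x = v then u else x) = a \<and> (if y = v then u else y) = b)"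
  unfolding contract_edge_def Let_def by auto

text \<open>Contracting edges amounts to collapsing disjoint connected sets, the fibres of \<open>\<phi>\<close>.\<close>

lemma contracts_to_fibres:
  assumes "contracts_to\<^sup>*\<^sup>* G K" "pair_graph G"
  shows "pair_graph K \<and> (\<exists>\<phi>. \<phi> ` pverts G = pverts K
    \<and> (\<forall>a\<in>pverts K. conn (parcs G) {v \<in> pverts G. \<phi> v = a})
    \<and> (\<forall>a b. (a, b) \<in> parcs K \<longrightarrow> (\<exists>v w. (v, w) \<in> parcs G \<and> \<phi> v = a \<and> \<phi> w = b)))"
  using assms(1)
proof (induct rule: rtranclp_induct)
  case base
  have "{v \<in> pverts G. id v = a} = {a}" if "a \<in> pverts G" for a using that by auto
  then show ?case using assms(2) by (intro conjI exI[of _ id]) (auto simp: conn_singleton)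
next
  case (step K K')
  then obtain \<phi> where K: "pair_graph K" and \<phi>: "\<phi> ` pverts G = pverts K"
    "\<And>a. a\<in>pverts K \<Longrightarrow> conn (parcs G) {v \<in> pverts G. \<phi> v = a}"
    "\<And>a b. (a, b) \<in> parcs K \<Longrightarrow> \<exists>v w. (v, w) \<in> parcs G \<and> \<phi> v = a \<and> \<phi> w = b"
    by blast
  obtain a b where ab: "(a, b) \<in> parcs K" "K' = contract_edge K a b"
    using step(2) unfolding contracts_to_def by blast
  interpret K: pair_graph K by fact
  interpret G: pair_graph G by fact
  have abK: "a \<in> pverts K" "b \<in> pverts K" "a \<noteq> b"
    using ab(1) K.in_arcsD1 K.in_arcsD2 K.pair_no_loops by fastforce+
  \<comment> \<open>Contracting \<open>ab\<close> composes \<phi> with \<open>f\<close>. Only the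
    fibre over \<open>a\<close> changes: it absorbs the fibre over \<open>b\<close>, and an edge of
    \<open>G\<close> over \<open>ab\<close> keeps the union connected.\<close>
  define f where "f x = (if x = b then a else x)" for x
  have "conn (parcs G) {v \<in> pverts G. (f \<circ> \<phi>) v = c}" if c: "c \<in> pverts K'" for c
  proof (cases "c = a")
    case True
    obtain v w where vw: "(v, w) \<in> parcs G" "\<phi> v = a" "\<phi> w = b" using \<phi>(3)[OF ab(1)] by blast
    have "conn (parcs G) ({v \<in> pverts G. \<phi> v = a} \<union> {v \<in> pverts G. \<phi> v = b})"
      by (rule conn_Un[OF \<phi>(2)[OF abK(1)] \<phi>(2)[OF abK(2)], of v w])
        (use vw G.in_arcsD1 G.in_arcsD2 G.arcs_symmetric in auto)
    moreover have "{v \<in> pverts G. \<phi> v = a} \<union> {v \<in> pverts G. \<phi> v = b} = {v \<in> pverts G. (f \<circ> \<phi>) v = c}"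
      using True by (auto simp: f_def)
    ultimately show ?thesis by simp
  next
    case False
    then have "c \<noteq> b" "c \<in> pverts K"
      using c abK unfolding ab(2) verts_contract_edge by (auto split: if_splits)
    then have "{v \<in> pverts G. (f \<circ> \<phi>) v = c} = {v \<in> pverts G. \<phi> v = c}"
      using False by (auto simp: f_def)
    then show ?thesis using \<phi>(2) \<open>c \<in> pverts K\<close> by simp
  qed
  moreover have "(f \<circ> \<phi>) ` pverts G = pverts K'"
    unfolding image_comp[symmetric] \<phi>(1) ab(2) verts_contract_edge f_def ..
  moreover have "\<exists>v w. (v, w) \<in> parcs G \<and> (f \<circ> \<phi>) v = p \<and> (f \<circ> \<phi>) w = q"
    if pq: "(p, q) \<in> parcs K'" for p q
  proof -
    obtain x y where "(x, y) \<in> parcs K" "f x = p" "f y = q"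
      using pq unfolding ab(2) arcs_contract_edge f_def by blast
    then show ?thesis using \<phi>(3)[of x y] by fastforce
  qed
  moreover have "pair_graph K'"
    unfolding ab(2) by (rule pair_graph_contract_edge[OF K ab(1)])
  ultimately show ?case by blast
qed

text \<open>Edges inside \<open>B\<close> are contracted one at a time until \<open>B\<close> is a
  single vertex, the centre; \<open>L\<close> stays independent and attached throughout, so what
  remains is exactly a star.\<close>

lemma contract_to_star:
  assumes "pair_graph G" "pverts G = B \<union> L" "B \<inter> L = {}" "conn (parcs G) B"
    and "\<And>l. l \<in> L \<Longrightarrow> \<exists>b\<in>B. (b, l) \<in> parcs G" "parcs G \<inter> L \<times> L = {}" "card L = t"
  shows "\<exists>K. contracts_to\<^sup>*\<^sup>* G K \<and> digraph_iso (with_proj K) (with_proj (star t))"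
  using assms
proof (induct "card B" arbitrary: B G rule: less_induct)
  case less
  interpret pair_graph G by (rule less.prems(1))
  have fin: "finite B" "finite L"
    using pair_finite_verts less.prems(2) by auto
  obtain b where b: "b \<in> B" using less.prems(4) by (auto simp: conn_def)
  show ?case
  proof (cases "B = {b}")
    case True
    obtain h where h: "bij_betw h L {1..t}"
      using fin(2) less.prems(7) by (metis finite_same_card_bij finite_atLeastAtMost card_atLeastAtMost diff_Suc_1)
    define f where "f v = (if v = b then 0 else h v)" for v
    have bL: "b \<notin> L" using less.prems(3) True by blast
    then have fL: "f v = h v" "h v \<in> {1..t}" if "v \<in> L" for v
      using that bij_betwE[OF h] by (auto simp: f_def)
    have him: "h ` L = {1..t}" using h by (simp add: bij_betw_def)
    have fim: "f ` L = {1..t}" using fL him by force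
    have fb: "f b = 0" by (simp add: f_def)
    have bl: "(b, l) \<in> parcs G \<and> (l, b) \<in> parcs G" if "l \<in> L" for l
      using less.prems(5)[OF that] True arcs_symmetric by auto
    have "parcs G \<subseteq> {b} \<times> L \<union> L \<times> {b}"
    proof
      fix e assume e: "e \<in> parcs G"
      then show "e \<in> {b} \<times> L \<union> L \<times> {b}"
        using pair_no_loops[OF e] arc_fst_in_verts[OF e] arc_snd_in_verts[OF e] less.prems(2,6) True
        by (cases e) auto
    qed
    then have arcs: "parcs G = {b} \<times> L \<union> L \<times> {b}" using bl by auto
    have "digraph_iso (with_proj G) (with_proj (star t))"
    proof (rule digraph_iso_pairI[OF less.prems(1)])
      have "inj_on h L" using h by (simp add: bij_betw_def)
      then have "inj_on f L" using fL(1) by (simp cong: inj_on_cong)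
      moreover have "f b \<notin> f ` (L - {b})" using fim bL by (simp add: fb)
      moreover have "pverts G = insert b L" unfolding less.prems(2) True by simp
      ultimately show "inj_on f (pverts G)" by simp
      show "pverts (star t) = f ` pverts G"
        unfolding less.prems(2) True image_Un fim by (auto simp: star_def fb)
      have "map_prod f f ` parcs G = {0} \<times> f ` L \<union> f ` L \<times> {0}"
        unfolding arcs image_Un by (auto simp: fb image_iff)
      then show "parcs (star t) = map_prod f f ` parcs G"
        unfolding fim by (simp add: star_def)
    qed
    then show ?thesis by blast
  next
    case False
    then have "\<not> parcs G `` {b} \<inter> B \<subseteq> {b}"
      using conn_closed_eq[OF less.prems(4), of "{b}"] b by blast
    then obtain c where c: "(b, c) \<in> parcs G" "c \<in> B" "c \<noteq> b" by blast
    let ?G = "contract_edge G b c"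
    define f where "f x = (if x = c then b else x)" for x
    have arcs: "(p, q) \<in> parcs ?G \<longleftrightarrow> p \<noteq> q \<and> (\<exists>x y. (x, y) \<in> parcs G \<and> f x = p \<and> f y = q)" for p q
      unfolding arcs_contract_edge f_def ..
    have fB: "f x \<in> B - {c}" if "x \<in> B" for x using that b c by (auto simp: f_def)
    have fL: "f x = x" if "x \<in> L" for x using that less.prems(3) c by (auto simp: f_def)
    have L: "x \<in> L" if "x \<in> pverts G" "f x \<in> L" for x
      using that less.prems(2,3) fB by blast
    have "\<exists>K. contracts_to\<^sup>*\<^sup>* ?G K \<and> digraph_iso (with_proj K) (with_proj (star t))"
    proof (rule less.hyps[of "B - {c}"])
      show "card (B - {c}) < card B" using fin(1) c(2) by (rule card_Diff1_less)
      show "pair_graph ?G" by (rule pair_graph_contract_edge[OF less.prems(1) c(1)])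
      show "pverts ?G = B - {c} \<union> L"
        unfolding verts_contract_edge less.prems(2) using b c less.prems(3) by auto
      show "(B - {c}) \<inter> L = {}" using less.prems(3) by blast
      show "conn (parcs ?G) (B - {c})"
        unfolding conn_def
      proof (intro conjI allI impI)
        show "B - {c} \<noteq> {}" using b c by blast
        fix X assume X: "X \<subseteq> B - {c}" "X \<noteq> {}" "parcs ?G `` X \<inter> (B - {c}) \<subseteq> X"
        \<comment> \<open>A closed set after the contraction lifts to a closed set before it once
          \<open>c\<close> is added exactly when the merged vertex \<open>b\<close> belongs to
          it.\<close>
        let ?X = "X \<union> (if b \<in> X then {c} else {})"
        have "?X = B"
        proof (rule conn_closed_eq[OF less.prems(4)])
          show "?X \<subseteq> B" "?X \<noteq> {}" using X c by auto
          have "y \<in> ?X" if "x \<in> ?X" "(x, y) \<in> parcs G" "y \<in> B" for x y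
          proof -
            have fx: "f x \<in> X" using that(1) X(1) c by (auto simp: f_def split: if_splits)
            have "f y \<in> X"
            proof (cases "f x = f y")
              case False
              then have "(f x, f y) \<in> parcs ?G" using that(2) unfolding arcs by blast
              then show ?thesis using X(3) fx fB[OF that(3)] by blast
            qed (use fx in simp)
            then show ?thesis by (auto simp: f_def split: if_splits)
          qed
          then show "parcs G `` ?X \<inter> B \<subseteq> ?X" by blast
        qed
        then show "X = B - {c}" using X(1) by (auto split: if_splits)
      qed
      show "\<exists>b'\<in>B - {c}. (b', l) \<in> parcs ?G" if l: "l \<in> L" for l
      proof -
        obtain x where x: "x \<in> B" "(x, l) \<in> parcs G" using less.prems(5)[OF l] by blast
        have "f x \<noteq> l" using fB[OF x(1)] l less.prems(3) by blast
        then have "(f x, l) \<in> parcs ?G" unfolding arcs using x(2) fL[OF l] by blast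
        then show ?thesis using fB[OF x(1)] by blast
      qed
      show "parcs ?G \<inter> L \<times> L = {}"
      proof -
        have False if "(p, q) \<in> parcs ?G" "p \<in> L" "q \<in> L" for p q
        proof -
          obtain x y where xy: "(x, y) \<in> parcs G" "f x = p" "f y = q"
            using \<open>(p, q) \<in> parcs ?G\<close> unfolding arcs by blast
          then show False using L[of x] L[of y] that in_arcsD1 in_arcsD2 less.prems(6) by blast
        qed
        then show ?thesis by auto
      qed
      show "card L = t" by (rule less.prems(7))
    qed
    moreover have "contracts_to G ?G" using c(1) unfolding contracts_to_def by blast
    ultimately show ?thesis by (metis converse_rtranclp_into_rtranclp)
  qed
qed

text \<open>In a star minor only the fibre of the centre matters: each leaf's fibre can be shrunk to
  one vertex adjacent to it. Conversely a spreading \<open>B\<close> is contracted to the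
  centre.\<close>

lemma is_minor_star_iff:
  assumes "pair_graph G"
  shows "is_minor (star t) G \<longleftrightarrow> spreads t (parcs G) (pverts G)"
proof
  interpret G: pair_graph G by fact
  assume "is_minor (star t) G"
  then obtain G' K where K: "pair_graph G'" "subgraph G' G" "contracts_to\<^sup>*\<^sup>* G' K"
    "digraph_iso (with_proj K) (with_proj (star t))"
    unfolding is_minor_def by blast
  have sub: "pverts G' \<subseteq> pverts G" "parcs G' \<subseteq> parcs G"
    using K(2) unfolding subgraph_def by auto
  obtain \<phi> where \<phi>: "\<phi> ` pverts G' = pverts K"
    "\<And>a. a\<in>pverts K \<Longrightarrow> conn (parcs G') {v \<in> pverts G'. \<phi> v = a}"
    "\<And>a b. (a, b) \<in> parcs K \<Longrightarrow> \<exists>v w. (v, w) \<in> parcs G' \<and> \<phi> v = a \<and> \<phi> w = b"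
    using contracts_to_fibres[OF K(3,1)] by blast
  obtain f where f: "inj_on f (pverts K)" "pverts (star t) = f ` pverts K"
    "parcs (star t) = map_prod f f ` parcs K"
    using digraph_iso_pairE[OF K(4)] by blast
  interpret G': pair_graph G' by (rule K(1))
  interpret K: pair_graph K using contracts_to_fibres[OF K(3,1)] by blast
  have "0 \<in> f ` pverts K" using f(2) by (auto simp: star_def)
  then obtain a where a: "a \<in> pverts K" "f a = 0" by auto
  let ?B = "{v \<in> pverts G'. \<phi> v = a}"
  have "\<exists>w. w \<in> parcs G' `` ?B \<and> f (\<phi> w) = i" if "i \<in> {1..t}" for i
  proof -
    have "(0, i) \<in> parcs (star t)" using that by (auto simp: star_def)
    then obtain p q where pq: "(p, q) \<in> parcs K" "f p = 0" "f q = i" unfolding f(3) by auto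
    then have "p = a" using a f(1) K.in_arcsD1 by (auto simp: inj_on_def)
    obtain v w where "(v, w) \<in> parcs G'" "\<phi> v = p" "\<phi> w = q" using \<phi>(3)[OF pq(1)] by blast
    then show ?thesis using \<open>p = a\<close> pq G'.in_arcsD1 by blast
  qed
  then obtain g where g: "\<And>i. i \<in> {1..t} \<Longrightarrow> g i \<in> parcs G' `` ?B" "\<And>i. i \<in> {1..t} \<Longrightarrow> f (\<phi> (g i)) = i"
    by metis
  have "inj_on g {1..t}" by (rule inj_on_inverseI[of _ "f \<circ> \<phi>"]) (use g(2) in auto)
  moreover have "g ` {1..t} \<subseteq> parcs G `` ?B - ?B"
    using g a(2) sub by fastforce
  moreover have "finite (parcs G `` ?B - ?B)"
  proof (rule finite_subset)
    show "parcs G `` ?B - ?B \<subseteq> pverts G" using G.in_arcsD2 by blast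
  qed (rule G.pair_finite_verts)
  ultimately have "t \<le> card (parcs G `` ?B - ?B)"
    using card_inj_on_le[of g "{1..t}"] by simp
  moreover have "conn (parcs G) ?B" by (rule conn_mono[OF \<phi>(2)[OF a(1)] sub(2)])
  moreover have "?B \<subseteq> pverts G" using sub(1) by blast
  ultimately show "spreads t (parcs G) (pverts G)" unfolding spreads_def by blast
next
  interpret G: pair_graph G by fact
  assume "spreads t (parcs G) (pverts G)"
  then obtain B where B: "B \<subseteq> pverts G" "conn (parcs G) B" "t \<le> card (parcs G `` B - B)"
    unfolding spreads_def by blast
  obtain L where L: "L \<subseteq> parcs G `` B - B" "card L = t" "finite L"
    using obtain_subset_with_card_n[OF B(3)] by metis
  \<comment> \<open>Contraction keeps all edges between distinct fibres, so the edges inside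
    \<open>L\<close> have to be dropped beforehand.\<close>
  define G' where "G' = \<lparr> pverts = B \<union> L, parcs = parcs G \<inter> (B \<times> B \<union> B \<times> L \<union> L \<times> B) \<rparr>"
  have V: "pverts G' = B \<union> L" and E: "parcs G' = parcs G \<inter> (B \<times> B \<union> B \<times> L \<union> L \<times> B)"
    by (simp_all add: G'_def)
  have "sym (parcs G')" unfolding E sym_def using G.arcs_symmetric by blast
  moreover have "finite (parcs G')" unfolding E using G.pair_finite_arcs by blast
  moreover have "finite (pverts G')"
    unfolding V using finite_subset[OF B(1) G.pair_finite_verts] L(3) by blast
  ultimately have pg: "pair_graph G'"
    by unfold_locales (auto simp: V E symmetric_def dest: G.pair_no_loops)
  have "conn (parcs G') B"
    unfolding conn_def
  proof (intro conjI allI impI)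
    show "B \<noteq> {}" using B(2) by (simp add: conn_def)
    fix X assume X: "X \<subseteq> B" "X \<noteq> {}" "parcs G' `` X \<inter> B \<subseteq> X"
    then have "parcs G `` X \<inter> B \<subseteq> X" unfolding E by blast
    then show "X = B" using conn_closed_eq[OF B(2)] X by blast
  qed
  then have "\<exists>K. contracts_to\<^sup>*\<^sup>* G' K \<and> digraph_iso (with_proj K) (with_proj (star t))"
    by (intro contract_to_star[OF pg V]) (use L in \<open>auto simp: E\<close>)
  moreover have "subgraph (with_proj G') (with_proj G)"
  proof -
    interpret G': pair_graph G' by fact
    show ?thesis
      unfolding subgraph_def compatible_def
      using B(1) L(1) G.in_arcsD2 G.wf_digraph G'.wf_digraph by (auto simp: V E)
  qed
  ultimately show "is_minor (star t) G"
    unfolding is_minor_def using pg by blast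
qed

section \<open>Comparison with competing graphs\<close>

text \<open>The candidates live on \<open>nat\<close> or \<open>nat \<times> nat\<close>, whereas
  maximality of G only speaks about graphs on G's own vertex type; they are copied along a bijection
  onto G's vertices.\<close>

definition map_graph :: "('a \<Rightarrow> 'b) \<Rightarrow> 'a pair_pre_digraph \<Rightarrow> 'b pair_pre_digraph" where
  "map_graph f G = \<lparr> pverts = f ` pverts G, parcs = map_prod f f ` parcs G \<rparr>"

lemma map_graph_simps [simp]:
  "pverts (map_graph f G) = f ` pverts G"
  "parcs (map_graph f G) = map_prod f f ` parcs G"
  by (simp_all add: map_graph_def)

context
  fixes f :: "'a \<Rightarrow> 'b" and V :: "'a set" and E :: "('a \<times> 'a) set"
  assumes inj: "inj_on f V" and EV: "E \<subseteq> V \<times> V"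
begin

lemma map_arcs_Image:
  assumes "B \<subseteq> V"
  shows "(map_prod f f ` E) `` (f ` B) = f ` (E `` B)"
proof
  show "(map_prod f f ` E) `` (f ` B) \<subseteq> f ` (E `` B)"
  proof
    fix q assume "q \<in> (map_prod f f ` E) `` (f ` B)"
    then obtain v a b where vab: "v \<in> B" "(a, b) \<in> E" "f v = f a" "q = f b" by auto
    then have "v = a" using inj_onD[OF inj] EV assms by blast
    then show "q \<in> f ` (E `` B)" using vab by blast
  qed
qed force

lemma nb_map_arcs: "v \<in> V \<Longrightarrow> nb (map_prod f f ` E) (f v) = f ` nb E v"
  using map_arcs_Image[of "{v}"] by (simp add: nb_def)

lemma conn_map_iff:
  assumes "B \<subseteq> V"
  shows "conn (map_prod f f ` E) (f ` B) \<longleftrightarrow> conn E B"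
proof
  have inj_sub: "f ` X = f ` Y \<Longrightarrow> X \<subseteq> V \<Longrightarrow> Y \<subseteq> V \<Longrightarrow> X = Y" for X Y
    using inj by (simp add: inj_on_image_eq_iff)
  have closed: "(map_prod f f ` E) `` (f ` X) \<inter> f ` B \<subseteq> f ` X \<longleftrightarrow> E `` X \<inter> B \<subseteq> X" if "X \<subseteq> B" for X
  proof -
    have X: "X \<subseteq> V" using that assms by blast
    have EX: "E `` X \<subseteq> V" using EV by blast
    have "(map_prod f f ` E) `` (f ` X) \<inter> f ` B = f ` (E `` X \<inter> B)"
      unfolding map_arcs_Image[OF X] inj_on_image_Int[OF inj EX assms] ..
    moreover have "f a \<in> f ` X \<longleftrightarrow> a \<in> X" if "a \<in> E `` X \<inter> B" for a
      using inj_on_image_mem_iff[OF inj _ X] that assms by blast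
    ultimately show ?thesis by (auto simp: image_subset_iff)
  qed
  show "conn E B" if c: "conn (map_prod f f ` E) (f ` B)"
    unfolding conn_def
  proof (intro conjI allI impI)
    show "B \<noteq> {}" using c by (auto simp: conn_def)
    fix X assume X: "X \<subseteq> B" "X \<noteq> {}" "E `` X \<inter> B \<subseteq> X"
    then have "f ` X = f ` B"
      using closed[OF X(1)] by (intro conn_closed_eq[OF c]) auto
    then show "X = B" using inj_sub X(1) assms by blast
  qed
  show "conn (map_prod f f ` E) (f ` B)" if c: "conn E B"
    unfolding conn_def
  proof (intro conjI allI impI)
    show "f ` B \<noteq> {}" using c by (auto simp: conn_def)
    fix Y assume Y: "Y \<subseteq> f ` B" "Y \<noteq> {}" "(map_prod f f ` E) `` Y \<inter> f ` B \<subseteq> Y"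
    then obtain X where X: "X \<subseteq> B" "Y = f ` X" by (meson subset_imageE)
    then have "X = B"
      using closed[OF X(1)] Y by (intro conn_closed_eq[OF c]) auto
    then show "Y = f ` B" using X(2) by simp
  qed
qed

lemma spreads_map_iff: "spreads t (map_prod f f ` E) (f ` V) \<longleftrightarrow> spreads t E V"
proof -
  have "conn (map_prod f f ` E) (f ` B) \<and> t \<le> card ((map_prod f f ` E) `` (f ` B) - f ` B)
      \<longleftrightarrow> conn E B \<and> t \<le> card (E `` B - B)" if B: "B \<subseteq> V" for B
  proof -
    have EB: "E `` B \<subseteq> V" using EV by blast
    have "(map_prod f f ` E) `` (f ` B) - f ` B = f ` (E `` B - B)"
      unfolding map_arcs_Image[OF B] using inj_on_image_set_diff[OF inj, of "E `` B" B] EB B by blast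
    moreover have "card (f ` (E `` B - B)) = card (E `` B - B)"
      by (rule card_image[OF inj_on_subset[OF inj]]) (use EB in blast)
    ultimately show ?thesis using conn_map_iff[OF B] by simp
  qed
  then show ?thesis
    unfolding spreads_def by (metis (no_types, opaque_lifting) image_mono subset_imageE)
qed

lemma qform_map:
  assumes "finite V"
  shows "qform (f ` V) (map_prod f f ` E) y = qform V E (y \<circ> f)"
proof -
  have "(\<Sum>w\<in>nb (map_prod f f ` E) (f v). y w) = (\<Sum>w\<in>nb E v. y (f w))" if "v \<in> V" for v
    unfolding nb_map_arcs[OF that]
    by (rule sum.reindex_cong[OF inj_on_subset[OF inj]]) (use nb_subset[OF EV] in auto)
  then show ?thesis
    unfolding qform_def by (subst sum.reindex[OF inj]) simp
qed

end

lemma pair_graph_map_graph: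
  assumes "pair_graph G" "inj_on f (pverts G)"
  shows "pair_graph (map_graph f G)"
proof -
  interpret pair_graph G by fact
  have "sym (map_prod f f ` parcs G)"
    unfolding sym_def using arcs_symmetric by force
  moreover have "f x \<noteq> f y" if "(x, y) \<in> parcs G" for x y
    using inj_onD[OF assms(2), of x y] in_arcsD1[OF that] in_arcsD2[OF that] pair_no_loops[OF that]
    by auto
  ultimately show ?thesis
    using pair_finite_verts pair_finite_arcs
    by unfold_locales (auto simp: symmetric_def dest: in_arcsD1 in_arcsD2)
qed

section \<open>Admissible competitors and extremal graphs\<close>

definition admissible :: "nat \<Rightarrow> nat \<Rightarrow> 'a pair_pre_digraph \<Rightarrow> bool" where
  "admissible n t G \<longleftrightarrow> pair_graph G \<and> card (pverts G) = n \<and> conn (parcs G) (pverts G)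
     \<and> \<not> spreads t (parcs G) (pverts G)"

lemma admissible_iff:
  "pair_graph G \<and> card (pverts G) = n \<and> Digraph_Component.connected (with_proj G)
     \<and> minor_free (star t) G \<longleftrightarrow> admissible n t G"
  using connected_iff_conn is_minor_star_iff unfolding admissible_def by blast

lemma pair_graph_arcs_subset: "pair_graph G \<Longrightarrow> parcs G \<subseteq> pverts G \<times> pverts G"
  using fin_graph.EV[OF fin_graph_pair_graph] .

lemma admissible_map_graph:
  assumes "admissible n t G" "inj_on f (pverts G)"
  shows "admissible n t (map_graph f G)"
proof -
  have "parcs G \<subseteq> pverts G \<times> pverts G"
    using assms(1) pair_graph_arcs_subset by (auto simp: admissible_def)
  then show ?thesis
    using assms conn_map_iff[OF assms(2), of "parcs G" "pverts G"] pair_graph_map_graph[of G f]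
      spreads_map_iff[OF assms(2), of "parcs G" t] card_image[OF assms(2)]
    by (simp add: admissible_def)
qed

locale extremal =
  fixes n t :: nat and G :: "'a pair_pre_digraph"
  assumes adm: "admissible n t G"
    and maximal: "\<And>H :: 'a pair_pre_digraph. admissible n t H \<Longrightarrow> graph_spectral_radius H \<le> graph_spectral_radius G"
    and n_pos: "n > 0"
begin

abbreviation "V \<equiv> pverts G"
abbreviation "E \<equiv> parcs G"
abbreviation "\<rho> \<equiv> graph_spectral_radius G"

sublocale fin_graph V E
  using adm fin_graph_pair_graph by (auto simp: admissible_def)

lemma pg: "pair_graph G" and cardV: "card V = n" and connV: "conn E V"
  and no_spread: "\<not> spreads t E V"
  using adm by (auto simp: admissible_def)

lemma bij_exists:
  assumes "admissible n t H"
  obtains f where "bij_betw f (pverts H) V"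
proof -
  have "finite (pverts H)" using assms n_pos unfolding admissible_def by (metis card.infinite less_numeral_extra(3))
  then show ?thesis
    using that finite_same_card_bij[of "pverts H" V] finV assms cardV by (auto simp: admissible_def)
qed

text \<open>Where a nonnegative eigenvector vanishes, its neighbour sum vanishes too. The zero set
  is thus closed under neighbours, and by connectedness it is empty or everything.\<close>

lemma positive_eigenvector:
  obtains x where "\<And>v. v \<in> V \<Longrightarrow> 0 < x v"
    and "\<And>v. v \<in> V \<Longrightarrow> (\<Sum>w\<in>nb E v. x w) = \<rho> * x v"
proof -
  have ne: "V \<noteq> {}" using connV by (simp add: conn_def)
  obtain x where x: "\<And>v. 0 \<le> x v" "(\<Sum>v\<in>V. (x v)\<^sup>2) = 1"
    "\<And>v. v \<in> V \<Longrightarrow> (\<Sum>w\<in>nb E v. x w) = \<rho> * x v"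
    using graph_spectral_radius_eigenvector[OF pg ne] by metis
  have "0 < x v" if "v \<in> V" for v
  proof (rule ccontr)
    assume "\<not> 0 < x v"
    then have xv: "x v = 0" using x(1)[of v] by simp
    let ?Z = "{v \<in> V. x v = 0}"
    have "x w = 0" if "u \<in> V" "x u = 0" "(u, w) \<in> E" for u w
    proof -
      have "(\<Sum>w\<in>nb E u. x w) = 0" using x(3)[OF that(1)] that(2) by simp
      then show ?thesis using x(1) that(3) by (simp add: sum_nonneg_eq_0_iff)
    qed
    then have "?Z = V"
      by (intro conn_closed_eq[OF connV]) (use xv that in auto)
    then have "(\<Sum>v\<in>V. (x v)\<^sup>2) = 0" by (intro sum.neutral) auto
    then show False using x(2) by simp
  qed
  then show ?thesis using that x(3) by blast
qed

text \<open>By maximality the Rayleigh quotient of \<open>y\<close> on \<open>H\<close> is at most \<open>\<rho>\<close>.\<close>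

lemma test_vector:
  assumes H: "admissible n t H" and y: "\<And>v. v \<in> pverts H \<Longrightarrow> 0 \<le> y v"
    and sub: "\<And>v. v \<in> pverts H \<Longrightarrow> \<rho> * y v \<le> (\<Sum>w\<in>nb (parcs H) v. y w)"
    and v: "v \<in> pverts H" "0 < y v"
  shows "(\<Sum>w\<in>nb (parcs H) v. y w) = \<rho> * y v"
proof -
  obtain f where f: "bij_betw f (pverts H) V" using bij_exists[OF H] by blast
  then have inj: "inj_on f (pverts H)" by (simp add: bij_betw_def)
  have pgH: "pair_graph H" using H by (simp add: admissible_def)
  interpret H: fin_graph "pverts H" "parcs H" by (rule fin_graph_pair_graph[OF pgH])
  let ?M = "map_graph f H"
  have M: "admissible n t ?M" by (rule admissible_map_graph[OF H inj])
  then have pgM: "pair_graph ?M" and neM: "pverts ?M \<noteq> {}"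
    by (auto simp: admissible_def conn_def)
  have "qform (pverts ?M) (parcs ?M) z \<le> graph_spectral_radius ?M * (\<Sum>v\<in>pverts ?M. (z v)\<^sup>2)" for z
    using graph_spectral_radius_eigenvector[OF pgM neM] by metis
  then have le: "qform (pverts ?M) (parcs ?M) z \<le> \<rho> * (\<Sum>v\<in>pverts ?M. (z v)\<^sup>2)" for z
    using mult_right_mono[OF maximal[OF M] sum_nonneg[of "pverts ?M" "\<lambda>v. (z v)\<^sup>2"]]
    by (meson order_trans zero_le_power2)
  define g where "g = y \<circ> the_inv_into (pverts H) f"
  have g: "g (f u) = y u" if "u \<in> pverts H" for u
    using the_inv_into_f_f[OF inj that] by (simp add: g_def)
  have "qform (pverts ?M) (parcs ?M) g = qform (pverts H) (parcs H) y"
    unfolding map_graph_simps qform_map[OF inj H.EV H.finV] by (rule H.qform_cong) (simp add: g)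
  moreover have "(\<Sum>v\<in>pverts ?M. (g v)\<^sup>2) = (\<Sum>v\<in>pverts H. (y v)\<^sup>2)"
    unfolding map_graph_simps by (subst sum.reindex[OF inj]) (simp add: g)
  ultimately have "qform (pverts H) (parcs H) y \<le> \<rho> * (\<Sum>v\<in>pverts H. (y v)\<^sup>2)"
    using le[of g] by simp
  \<comment> \<open>The Rayleigh bound makes this sum nonpositive, while \<open>sub\<close> makes
    every term nonnegative; hence all terms vanish.\<close>
  then have "(\<Sum>v\<in>pverts H. y v * ((\<Sum>w\<in>nb (parcs H) v. y w) - \<rho> * y v)) \<le> 0"
    unfolding qform_def sum_distrib_left
    by (simp add: algebra_simps power2_eq_square sum_subtractf sum_distrib_left)
  moreover have nn: "0 \<le> y v * ((\<Sum>w\<in>nb (parcs H) v. y w) - \<rho> * y v)" if "v \<in> pverts H" for v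
    using y sub that by simp
  ultimately have "(\<Sum>v\<in>pverts H. y v * ((\<Sum>w\<in>nb (parcs H) v. y w) - \<rho> * y v)) = 0"
    by (meson antisym sum_nonneg)
  then have "y v * ((\<Sum>w\<in>nb (parcs H) v. y w) - \<rho> * y v) = 0"
    using nn v(1) H.finV by (simp add: sum_nonneg_eq_0_iff)
  then show ?thesis using v(2) by simp
qed

text \<open>The Perron vector of G, carried to H, is a positive test vector. An edge of H outside
  the image of G would make one of its inequalities strict.\<close>

lemma iso_of_embedding:
  assumes H: "admissible n t H" and f: "bij_betw f V (pverts H)"
    and sub: "\<And>v w. (v, w) \<in> E \<Longrightarrow> (f v, f w) \<in> parcs H"
  shows "digraph_iso (with_proj G) (with_proj H)"
proof -
  obtain x where x: "\<And>v. v \<in> V \<Longrightarrow> 0 < x v" "\<And>v. v \<in> V \<Longrightarrow> (\<Sum>w\<in>nb E v. x w) = \<rho> * x v"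
    using positive_eigenvector by blast
  have inj: "inj_on f V" and im: "f ` V = pverts H" using f by (auto simp: bij_betw_def)
  have pgH: "pair_graph H" using H by (simp add: admissible_def)
  interpret H: fin_graph "pverts H" "parcs H" by (rule fin_graph_pair_graph[OF pgH])
  define y where "y = x \<circ> the_inv_into V f"
  have y: "y (f v) = x v" if "v \<in> V" for v
    using the_inv_into_f_f[OF inj that] by (simp add: y_def)
  have ypos: "0 < y p" if "p \<in> pverts H" for p
  proof -
    from that im obtain v where "v \<in> V" "p = f v" by blast
    then show ?thesis using y x(1) by simp
  qed
  have sum_image: "(\<Sum>p\<in>f ` nb E v. y p) = \<rho> * y (f v)" if v: "v \<in> V" for v
  proof -
    have "(\<Sum>p\<in>f ` nb E v. y p) = (\<Sum>w\<in>nb E v. x w)"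
      by (rule sum.reindex_cong[OF inj_on_subset[OF inj]]) (use E_verts y in auto)
    then show ?thesis using x(2) y v by simp
  qed
  have image_sub: "f ` nb E v \<subseteq> nb (parcs H) (f v)" for v using sub by auto
  have ge: "\<rho> * y p \<le> (\<Sum>q\<in>nb (parcs H) p. y q)" if p: "p \<in> pverts H" for p
  proof -
    obtain v where v: "v \<in> V" "p = f v" using p im by blast
    have "(\<Sum>q\<in>f ` nb E v. y q) \<le> (\<Sum>q\<in>nb (parcs H) p. y q)"
    proof (rule sum_mono2)
      show "f ` nb E v \<subseteq> nb (parcs H) p" using image_sub v(2) by blast
    qed (use ypos H.E_verts in \<open>auto intro: less_imp_le\<close>)
    then show ?thesis using sum_image v by simp
  qed
  have eq: "(\<Sum>q\<in>nb (parcs H) p. y q) = \<rho> * y p" if "p \<in> pverts H" for p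
    by (rule test_vector[OF H]) (use ypos ge that in \<open>auto intro: less_imp_le\<close>)
  have "nb (parcs H) (f v) = f ` nb E v" if v: "v \<in> V" for v
  proof (rule ccontr)
    assume "\<not> ?thesis"
    then obtain q where q: "q \<in> nb (parcs H) (f v) - f ` nb E v" using image_sub by blast
    have "(\<Sum>q\<in>f ` nb E v. y q) < (\<Sum>q\<in>nb (parcs H) (f v). y q)"
      by (rule sum_strict_mono2[where b = q])
        (use image_sub q ypos H.E_verts in \<open>auto intro: less_imp_le\<close>)
    then show False using sum_image[OF v] eq[of "f v"] im v by auto
  qed
  note nb_eq = this
  have "parcs H = map_prod f f ` E"
  proof
    show "parcs H \<subseteq> map_prod f f ` E"
    proof
      fix e assume e: "e \<in> parcs H"
      obtain p q where pq: "e = (p, q)" by (cases e)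
      then obtain v where v: "v \<in> V" "p = f v" using e H.E_verts(1) im by blast
      then have "q \<in> f ` nb E v" using e pq nb_eq[OF v(1)] by auto
      then show "e \<in> map_prod f f ` E" using pq v by auto
    qed
  qed (use sub in auto)
  then show ?thesis
    using digraph_iso_pairI[OF pg inj] im by simp
qed

end

lemma extremalI:
  fixes G :: "'a pair_pre_digraph"
  assumes "is_arg_max graph_spectral_radius
           (\<lambda>H. pair_graph H \<and> card (pverts H) = n \<and> Digraph_Component.connected (with_proj H)
                \<and> minor_free (star t) H) G" "n > 0"
  shows "extremal n t G"
  using assms unfolding admissible_iff is_arg_max_def by unfold_locales (auto simp: not_less)

section \<open>The subdivided complete graph\<close>

fun path_arcs :: "'a list \<Rightarrow> ('a \<times> 'a) set" where
  "path_arcs (x # y # zs) = {(x, y), (y, x)} \<union> path_arcs (y # zs)"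
| "path_arcs _ = {}"

text \<open>Every step subdivides the last segment, from the newest vertex to \<open>v\<close>, so
  the arcs added for that segment are removed again by the next step.\<close>

lemma arcs_subdivide_edge:
  assumes "pair_graph G" "(u, v) \<in> parcs G" "distinct ws" "set ws \<inter> pverts G = {}"
  shows "parcs (subdivide_edge G (u, v) ws) = parcs G - {(u, v), (v, u)} \<union> path_arcs (u # ws @ [v])"
  using assms
proof (induction ws arbitrary: G u)
  case Nil
  interpret pair_graph G by fact
  show ?case using Nil.prems(2) arcs_symmetric by auto
next
  case (Cons w ws)
  interpret pair_graph G by fact
  have uv: "u \<noteq> v" "w \<noteq> u" "w \<noteq> v"
    using pair_no_loops[OF Cons.prems(2)] in_arcsD1[OF Cons.prems(2)] in_arcsD2[OF Cons.prems(2)]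
      Cons.prems(4) by auto
  have w: "(w, v) \<notin> parcs G" "(v, w) \<notin> parcs G"
    using Cons.prems(4) in_arcsD1 in_arcsD2 by auto
  have pg: "pair_graph (subdivide G (u, v) w)"
    using Cons.prems by (intro pair_graph_subdivide) auto
  have "parcs (subdivide_edge (subdivide G (u, v) w) (w, v) ws)
      = parcs (subdivide G (u, v) w) - {(w, v), (v, w)} \<union> path_arcs (w # ws @ [v])"
    by (rule Cons.IH[OF pg]) (use Cons.prems(3,4) in auto)
  moreover have "parcs (subdivide G (u, v) w) - {(w, v), (v, w)}
      = parcs G - {(u, v), (v, u)} \<union> {(u, w), (w, u)}"
    using uv w by auto
  ultimately show ?case by auto
qed

lemma mem_path_arcs_upt:
  assumes "m < n"
  shows "(a, b) \<in> path_arcs (u # [m..<n] @ [v]) \<longleftrightarrow>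
    (a = u \<and> b = m) \<or> (a = m \<and> b = u) \<or> (a = n - 1 \<and> b = v) \<or> (a = v \<and> b = n - 1)
    \<or> (m \<le> a \<and> b = Suc a \<and> b < n) \<or> (m \<le> b \<and> a = Suc b \<and> a < n)"
  using assms
proof (induction "n - m" arbitrary: m u)
  case (Suc d)
  show ?case
  proof (cases "Suc m = n")
    case True
    then have "[m..<n] = [m]" using upt_rec[of m n] by simp
    then show ?thesis using True by auto
  next
    case False
    then have lt: "Suc m < n" using Suc.prems by simp
    have "[m..<n] = m # [Suc m..<n]" using Suc.prems by (rule upt_conv_Cons)
    then have "(a, b) \<in> path_arcs (u # [m..<n] @ [v]) \<longleftrightarrow>
        (a, b) = (u, m) \<or> (a, b) = (m, u) \<or> (a, b) \<in> path_arcs (m # [Suc m..<n] @ [v])"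
      by simp
    also have "\<dots> \<longleftrightarrow> (a = u \<and> b = m) \<or> (a = m \<and> b = u) \<or> (a = n - 1 \<and> b = v)
        \<or> (a = v \<and> b = n - 1) \<or> (m \<le> a \<and> b = Suc a \<and> b < n) \<or> (m \<le> b \<and> a = Suc b \<and> a < n)"
    proof -
      have IH: "(a, b) \<in> path_arcs (m # [Suc m..<n] @ [v]) \<longleftrightarrow>
        (a = m \<and> b = Suc m) \<or> (a = Suc m \<and> b = m) \<or> (a = n - 1 \<and> b = v) \<or> (a = v \<and> b = n - 1)
        \<or> (Suc m \<le> a \<and> b = Suc a \<and> b < n) \<or> (Suc m \<le> b \<and> a = Suc b \<and> a < n)"
        by (rule Suc.hyps(1)) (use Suc.hyps(2) lt in auto)
      have e1: "m \<le> a \<and> b = Suc a \<and> b < n \<longleftrightarrow>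
          (a = m \<and> b = Suc m) \<or> (Suc m \<le> a \<and> b = Suc a \<and> b < n)"
        using lt unfolding le_eq_less_or_eq[of m] Suc_le_eq by metis
      have e2: "m \<le> b \<and> a = Suc b \<and> a < n \<longleftrightarrow>
          (a = Suc m \<and> b = m) \<or> (Suc m \<le> b \<and> a = Suc b \<and> a < n)"
        using lt unfolding le_eq_less_or_eq[of m] Suc_le_eq by metis
      show ?thesis unfolding IH prod.inject e1 e2 by (simp only: disj_ac)
    qed
    finally show ?thesis .
  qed
qed simp

lemma pair_graph_complete_graph: "pair_graph (complete_graph t)"
proof -
  have "finite (parcs (complete_graph t))"
    by (rule finite_subset[of _ "{..<t} \<times> {..<t}"]) (auto simp: complete_graph_def)
  moreover have "sym (parcs (complete_graph t))"
    by (auto simp: complete_graph_def sym_def)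
  ultimately show ?thesis
    by unfold_locales (auto simp: complete_graph_def symmetric_def)
qed

locale subdivided_clique =
  fixes n t :: nat
  assumes t3: "3 \<le> t" and nt: "t < n"
begin

abbreviation "S \<equiv> subdivided_complete_graph (n - t) t"

text \<open>Layout used throughout: \<open>{..<t}\<close> is the core, a clique without the edge 01,
  and the path runs 0, t, t + 1, ..., n - 1, 1.\<close>

lemma S_verts: "pverts S = {..<n}" and pair_graph_S: "pair_graph S"
  and S_arcs: "(a, b) \<in> parcs S \<longleftrightarrow> a < t \<and> b < t \<and> a \<noteq> b \<and> \<not> (a < 2 \<and> b < 2)
    \<or> (a = 0 \<and> b = t) \<or> (a = t \<and> b = 0) \<or> (a = n - 1 \<and> b = 1) \<or> (a = 1 \<and> b = n - 1)
    \<or> (t \<le> a \<and> b = Suc a \<and> b < n) \<or> (t \<le> b \<and> a = Suc b \<and> a < n)"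
proof -
  have uv: "(0, 1) \<in> parcs (complete_graph t)" using t3 by (simp add: complete_graph_def)
  have d: "distinct [t..<n]" "set [t..<n] \<inter> pverts (complete_graph t) = {}"
    by (auto simp: complete_graph_def)
  have S: "S = subdivide_edge (complete_graph t) (0, 1) [t..<n]"
    using nt by (simp add: subdivided_complete_graph_def)
  note sub = pair_graph_subdivide_edge[OF pair_graph_complete_graph uv d]
  show "pair_graph S" unfolding S using sub by blast
  show "pverts S = {..<n}"
    unfolding S conjunct2[OF sub] using nt by (auto simp: complete_graph_def)
  have clique: "(a, b) \<in> parcs (complete_graph t) - {(0, 1), (1, 0)} \<longleftrightarrow>
      a < t \<and> b < t \<and> a \<noteq> b \<and> \<not> (a < 2 \<and> b < 2)"
    by (auto simp: complete_graph_def less_2_cases_iff)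
  show "(a, b) \<in> parcs S \<longleftrightarrow> a < t \<and> b < t \<and> a \<noteq> b \<and> \<not> (a < 2 \<and> b < 2)
    \<or> (a = 0 \<and> b = t) \<or> (a = t \<and> b = 0) \<or> (a = n - 1 \<and> b = 1) \<or> (a = 1 \<and> b = n - 1)
    \<or> (t \<le> a \<and> b = Suc a \<and> b < n) \<or> (t \<le> b \<and> a = Suc b \<and> a < n)"
    unfolding S arcs_subdivide_edge[OF pair_graph_complete_graph uv d] Un_iff mem_path_arcs_upt[OF nt]
      clique by (rule refl)
qed

sublocale S: fin_graph "{..<n}" "parcs S"
  using fin_graph_pair_graph[OF pair_graph_S] S_verts by simp

text \<open>Vertex 2 exists since \<open>t \<ge> 3\<close> and is adjacent to all of the core; the
  path vertices are then appended in order, each next to its predecessor.\<close>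

lemma conn_S: "conn (parcs S) {..<n}"
proof -
  have "conn (parcs S) {..<m}" if "t \<le> m" "m \<le> n" for m
    using that
  proof (induction m rule: dec_induct)
    case base
    show ?case
      unfolding conn_def
    proof (intro conjI allI impI)
      show "{..<t} \<noteq> {}" using t3 by (auto simp: lessThan_empty_iff)
      fix X assume X: "X \<subseteq> {..<t}" "X \<noteq> {}" "parcs S `` X \<inter> {..<t} \<subseteq> X"
      have closed: "b \<in> X" if "a \<in> X" "(a, b) \<in> parcs S" "b < t" for a b using X(3) that by blast
      obtain a where a: "a \<in> X" "a < t" using X by blast
      have "2 \<in> X"
      proof (cases "a = 2")
        case False
        then show ?thesis by (intro closed[OF a(1)]) (use a(2) t3 in \<open>auto simp: S_arcs\<close>)
      qed (use a in simp)
      then have "b \<in> X" if "b < t" for b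
        using closed[of 2 b] that t3 by (cases "b = 2") (auto simp: S_arcs)
      then show "X = {..<t}" using X(1) by blast
    qed
  next
    case (step m)
    let ?b = "if m = t then 0 else m - 1"
    have "conn (parcs S) (insert m {..<m})"
      by (rule conn_insert[of _ _ ?b]) (use step t3 in \<open>auto simp: S_arcs\<close>)
    then show ?case by (simp add: lessThan_Suc)
  qed
  then show ?thesis using nt by simp
qed

section \<open>Outside neighbours of connected sets in the subdivided complete graph\<close>

context
  fixes B
  assumes B: "B \<subseteq> {..<n}" and connB: "conn (parcs S) B"
begin

lemma closed_eq:
  assumes "X \<subseteq> B" "X \<noteq> {}" "\<And>a b. a \<in> X \<Longrightarrow> b \<in> B \<Longrightarrow> (a, b) \<in> parcs S \<Longrightarrow> b \<in> X"
  shows "X = B"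
  by (rule conn_closed_eq[OF connB assms(1,2)]) (use assms(3) in blast)

text \<open>A gap in \<open>B\<close> would make its lower part closed. So \<open>B\<close> is an
  interval of the path and can be left only at its two ends.\<close>

lemma boundary_inside_path:
  assumes "B \<inter> {..<t} = {}"
  shows "card (parcs S `` B - B) \<le> 2"
proof -
  have ne: "B \<noteq> {}" using connB by (simp add: conn_def)
  have fin: "finite B" using B finite_subset by blast
  define lo hi where "lo = Min B" and "hi = Max B"
  have lohi: "lo \<in> B" "hi \<in> B" "\<And>b. b \<in> B \<Longrightarrow> lo \<le> b \<and> b \<le> hi"
    using ne fin by (auto simp: lo_def hi_def)
  have tB: "t \<le> b \<and> b < n" if "b \<in> B" for b using that assms B by fastforce
  have mid: "z \<in> B" if "lo < z" "z < hi" for z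
  proof (rule ccontr)
    assume z: "z \<notin> B"
    have "B \<inter> {..<z} = B"
    proof (rule closed_eq)
      show "B \<inter> {..<z} \<noteq> {}" using lohi(1) that by blast
      fix a b assume "a \<in> B \<inter> {..<z}" "b \<in> B" "(a, b) \<in> parcs S"
      moreover have "b \<noteq> z" using z \<open>b \<in> B\<close> by blast
      ultimately show "b \<in> B \<inter> {..<z}" using tB[of a] tB[of b] t3 nt that by (auto simp: S_arcs)
    qed simp
    then have "hi \<in> {..<z}" using lohi(2) by blast
    then show False using that by simp
  qed
  let ?l = "if lo = t then 0 else lo - 1" and ?r = "if hi = n - 1 then 1 else Suc hi"
  have "parcs S `` B - B \<subseteq> {?l, ?r}"
  proof
    fix q assume q: "q \<in> parcs S `` B - B"
    then obtain b where b: "b \<in> B" "(b, q) \<in> parcs S" by blast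
    have "\<not> (lo \<le> q \<and> q \<le> hi)" using q mid lohi(1,2) by (metis DiffD2 le_neq_implies_less)
    then show "q \<in> {?l, ?r}"
      using b(2) lohi(3)[OF b(1)] tB[OF b(1)] tB[OF lohi(1)] tB[OF lohi(2)] t3 by (auto simp: S_arcs)
  qed
  then have "card (parcs S `` B - B) \<le> card {?l, ?r}" by (intro card_mono) auto
  also have "\<dots> \<le> 2" by (cases "?l = ?r") simp_all
  finally show ?thesis .
qed

text \<open>Here \<open>p\<close> is an outside path vertex whose predecessor, seen from 0, lies in
  \<open>B\<close>. As \<open>B\<close> is connected and reaches the core, but not through
  \<open>p\<close>, the whole segment from 0 up to \<open>p\<close> lies in \<open>B\<close>. If
  \<open>B\<close> offers no other way out of 0 in the core, 0 with this segment is all of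
  \<open>B\<close>, so the far end of the path is missing.\<close>

lemma left_boundary:
  assumes C: "B \<inter> {..<t} \<noteq> {}" and p: "t \<le> p" "p < n" "p \<notin> B"
    and l: "p = t \<and> 0 \<in> B \<or> t < p \<and> p - 1 \<in> B"
  shows "0 \<in> B" "{t..<p} \<subseteq> B" "B \<inter> {..<t} \<subseteq> {0, 1} \<Longrightarrow> 1 \<notin> B"
    "B \<inter> {..<t} \<subseteq> {0} \<Longrightarrow> n - 1 \<notin> B"
proof -
  obtain c where c: "c \<in> B" "c < t" using C by blast
  have above: "z \<in> B \<or> z < t" if "z < p" "z \<ge> t \<or> 0 \<notin> B" "p > t" for z
  proof (rule ccontr)
    assume z: "\<not> (z \<in> B \<or> z < t)"
    have "B \<inter> {z<..<p} = B"
    proof (rule closed_eq)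
      have "p - 1 \<in> B" "p - 1 \<noteq> z" using l that z by auto
      then show "B \<inter> {z<..<p} \<noteq> {}" using that by (auto intro!: exI[of _ "p - 1"])
      fix a b assume ab: "a \<in> B \<inter> {z<..<p}" "b \<in> B" "(a, b) \<in> parcs S"
      then have "b \<noteq> z" "b \<noteq> p" using z p by blast+
      then show "b \<in> B \<inter> {z<..<p}" using ab p z t3 nt by (auto simp: S_arcs)
    qed simp
    then have "c \<in> {z<..<p}" using c by blast
    then show False using c z p by auto
  qed
  show 0: "0 \<in> B"
  proof (rule ccontr)
    assume n0: "0 \<notin> B"
    have "B \<inter> {t..<p} = B"
    proof (rule closed_eq)
      show "B \<inter> {t..<p} \<noteq> {}" using l n0 by (auto intro!: exI[of _ "p - 1"])
      fix a b assume ab: "a \<in> B \<inter> {t..<p}" "b \<in> B" "(a, b) \<in> parcs S"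
      then have "b \<noteq> 0" "b \<noteq> p" using n0 p by metis+
      then show "b \<in> B \<inter> {t..<p}" using ab p t3 nt by (auto simp: S_arcs)
    qed simp
    then have "c \<in> {t..<p}" using c by blast
    then show False using c t3 p nt by auto
  qed
  show sub: "{t..<p} \<subseteq> B"
  proof
    fix z assume "z \<in> {t..<p}"
    then show "z \<in> B" using above[of z] by auto
  qed
  show "1 \<notin> B" if C01: "B \<inter> {..<t} \<subseteq> {0, 1}"
  proof
    assume 1: "1 \<in> B"
    have "B \<inter> ({0} \<union> {t..<p}) = B"
    proof (rule closed_eq)
      show "B \<inter> ({0} \<union> {t..<p}) \<noteq> {}" using 0 by blast
      fix a b assume ab: "a \<in> B \<inter> ({0} \<union> {t..<p})" "b \<in> B" "(a, b) \<in> parcs S"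
      then have "b \<noteq> p" "b < t \<Longrightarrow> b \<in> {0, 1}" using p C01 by blast+
      then show "b \<in> B \<inter> ({0} \<union> {t..<p})" using ab p t3 by (auto simp: S_arcs)
    qed simp
    then have "1 \<in> ({0} \<union> {t..<p})" using 1 by blast
    then show False using 1 t3 t3 p nt by auto
  qed
  show "n - 1 \<notin> B" if C0: "B \<inter> {..<t} \<subseteq> {0}"
  proof
    assume n1: "n - 1 \<in> B"
    have "B \<inter> ({0} \<union> {t..<p}) = B"
    proof (rule closed_eq)
      show "B \<inter> ({0} \<union> {t..<p}) \<noteq> {}" using 0 by blast
      fix a b assume ab: "a \<in> B \<inter> ({0} \<union> {t..<p})" "b \<in> B" "(a, b) \<in> parcs S"
      then have "b \<noteq> p" "b < t \<Longrightarrow> b = 0" using p C0 by blast+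
      then show "b \<in> B \<inter> ({0} \<union> {t..<p})" using ab p t3 by (auto simp: S_arcs)
    qed simp
    then have "n - 1 \<in> ({0} \<union> {t..<p})" using n1 by blast
    then show False using n1 t3 p nt by auto
  qed
qed

text \<open>The mirror image of \<open>left_boundary\<close>: 0 and 1 are exchanged and the path is
  reversed.\<close>

lemma right_boundary:
  assumes C: "B \<inter> {..<t} \<noteq> {}" and p: "t \<le> p" "p < n" "p \<notin> B"
    and r: "p = n - 1 \<and> 1 \<in> B \<or> Suc p < n \<and> Suc p \<in> B"
  shows "1 \<in> B" "{p<..<n} \<subseteq> B" "B \<inter> {..<t} \<subseteq> {0, 1} \<Longrightarrow> 0 \<notin> B"
    "B \<inter> {..<t} \<subseteq> {1} \<Longrightarrow> t \<notin> B"
proof -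
  obtain c where c: "c \<in> B" "c < t" using C by blast
  show 1: "1 \<in> B"
  proof (rule ccontr)
    assume n1: "1 \<notin> B"
    have "B \<inter> {p<..<n} = B"
    proof (rule closed_eq)
      show "B \<inter> {p<..<n} \<noteq> {}" using r n1 by (auto intro!: exI[of _ "Suc p"])
      fix a b assume ab: "a \<in> B \<inter> {p<..<n}" "b \<in> B" "(a, b) \<in> parcs S"
      then have "b \<noteq> 1" "b \<noteq> p" using n1 p by blast+
      then show "b \<in> B \<inter> {p<..<n}" using ab p t3 nt by (auto simp: S_arcs)
    qed simp
    then have "c \<in> {p<..<n}" using c by blast
    then show False using c p t3 p nt by auto
  qed
  show sub: "{p<..<n} \<subseteq> B"
  proof (rule ccontr)
    assume "\<not> {p<..<n} \<subseteq> B"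
    then obtain z where z: "p < z" "z < n" "z \<notin> B"
      by (meson greaterThanLessThan_iff subsetI)
    have "B \<inter> {p<..<z} = B"
    proof (rule closed_eq)
      have "Suc p \<in> B" "Suc p \<noteq> z" using r z by auto
      then show "B \<inter> {p<..<z} \<noteq> {}" using z by (auto intro!: exI[of _ "Suc p"])
      fix a b assume ab: "a \<in> B \<inter> {p<..<z}" "b \<in> B" "(a, b) \<in> parcs S"
      then have "b \<noteq> z" "b \<noteq> p" using z p by blast+
      then show "b \<in> B \<inter> {p<..<z}" using ab p z t3 nt by (auto simp: S_arcs)
    qed simp
    then have "c \<in> {p<..<z}" using c by blast
    then show False using c p t3 p nt by auto
  qed
  show "0 \<notin> B" if C01: "B \<inter> {..<t} \<subseteq> {0, 1}"
  proof
    assume 0: "0 \<in> B"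
    have "B \<inter> ({1} \<union> {p<..<n}) = B"
    proof (rule closed_eq)
      show "B \<inter> ({1} \<union> {p<..<n}) \<noteq> {}" using 1 by blast
      fix a b assume ab: "a \<in> B \<inter> ({1} \<union> {p<..<n})" "b \<in> B" "(a, b) \<in> parcs S"
      then have "b \<noteq> p" "b < t \<Longrightarrow> b \<in> {0, 1}" using p C01 by blast+
      then show "b \<in> B \<inter> ({1} \<union> {p<..<n})" using ab p t3 nt by (auto simp: S_arcs)
    qed simp
    then have "0 \<in> ({1} \<union> {p<..<n})" using 0 by blast
    then show False using 0 t3 t3 p nt by auto
  qed
  show "t \<notin> B" if C1: "B \<inter> {..<t} \<subseteq> {1}"
  proof
    assume tB: "t \<in> B"
    have "B \<inter> ({1} \<union> {p<..<n}) = B"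
    proof (rule closed_eq)
      show "B \<inter> ({1} \<union> {p<..<n}) \<noteq> {}" using 1 by blast
      fix a b assume ab: "a \<in> B \<inter> ({1} \<union> {p<..<n})" "b \<in> B" "(a, b) \<in> parcs S"
      then have "b \<noteq> p" "b < t \<Longrightarrow> b = 1" using p C1 by blast+
      then show "b \<in> B \<inter> ({1} \<union> {p<..<n})" using ab p t3 nt by (auto simp: S_arcs)
    qed simp
    then have "t \<in> ({1} \<union> {p<..<n})" using tB by blast
    then show False using tB t3 p t3 p nt by auto
  qed
qed

text \<open>Each end of the path contributes at most one outside neighbour, and each such neighbour
  is paid for by one more core vertex that is not counted. With both ends present, 0 and 1 lie in
  \<open>B\<close> but can only be joined through a third core vertex of \<open>B\<close>.\<close>

lemma boundary_card: "card (parcs S `` B - B) < t"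
proof (cases "B \<inter> {..<t} = {}")
  case True
  then show ?thesis using boundary_inside_path t3 by fastforce
next
  case False
  then obtain c where c: "c \<in> B" "c < t" by blast
  let ?N = "parcs S `` B - B"
  have N: "q < n" if "q \<in> ?N" for q using that S.E_verts(2) by blast
  \<comment> \<open>\<open>PL\<close> and \<open>PR\<close> are the outside path vertices entered
    from the side of 0 and of 1. They may share a vertex, which an upper bound may count
    twice.\<close>
  define PL where "PL = {p \<in> ?N. t \<le> p \<and> (p = t \<and> 0 \<in> B \<or> t < p \<and> p - 1 \<in> B)}"
  define PR where "PR = {p \<in> ?N. t \<le> p \<and> (p = n - 1 \<and> 1 \<in> B \<or> Suc p < n \<and> Suc p \<in> B)}"
  have split: "?N = (?N \<inter> {..<t}) \<union> PL \<union> PR"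
  proof
    show "?N \<subseteq> (?N \<inter> {..<t}) \<union> PL \<union> PR"
    proof
      fix q assume q: "q \<in> ?N"
      then obtain b where b: "b \<in> B" "(b, q) \<in> parcs S" by blast
      show "q \<in> (?N \<inter> {..<t}) \<union> PL \<union> PR"
      proof (cases "q < t")
        case False
        then have "(q = t \<and> b = 0) \<or> (q = n - 1 \<and> b = 1) \<or> (t < q \<and> b = q - 1) \<or> (b = Suc q \<and> Suc q < n)"
          using b(2) t3 nt by (auto simp: S_arcs)
        then show ?thesis using q b(1) False unfolding PL_def PR_def by auto
      qed (use q in simp)
    qed
  qed (auto simp: PL_def PR_def)
  have L: "0 \<in> B" "{t..<p} \<subseteq> B" "B \<inter> {..<t} \<subseteq> {0, 1} \<Longrightarrow> 1 \<notin> B"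
    "B \<inter> {..<t} \<subseteq> {0} \<Longrightarrow> n - 1 \<notin> B" if "p \<in> PL" for p
    using left_boundary[OF False, of p] that N[of p] unfolding PL_def by blast+
  have R: "1 \<in> B" "{p<..<n} \<subseteq> B" "B \<inter> {..<t} \<subseteq> {0, 1} \<Longrightarrow> 0 \<notin> B"
    "B \<inter> {..<t} \<subseteq> {1} \<Longrightarrow> t \<notin> B" if "p \<in> PR" for p
    using right_boundary[OF False, of p] that N[of p] unfolding PR_def by blast+
  have PL_unique: "p = q" if "p \<in> PL" "q \<in> PL" for p q
  proof (rule ccontr)
    assume "p \<noteq> q"
    then have "p \<in> {t..<q} \<or> q \<in> {t..<p}" using that by (auto simp: PL_def)
    moreover have "p \<notin> B" "q \<notin> B" using that by (auto simp: PL_def)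
    ultimately show False using L(2)[OF that(1)] L(2)[OF that(2)] by blast
  qed
  have PR_unique: "p = q" if "p \<in> PR" "q \<in> PR" for p q
  proof (rule ccontr)
    assume "p \<noteq> q"
    then have "p \<in> {q<..<n} \<or> q \<in> {p<..<n}" using that N by (auto simp: PR_def)
    moreover have "p \<notin> B" "q \<notin> B" using that by (auto simp: PR_def)
    ultimately show False using R(2)[OF that(1)] R(2)[OF that(2)] by blast
  qed
  have cPL: "card PL \<le> 1" and cPR: "card PR \<le> 1"
    using PL_unique PR_unique by (metis card_le_Suc0_iff_eq card.infinite One_nat_def le_SucI le0)+
  have le: "card ?N \<le> card (?N \<inter> {..<t}) + card PL + card PR"
    by (subst split) (meson card_Un_le order_trans add_le_mono1)
  have minus: "card (?N \<inter> {..<t}) \<le> t - card D" if "D \<subseteq> {..<t}" "?N \<inter> {..<t} \<subseteq> {..<t} - D" for D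
  proof -
    have "card ({..<t} - D) = t - card D" using that(1) by (simp add: card_Diff_subset finite_subset)
    then show ?thesis using that(2) by (metis card_mono finite_Diff finite_lessThan)
  qed
  consider "PL = {}" "PR = {}" | "PL \<noteq> {}" "PR = {}" | "PL = {}" "PR \<noteq> {}" | "PL \<noteq> {}" "PR \<noteq> {}"
    by blast
  then show ?thesis
  proof cases
    case 1
    have "card (?N \<inter> {..<t}) \<le> t - card {c}" by (rule minus) (use c in auto)
    then show ?thesis using le 1 t3 by simp
  next
    case 2
    then obtain p where p: "p \<in> PL" by blast
    have "\<exists>d. d < t \<and> d \<noteq> 0 \<and> d \<notin> ?N"
    proof (cases "B \<inter> {..<t} \<subseteq> {0}")
      case True
      have "1 \<notin> ?N"
      proof
        assume "1 \<in> ?N"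
        then obtain b where b: "b \<in> B" "(b, 1) \<in> parcs S" by blast
        then have "b < t \<Longrightarrow> b = 0" "b \<noteq> n - 1" using True L(4)[OF p] by auto
        then show False using b t3 nt by (auto simp: S_arcs)
      qed
      then show ?thesis using t3 by (intro exI[of _ 1]) auto
    qed blast
    then obtain d where d: "d < t" "d \<noteq> 0" "d \<notin> ?N" by blast
    have "card (?N \<inter> {..<t}) \<le> t - card {0, d}"
      by (rule minus) (use d L(1)[OF p] t3 in auto)
    then show ?thesis using le 2 d cPL t3 by simp
  next
    case 3
    then obtain p where p: "p \<in> PR" by blast
    have "\<exists>d. d < t \<and> d \<noteq> 1 \<and> d \<notin> ?N"
    proof (cases "B \<inter> {..<t} \<subseteq> {1}")
      case True
      have "0 \<notin> ?N"
      proof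
        assume "0 \<in> ?N"
        then obtain b where b: "b \<in> B" "(b, 0) \<in> parcs S" by blast
        then have "b < t \<Longrightarrow> b = 1" "b \<noteq> t" using True R(4)[OF p] by auto
        then show False using b t3 nt by (auto simp: S_arcs)
      qed
      then show ?thesis using t3 by (intro exI[of _ 0]) auto
    qed blast
    then obtain d where d: "d < t" "d \<noteq> 1" "d \<notin> ?N" by blast
    have "card (?N \<inter> {..<t}) \<le> t - card {1, d}"
      by (rule minus) (use d R(1)[OF p] t3 in auto)
    then show ?thesis using le 3 d cPR t3 by simp
  next
    case 4
    then obtain p q where pq: "p \<in> PL" "q \<in> PR" by blast
    then obtain d where d: "d \<in> B" "d < t" "d \<noteq> 0" "d \<noteq> 1" using L(3) R(1) by blast
    have "card (?N \<inter> {..<t}) \<le> t - card {0, 1, d}"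
      by (rule minus) (use d L(1)[OF pq(1)] R(1)[OF pq(2)] t3 in auto)
    then show ?thesis using le d cPL cPR t3 by simp
  qed
qed

end

lemma admissible_S: "admissible n t S"
proof -
  have "\<not> spreads t (parcs S) {..<n}"
    unfolding spreads_def using boundary_card by (meson not_le)
  then show ?thesis
    using pair_graph_S conn_S by (simp add: admissible_def S_verts)
qed

end

section \<open>Spectral constraints on an extremal graph of order at least \<open>t + 2\<close>\<close>

locale large_extremal = extremal +
  assumes t3: "3 \<le> t" and nt: "t + 2 \<le> n"
begin

sublocale subdivided_clique n t
  using t3 nt by unfold_locales auto

text \<open>\<open>A v\<close> is the part of the neighbourhood that is summed explicitly; neglected
  neighbours only help since \<open>y\<close> is nonnegative, and rows where \<open>y\<close>
  vanishes hold for the same reason.\<close>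

lemma S_test_vector:
  assumes y: "\<And>v. v < n \<Longrightarrow> 0 \<le> y v"
    and A: "\<And>v. v < n \<Longrightarrow> 0 < y v \<Longrightarrow> A v \<subseteq> nb (parcs S) v \<and> \<rho> * y v \<le> sum y (A v)"
    and v: "v < n" "0 < y v"
  shows "sum y (A v) \<le> \<rho> * y v"
proof -
  have le: "sum y (A v) \<le> sum y (nb (parcs S) v)" if "v < n" "0 < y v" for v
    by (rule sum_mono2) (use A[OF that] y S.E_verts(2) in \<open>auto\<close>)
  have "\<rho> * y v \<le> sum y (nb (parcs S) v)" if v: "v < n" for v
  proof (cases "y v = 0")
    case True
    then show ?thesis using y S.E_verts(2) by (auto intro!: sum_nonneg)
  next
    case False
    then have "0 < y v" using y[OF v] by simp
    then show ?thesis using le[OF v] A[OF v] by linarith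
  qed
  then have "sum y (nb (parcs S) v) = \<rho> * y v"
    using y v by (intro test_vector[OF admissible_S]) (auto simp: S_verts)
  then show ?thesis using le[OF v] by simp
qed

text \<open>The indicator of the core is a test vector: its row sums are \<open>t - 2\<close> at 0
  and 1 and \<open>t - 1\<close> elsewhere in the core, so the inequality would be strict at
  2.\<close>

lemma rho_gt: "real t - 2 < \<rho>"
proof (rule ccontr)
  assume "\<not> ?thesis"
  then have le: "\<rho> \<le> real t - 2" by simp
  define y :: "nat \<Rightarrow> real" where "y v = (if v < t then 1 else 0)" for v
  define A where "A v = (if v < 2 then {2..<t} else {..<t} - {v})" for v
  have sumA: "sum y (A v) = (if v < 2 then real t - 2 else real t - 1)" if "v < t" for v
  proof -
    have "sum y (A v) = real (card (A v))"
      using sum.cong[of "A v" "A v" y "\<lambda>_. 1"] by (auto simp: A_def y_def)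
    then show ?thesis using that t3 by (auto simp: A_def)
  qed
  have "sum y (A 2) \<le> \<rho> * y 2"
  proof (rule S_test_vector)
    fix v assume "v < n" "0 < y v"
    then have v: "v < t" by (simp add: y_def split: if_splits)
    have "A v \<subseteq> nb (parcs S) v"
      using v t3 by (auto simp: A_def S_arcs)
    moreover have "\<rho> * y v \<le> sum y (A v)"
      unfolding sumA[OF v] using le v by (simp add: y_def)
    ultimately show "A v \<subseteq> nb (parcs S) v \<and> \<rho> * y v \<le> sum y (A v)" ..
  qed (use t3 nt in \<open>auto simp: y_def\<close>)
  then show False
    using sumA[of 2] t3 le by (simp add: y_def)
qed

lemma rho_gt_1: "1 < \<rho>"
  using rho_gt t3 by simp

definition D :: real where
  "D = (\<rho> + 1) * (real t - 1 - \<rho>)"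

text \<open>
  The test vector on \<open>S\<close> is constant \<open>1\<close> on the vertices \<open>2,\<dots>,t-1\<close>; its value \<open>c\<close> at \<open>0\<close> and
  \<open>1\<close> and the value \<open>c / \<rho>\<close> at the adjacent path vertices make the eigenvalue equation at \<open>0\<close> and
  \<open>1\<close> exact, so that maximality of \<open>\<rho>\<close> limits the row sum \<open>t - 3 + 2 c\<close> at \<open>2\<close>.
\<close>

lemma D_bound: "D * (\<rho> + 2) \<le> 2 * \<rho>"
proof -
  define c where "c = (real t - 2) * \<rho> / (\<rho>\<^sup>2 - 1)"
  have r: "1 < \<rho>" by (rule rho_gt_1)
  then have r2: "\<rho>\<^sup>2 - 1 > 0" by (simp add: power2_eq_square) (smt (verit) mult_less_cancel_left2)
  have c_pos: "c > 0" using t3 r r2 by (simp add: c_def)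
  have c_eq: "\<rho> * c = real t - 2 + c / \<rho>"
  proof -
    have "c * (\<rho>\<^sup>2 - 1) = (real t - 2) * \<rho>" using r2 by (simp add: c_def)
    then show ?thesis using r by (simp add: field_simps power2_eq_square)
  qed
  \<comment> \<open>Beyond \<open>t\<close> and \<open>n - 1\<close>, which differ because
    \<open>n \<ge> t + 2\<close>, the path gets weight 0. If these two are adjacent,
    \<open>A\<close> ignores that edge.\<close>
  define y :: "nat \<Rightarrow> real" where "y v = (if v < 2 then c else if v < t then 1
    else if v = t \<or> v = n - 1 then c / \<rho> else 0)" for v
  define A where "A v = (if v = 0 then insert t {2..<t} else if v = 1 then insert (n - 1) {2..<t}
    else if v < t then {0, 1} \<union> ({2..<t} - {v}) else if v = t then {0} else {1})" for v
  have y1: "sum y X = real (card X)" if "X \<subseteq> {2..<t}" for X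
  proof -
    have "sum y X = sum (\<lambda>_. 1) X" by (rule sum.cong) (use that in \<open>auto simp: y_def\<close>)
    then show ?thesis by simp
  qed
  have s0: "sum y (A 0) = \<rho> * c"
  proof -
    have "sum y (A 0) = y t + sum y {2..<t}" by (simp add: A_def)
    then show ?thesis using c_eq y1[of "{2..<t}"] t3 by (simp add: y_def)
  qed
  have s1: "sum y (A 1) = \<rho> * c"
  proof -
    have "n - 1 \<notin> {2..<t}" using nt by auto
    then have "sum y (A 1) = y (n - 1) + sum y {2..<t}" by (simp add: A_def)
    moreover have "y (n - 1) = c / \<rho>" using nt t3 by (auto simp: y_def)
    ultimately show ?thesis using c_eq y1[of "{2..<t}"] t3 by simp
  qed
  have s2: "sum y (A v) = 2 * c + (real t - 3)" if "2 \<le> v" "v < t" for v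
  proof -
    have "sum y (A v) = sum y {0, 1} + sum y ({2..<t} - {v})"
      using that by (subst sum.union_disjoint[symmetric]) (auto simp: A_def)
    then show ?thesis using y1[of "{2..<t} - {v}"] that by (simp add: y_def)
  qed
  have "2 * c + (real t - 3) \<le> \<rho>"
  proof (rule ccontr)
    assume "\<not> ?thesis"
    then have gt: "\<rho> < 2 * c + (real t - 3)" by simp
    have "sum y (A 2) \<le> \<rho> * y 2"
    proof (rule S_test_vector)
      fix v assume v: "v < n" "0 < y v"
      then have "v = 0 \<or> v = 1 \<or> (2 \<le> v \<and> v < t) \<or> v = t \<or> (v = n - 1 \<and> v > t)"
        using nt by (auto simp: y_def less_2_cases_iff split: if_splits)
      then consider "v = 0" | "v = 1" | "2 \<le> v" "v < t" | "v = t" | "v = n - 1" "v > t"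
        by blast
      then show "A v \<subseteq> nb (parcs S) v \<and> \<rho> * y v \<le> sum y (A v)"
      proof cases
        case 1
        then show ?thesis using s0 t3 by (auto simp: A_def y_def S_arcs)
      next
        case 2
        then show ?thesis using s1 t3 by (auto simp: A_def y_def S_arcs)
      next
        case 3
        then have "A v \<subseteq> nb (parcs S) v" using t3 by (auto simp: A_def S_arcs)
        moreover have "\<rho> * y v \<le> sum y (A v)" unfolding s2[OF 3] using gt 3 by (simp add: y_def)
        ultimately show ?thesis ..
      next
        case 4
        have "y t = c / \<rho>" "y 0 = c" using t3 by (auto simp: y_def)
        then show ?thesis using 4 t3 r by (auto simp: A_def S_arcs)
      next
        case 5
        have "y (n - 1) = c / \<rho>" "y 1 = c" using t3 nt by (auto simp: y_def)
        then show ?thesis using 5 t3 r by (auto simp: A_def S_arcs)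
      qed
    qed (use t3 nt c_pos r in \<open>auto simp: y_def\<close>)
    then show False using s2[of 2] t3 gt by (simp add: y_def)
  qed
  then have "2 * c * (\<rho>\<^sup>2 - 1) \<le> (\<rho> - (real t - 3)) * (\<rho>\<^sup>2 - 1)"
    using r2 by (intro mult_right_mono) auto
  moreover have "c * (\<rho>\<^sup>2 - 1) = (real t - 2) * \<rho>" using r2 by (simp add: c_def)
  ultimately have "2 * ((real t - 2) * \<rho>) \<le> (\<rho> - (real t - 3)) * (\<rho>\<^sup>2 - 1)"
    by (simp add: mult.assoc)
  moreover define d where "d = real t - 1 - \<rho>"
  then have "real t = 1 + d + \<rho>" by simp
  ultimately have d: "d * (\<rho>\<^sup>2 + 2 * \<rho> - 1) \<le> 2 * (\<rho> - 1)"
    by (simp only:) (simp add: algebra_simps power2_eq_square)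
  define Q where "Q = \<rho>\<^sup>2 + 2 * \<rho> - 1"
  have Q: "Q > 0" unfolding Q_def using r2 r by linarith
  have "D * (\<rho> + 2) * Q = (\<rho> + 1) * (\<rho> + 2) * (d * Q)"
    by (simp add: D_def d_def)
  also have "\<dots> \<le> (\<rho> + 1) * (\<rho> + 2) * (2 * (\<rho> - 1))"
    using d r unfolding Q_def by (intro mult_left_mono) auto
  \<comment> \<open>The two sides differ by exactly 4: the convenient bound
    \<open>2 * \<rho> / (\<rho> + 2)\<close> slightly weakens
    \<open>2 * (\<rho>\<^sup>2 - 1) / Q\<close>.\<close>
  also have "\<dots> \<le> 2 * \<rho> * Q"
    by (simp add: Q_def algebra_simps power2_eq_square)
  finally show ?thesis using Q by simp
qed

text \<open>The form used in most counting arguments: two full units of loss exceed the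
  budget.\<close>

lemma D_lt_2: "D < 2"
proof -
  have "D * (\<rho> + 2) \<le> 2 * \<rho>" by (rule D_bound)
  also have "\<dots> < 2 * (\<rho> + 2)" by simp
  finally show ?thesis using rho_gt_1 mult_less_cancel_right_pos[of "\<rho> + 2" D 2] by simp
qed

text \<open>Supplies the final contradiction in \<open>no_large_classes\<close>, for which \<rho> >
  t - 2, giving only 9, is too weak. If \<rho> stayed below 7/2, then \<open>D\<close> would be at
  least 2.\<close>

lemma rho_sq_gt_12:
  assumes "5 \<le> t"
  shows "12 < \<rho>\<^sup>2"
proof (rule ccontr)
  assume "\<not> ?thesis"
  then have sq: "\<rho>\<^sup>2 \<le> 12" by simp
  have r: "3 < \<rho>" using rho_gt assms by linarith
  have r': "\<rho> < 7 / 2"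
  proof (rule power2_less_imp_less)
    have "\<rho>\<^sup>2 < 49 / 4" using sq by linarith
    then show "\<rho>\<^sup>2 < (7 / 2)\<^sup>2" by (simp add: power2_eq_square)
  qed simp
  have "4 * (1 / 2) \<le> D" unfolding D_def by (rule mult_mono) (use r r' assms in linarith)+
  then have "2 * (\<rho> + 2) \<le> D * (\<rho> + 2)" using r by (intro mult_right_mono) auto
  also have "\<dots> \<le> 2 * \<rho>" by (rule D_bound)
  finally show False by simp
qed

end

section \<open>Adjacency around a heaviest vertex\<close>

locale large_extremal_eigen = large_extremal +
  fixes x :: "'a \<Rightarrow> real" and u :: 'a
  assumes u: "u \<in> V" "x u = 1"
    and x: "\<And>v. v \<in> V \<Longrightarrow> 0 < x v" "\<And>v. v \<in> V \<Longrightarrow> x v \<le> 1"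
    and eigen: "\<And>v. v \<in> V \<Longrightarrow> (\<Sum>w\<in>nb E v. x w) = \<rho> * x v"
begin

definition N where "N = nb E u"
definition R where "R = V - insert u N"
definition F where "F v = {z \<in> N. z \<noteq> v \<and> (v, z) \<notin> E}"
definition A where "A = {v \<in> N. nb E v \<inter> R \<noteq> {}}"
text \<open>The exit of an attached vertex into \<open>R\<close>; by \<open>R_nb_unique\<close> the
  choice is unique on \<open>A\<close>.\<close>

definition g where "g v = (SOME w. w \<in> R \<and> (v, w) \<in> E)"

lemma boundary_lt:
  assumes "B \<subseteq> V" "conn E B" "X \<subseteq> E `` B - B"
  shows "card X < t"
proof -
  have "finite (E `` B - B)" using finite_subset[OF _ finV, of "E `` B - B"] EV by blast
  then have "card X \<le> card (E `` B - B)" using assms(3) by (rule card_mono)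
  moreover have "card (E `` B - B) < t"
    using no_spread assms(1,2) unfolding spreads_def by (meson not_le)
  ultimately show ?thesis by simp
qed

lemma N_verts: "v \<in> N \<Longrightarrow> v \<in> V" and R_verts: "v \<in> R \<Longrightarrow> v \<in> V"
  and N_adj: "v \<in> N \<Longrightarrow> (u, v) \<in> E \<and> (v, u) \<in> E"
  using E_verts symE by (auto simp: N_def R_def)

lemma disj: "u \<notin> N" "u \<notin> R" "v \<in> N \<Longrightarrow> v \<notin> R"
  using irrefl by (auto simp: N_def R_def)

lemma R_nonadj_u: "v \<in> R \<Longrightarrow> (v, u) \<notin> E"
  using symE by (auto simp: R_def N_def)

lemma finN [simp]: "finite N" and finR [simp]: "finite R"
  using finV by (auto simp: N_def R_def)

lemma finF [simp]: "finite (F v)"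
  by (simp add: F_def)

lemma conn_pair: "(v, w) \<in> E \<Longrightarrow> conn E {v, w}"
  using conn_insert[OF conn_singleton[of E v], of v w] symE by (simp add: insert_commute)

lemma card_N: "card N = t - 1"
proof -
  have "card N < t"
    by (rule boundary_lt[OF _ conn_singleton[of E u]]) (use u irrefl in \<open>auto simp: N_def\<close>)
  moreover have "\<rho> \<le> real (card N)"
  proof -
    have "\<rho> = (\<Sum>w\<in>N. x w)" using eigen[OF u(1)] u(2) by (simp add: N_def)
    also have "\<dots> \<le> (\<Sum>w\<in>N. 1)" by (rule sum_mono) (use x N_verts in auto)
    finally show ?thesis by simp
  qed
  ultimately show ?thesis using rho_gt by linarith
qed

lemma card_R: "2 \<le> card R"
proof -
  have "card R = n - t"
    using card_Diff_subset[of "insert u N" V] u(1) N_verts cardV card_N disj t3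
    by (auto simp: R_def)
  then show ?thesis using nt by simp
qed

text \<open>
  The connected set \<open>{u, v} \<union> P\<close> already has the \<open>t - 2\<close> neighbours \<open>N - {v}\<close>, which leaves room
  for only one neighbour in \<open>R\<close>.
\<close>

lemma arm_unique:
  assumes v: "v \<in> N" and P: "P \<subseteq> R" and conn: "conn E ({u, v} \<union> P)"
    and a: "a \<in> R - P" "a \<in> E `` ({u, v} \<union> P)" and b: "b \<in> R - P" "b \<in> E `` ({u, v} \<union> P)"
  shows "a = b"
proof (rule ccontr)
  assume ab: "a \<noteq> b"
  have "card ((N - {v}) \<union> {a, b}) < t"
  proof (rule boundary_lt[OF _ conn])
    show "{u, v} \<union> P \<subseteq> V" using u N_verts R_verts v P by blast
    show "(N - {v}) \<union> {a, b} \<subseteq> E `` ({u, v} \<union> P) - ({u, v} \<union> P)"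
      using a b v P disj N_adj by blast
  qed
  moreover have "card ((N - {v}) \<union> {a, b}) = card (N - {v}) + card {a, b}"
    by (rule card_Un_disjoint) (use a b disj in auto)
  ultimately show False using ab v card_N t3 by simp
qed

lemma R_nb_unique:
  assumes "v \<in> N" "a \<in> R" "(v, a) \<in> E" "b \<in> R" "(v, b) \<in> E"
  shows "a = b"
  by (rule arm_unique[of v "{}"]) (use assms conn_pair N_adj in auto)

text \<open>This makes a vertex of \<open>R\<close> attached to \<open>N\<close> an end of its path
  in \<open>R\<close>.\<close>

lemma R_nb_unique':
  assumes "v \<in> N" "w \<in> R" "(v, w) \<in> E" "a \<in> R" "(w, a) \<in> E" "b \<in> R" "(w, b) \<in> E"
  shows "a = b"
proof (rule arm_unique[of v "{w}"])
  show "conn E ({u, v} \<union> {w})"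
    using conn_insert[OF conn_pair[of u v], of v w] assms N_adj symE by (simp add: insert_commute)
qed (use assms irrefl in auto)

lemma g: "v \<in> A \<Longrightarrow> g v \<in> R \<and> (v, g v) \<in> E"
  unfolding g_def by (rule someI_ex) (auto simp: A_def)

lemma A_N: "v \<in> A \<Longrightarrow> v \<in> N"
  by (simp add: A_def)

lemma g_eq: "v \<in> N \<Longrightarrow> w \<in> R \<Longrightarrow> (v, w) \<in> E \<Longrightarrow> v \<in> A \<and> g v = w"
proof -
  assume a: "v \<in> N" "w \<in> R" "(v, w) \<in> E"
  then have "v \<in> A" by (auto simp: A_def)
  then show ?thesis using R_nb_unique[OF a(1) _ _ a(2,3)] g by blast
qed

lemma nb_g: "v \<in> A \<Longrightarrow> nb E (g v) \<inter> N = {v' \<in> A. g v' = g v}"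
  using g g_eq symE A_N by (auto simp: mem_nb) metis+

lemma F_sym: "v \<in> N \<Longrightarrow> z \<in> F v \<Longrightarrow> v \<in> F z"
  using symE by (auto simp: F_def)

lemma F_N: "z \<in> F v \<Longrightarrow> z \<in> N" "z \<in> F v \<Longrightarrow> z \<noteq> v"
  by (auto simp: F_def)

text \<open>Otherwise \<open>{v}\<close> alone would see \<open>u\<close>, \<open>g v\<close> and
  the other \<open>t - 2\<close> vertices of \<open>N\<close>.\<close>

lemma F_nonempty:
  assumes v: "v \<in> A"
  shows "F v \<noteq> {}"
proof
  assume F: "F v = {}"
  have "card ({u, g v} \<union> (N - {v})) < t"
    by (rule boundary_lt[OF _ conn_singleton[of E v]])
      (use v g[OF v] A_N[OF v] N_verts N_adj disj F irrefl in \<open>auto simp: F_def\<close>)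
  moreover have "card ({u, g v} \<union> (N - {v})) = card {u, g v} + card (N - {v})"
    by (rule card_Un_disjoint) (use disj g[OF v] in auto)
  moreover have "u \<noteq> g v" using g[OF v] disj by auto
  ultimately show False using A_N[OF v] card_N t3 by simp
qed

text \<open>Otherwise the edge \<open>{v, v'}\<close> would see \<open>u\<close>, two different
  exits and the other \<open>t - 3\<close> vertices of \<open>N\<close>.\<close>

lemma different_classes:
  assumes v: "v \<in> A" "v' \<in> A" "g v \<noteq> g v'"
  shows "v' \<in> F v \<or> F v \<inter> F v' \<noteq> {}"
proof (rule ccontr)
  assume "\<not> ?thesis"
  moreover have ne: "v \<noteq> v'" using v(3) by blast
  ultimately have e: "(v, v') \<in> E" and F: "F v \<inter> F v' = {}"
    using A_N v by (auto simp: F_def)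
  have g: "g v \<in> R" "(v, g v) \<in> E" "g v' \<in> R" "(v', g v') \<in> E" using g v by auto
  have N: "v \<in> N" "v' \<in> N" using A_N v by auto
  have "card ({u, g v, g v'} \<union> (N - {v, v'})) < t"
  proof (rule boundary_lt[OF _ conn_pair[OF e]])
    show "{v, v'} \<subseteq> V" using N N_verts by blast
    have "N - {v, v'} \<subseteq> E `` {v, v'}"
      using F by (auto simp: F_def)
    moreover have "{u, g v, g v'} \<subseteq> E `` {v, v'}" using g N_adj[OF N(1)] by auto
    moreover have "u \<notin> {v, v'}" "g v \<notin> {v, v'}" "g v' \<notin> {v, v'}"
      using N g(1,3) disj(1) disj(3)[OF N(1)] disj(3)[OF N(2)] by auto
    ultimately show "{u, g v, g v'} \<union> (N - {v, v'}) \<subseteq> E `` {v, v'} - {v, v'}" by auto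
  qed
  moreover have "card ({u, g v, g v'} \<union> (N - {v, v'})) = card {u, g v, g v'} + card (N - {v, v'})"
    by (rule card_Un_disjoint) (use disj g in auto)
  moreover have "u \<noteq> g v" "u \<noteq> g v'" using g(1,3) disj(2) by metis+
  then have "card {u, g v, g v'} = 3" using v(3) by simp
  moreover have "card (N - {v, v'}) = t - 3"
    using N ne card_N by (subst card_Diff_subset) auto
  ultimately show False using t3 by simp
qed

text \<open>If the path continues behind \<open>g v\<close>, the set \<open>{v, g v}\<close> sees
  \<open>u\<close> and \<open>s\<close>, so it must miss some vertex of
  \<open>N - {v}\<close>.\<close>

lemma tail:
  assumes v: "v \<in> A" and s: "s \<in> R" "(g v, s) \<in> E"
  shows "\<exists>z\<in>F v. (g v, z) \<notin> E"
proof (rule ccontr)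
  assume "\<not> ?thesis"
  then have F: "(g v, z) \<in> E" if "z \<in> F v" for z using that by blast
  have g: "g v \<in> R" "(v, g v) \<in> E" using g v by auto
  have N: "v \<in> N" using A_N v by auto
  have "card ({u, s} \<union> (N - {v})) < t"
  proof (rule boundary_lt[OF _ conn_pair[OF g(2)]])
    show "{v, g v} \<subseteq> V" using N g N_verts R_verts by blast
    have "N - {v} \<subseteq> E `` {v, g v}"
      using F by (auto simp: F_def)
    moreover have "{u, s} \<subseteq> E `` {v, g v}" using s N_adj[OF N] by auto
    moreover have "u \<notin> {v, g v}" "s \<notin> {v, g v}" "g v \<notin> N"
      using N g(1) s disj(1,2) disj(3)[OF N] disj(3)[of "g v"] irrefl[of "g v"] by auto
    ultimately show "{u, s} \<union> (N - {v}) \<subseteq> E `` {v, g v} - {v, g v}" by auto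
  qed
  moreover have "card ({u, s} \<union> (N - {v})) = card {u, s} + card (N - {v})"
    by (rule card_Un_disjoint) (use disj s in auto)
  moreover have "u \<noteq> s" using s disj by auto
  ultimately show False using N card_N t3 by simp
qed

section \<open>Weighing non-adjacent pairs against attachments\<close>

definition \<omega> where "\<omega> v = (\<Sum>w\<in>nb E v \<inter> R. x w)"

lemma omega_A: "v \<in> A \<Longrightarrow> \<omega> v = x (g v)"
proof -
  assume v: "v \<in> A"
  have "w = g v" if "w \<in> nb E v \<inter> R" for w
    using g_eq[OF A_N[OF v], of w] that by simp
  moreover have "g v \<in> nb E v \<inter> R" using g[OF v] by simp
  ultimately have "nb E v \<inter> R = {g v}" by blast
  then show ?thesis by (simp add: \<omega>_def)
qed

lemma omega_not_A: "v \<in> N \<Longrightarrow> v \<notin> A \<Longrightarrow> \<omega> v = 0"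
  by (simp add: \<omega>_def A_def)

lemma omega_le_1: "v \<in> N \<Longrightarrow> \<omega> v \<le> 1"
  using omega_A[of v] omega_not_A[of v] g[of v] R_verts[of "g v"] x(2)[of "g v"]
  by (cases "v \<in> A") simp_all

lemma sum_N: "(\<Sum>w\<in>N. x w) = \<rho>"
  using eigen[OF u(1)] u(2) by (simp add: N_def)

text \<open>The difference of the eigenvalue equations at \<open>u\<close> and \<open>v\<close>:
  both sum over \<open>N\<close>, but \<open>v\<close> misses itself and \<open>F v\<close> and
  gains \<open>u\<close> and the weight \<open>\<omega> v\<close> from \<open>R\<close>.\<close>

lemma deficiency:
  assumes v: "v \<in> N"
  shows "(\<rho> + 1) * (1 - x v) = (\<Sum>z\<in>F v. x z) - \<omega> v"
proof -
  have "nb E v = insert u ((N - insert v (F v)) \<union> (nb E v \<inter> R))"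
    using N_adj[OF v] E_verts irrefl by (auto simp: F_def R_def)
  moreover have "u \<notin> (N - insert v (F v)) \<union> (nb E v \<inter> R)" using disj by blast
  ultimately have "(\<Sum>w\<in>nb E v. x w) = 1 + (\<Sum>w\<in>(N - insert v (F v)) \<union> (nb E v \<inter> R). x w)"
    using u(2) sum.insert[of "(N - insert v (F v)) \<union> (nb E v \<inter> R)" u x] by simp
  also have "\<dots> = 1 + (\<Sum>w\<in>N - insert v (F v). x w) + \<omega> v"
    unfolding \<omega>_def by (subst sum.union_disjoint) (use disj in auto)
  also have "(\<Sum>w\<in>N - insert v (F v). x w) = \<rho> - (x v + (\<Sum>z\<in>F v. x z))"
  proof -
    have "insert v (F v) \<subseteq> N" using v by (auto simp: F_def)
    moreover have "v \<notin> F v" by (simp add: F_def)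
    ultimately show ?thesis by (simp add: sum_diff sum_N)
  qed
  finally show ?thesis using eigen[OF N_verts[OF v]] by (simp add: algebra_simps)
qed

text \<open>
  The deficiencies of an independent set \<open>T\<close> of the graph \<open>F\<close> of non-adjacent pairs can only be
  reduced by the deficiencies of its \<open>F\<close>-neighbours, which are themselves part of \<open>D\<close>.
\<close>

lemma independent_le_D:
  assumes T: "T \<subseteq> N" "card T \<le> 2" "\<And>v w. v \<in> T \<Longrightarrow> w \<in> T \<Longrightarrow> w \<notin> F v"
  shows "(\<Sum>v\<in>T. real (card (F v)) - \<omega> v) \<le> D"
proof -
  have finT: "finite T" by (rule finite_subset[OF T(1) finN])
  let ?y = "\<lambda>v. 1 - x v"
  have y: "0 \<le> ?y v" if "v \<in> N" for v using x(2) N_verts that by simp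
  have "(\<Sum>v\<in>N. ?y v) = real t - 1 - \<rho>"
    using card_N t3 by (simp add: sum_subtractf sum_N)
  then have "D = (\<rho> + 1) * (\<Sum>v\<in>N. ?y v)" by (simp add: D_def)
  also have "(\<Sum>v\<in>N. ?y v) = (\<Sum>v\<in>T. ?y v) + (\<Sum>v\<in>N - T. ?y v)"
    using sum.subset_diff[OF T(1) finN, of ?y] by linarith
  finally have D: "D = (\<Sum>v\<in>T. (\<rho> + 1) * ?y v) + (\<rho> + 1) * (\<Sum>v\<in>N - T. ?y v)"
    by (simp add: distrib_left sum_distrib_left)
  have "real (card (F v)) - \<omega> v \<le> (\<rho> + 1) * ?y v + (\<Sum>z\<in>N - T. ?y z)" if v: "v \<in> T" for v
  proof -
    have "(\<Sum>z\<in>F v. ?y z) \<le> (\<Sum>z\<in>N - T. ?y z)"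
      by (rule sum_mono2) (use y F_N T(3) v in auto)
    moreover have "(\<rho> + 1) * ?y v = (real (card (F v)) - (\<Sum>z\<in>F v. ?y z)) - \<omega> v"
      using deficiency[of v] v T(1) by (auto simp: sum_subtractf)
    ultimately show ?thesis by linarith
  qed
  then have "(\<Sum>v\<in>T. real (card (F v)) - \<omega> v)
      \<le> (\<Sum>v\<in>T. (\<rho> + 1) * ?y v + (\<Sum>z\<in>N - T. ?y z))"
    by (rule sum_mono)
  also have "\<dots> = (\<Sum>v\<in>T. (\<rho> + 1) * ?y v) + card T * (\<Sum>z\<in>N - T. ?y z)"
    by (simp add: sum.distrib)
  \<comment> \<open>A deficiency outside \<open>T\<close> is subtracted at most once per element of
    \<open>T\<close>, but occurs in \<open>D\<close> with the factor \<rho> + 1; this is where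
    \<open>card T \<le> 2\<close> is used.\<close>
  also have "card T * (\<Sum>z\<in>N - T. ?y z) \<le> (\<rho> + 1) * (\<Sum>z\<in>N - T. ?y z)"
    using T(2) rho_gt_1 y by (intro mult_right_mono sum_nonneg) auto
  finally show ?thesis using D by simp
qed

lemma single_le_D: "v \<in> N \<Longrightarrow> real (card (F v)) - \<omega> v \<le> D"
  using independent_le_D[of "{v}"] by (simp add: F_def)

lemma pair_le_D:
  assumes "v \<in> N" "w \<in> N" "v \<noteq> w" "w \<notin> F v"
  shows "real (card (F v)) - \<omega> v + (real (card (F w)) - \<omega> w) \<le> D"
proof -
  have F: "v \<notin> F w" "v \<notin> F v" "w \<notin> F w"
    using F_sym[OF assms(2), of v] assms(4) by blast (simp_all add: F_def)
  have "(\<Sum>v\<in>{v, w}. real (card (F v)) - \<omega> v) \<le> D"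
  proof (rule independent_le_D)
    show "b \<notin> F a" if "a \<in> {v, w}" "b \<in> {v, w}" for a b
      using that F assms(4) by blast
  qed (use assms in auto)
  then show ?thesis using assms(3) by simp
qed

text \<open>Three non-neighbours would cost at least 3 - 1 even with full compensation from
  \<open>R\<close>, which exceeds \<open>D\<close>.\<close>

lemma card_F_le_2: "v \<in> N \<Longrightarrow> card (F v) \<le> 2"
  using single_le_D[of v] omega_le_1[of v] D_lt_2 by linarith

lemma card_F_le_1: "v \<in> N \<Longrightarrow> v \<notin> A \<Longrightarrow> card (F v) \<le> 1"
  using single_le_D[of v] omega_not_A[of v] D_lt_2 by linarith

lemma card_F_pos: "z \<in> F v \<Longrightarrow> 1 \<le> card (F v)"
  using card_gt_0_iff[of "F v"] by auto

lemma card_F_pair: "a \<in> F v \<Longrightarrow> b \<in> F v \<Longrightarrow> a \<noteq> b \<Longrightarrow> 2 \<le> card (F v)"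
  using card_mono[of "F v" "{a, b}"] by auto

lemma F_pair_eq:
  assumes "v \<in> N" "a \<in> F v" "b \<in> F v" "a \<noteq> b"
  shows "F v = {a, b}"
  using card_subset_eq[of "F v" "{a, b}"] card_F_le_2[OF assms(1)] card_F_pair[OF assms(2-4)] assms
  by auto

text \<open>A vertex outside \<open>A\<close> pays for its non-neighbours in full. If
  \<open>b = b'\<close>, it would pay 2; otherwise \<open>b\<close> and \<open>b'\<close> are
  adjacent and pay 1 each.\<close>

lemma outside_nonneighbour_unique:
  assumes v: "v \<in> A" "v' \<in> A" and b: "b \<in> F v" "b \<notin> A" and b': "b' \<in> F v'" "b' \<notin> A"
  shows "v = v'"
proof (rule ccontr)
  assume ne: "v \<noteq> v'"
  have N: "b \<in> N" "b' \<in> N" "v \<in> F b" "v' \<in> F b'"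
    using F_N(1) F_sym A_N v b b' by blast+
  have c: "card (F b) \<le> 1" "card (F b') \<le> 1" using card_F_le_1 N b b' by auto
  show False
  proof (cases "b = b'")
    case True
    then show False using card_F_pair[of v b v'] N ne c by auto
  next
    case False
    have "b' \<notin> F b" using card_F_pair[of v b b'] N c b' v by auto
    then show False
      using pair_le_D[OF N(1,2) False] omega_not_A N b b' card_F_pos[OF N(3)] card_F_pos[OF N(4)] D_lt_2
      by auto
  qed
qed

text \<open>Each of the two pays at least 2 - 1, and as an adjacent pair they would exhaust 2
  units.\<close>

lemma two_degree_two:
  assumes "v \<in> N" "v' \<in> N" "v \<noteq> v'" "card (F v) = 2" "card (F v') = 2"
  shows "v' \<in> F v"
proof (rule ccontr)
  assume "v' \<notin> F v"
  then show False
    using pair_le_D[OF assms(1-3)] assms(4,5) omega_le_1[OF assms(1)] omega_le_1[OF assms(2)] D_lt_2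
    by simp
qed

section \<open>Attached vertices grouped by their exit into R\<close>

lemma x_g_le:
  assumes v: "v \<in> A"
  shows "\<rho> * x (g v) \<le> real (card {v' \<in> A. g v' = g v}) + real (card (nb E (g v) \<inter> R))"
proof -
  have "nb E (g v) = (nb E (g v) \<inter> N) \<union> (nb E (g v) \<inter> R)"
    using E_verts(2) R_nonadj_u g[OF v] by (auto simp: R_def)
  then have "\<rho> * x (g v) = (\<Sum>w\<in>(nb E (g v) \<inter> N) \<union> (nb E (g v) \<inter> R). x w)"
    using eigen[of "g v"] g[OF v] R_verts by simp
  also have "\<dots> \<le> (\<Sum>w\<in>(nb E (g v) \<inter> N) \<union> (nb E (g v) \<inter> R). 1)"
    by (rule sum_mono) (use x(2) N_verts R_verts in auto)
  also have "\<dots> = real (card (nb E (g v) \<inter> N)) + real (card (nb E (g v) \<inter> R))"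
    by (subst sum.union_disjoint) (use disj in auto)
  finally show ?thesis using nb_g[OF v] by simp
qed

lemma card_tail_le_1: "v \<in> A \<Longrightarrow> card (nb E (g v) \<inter> R) \<le> 1"
proof -
  assume v: "v \<in> A"
  have "a = b" if "a \<in> nb E (g v) \<inter> R" "b \<in> nb E (g v) \<inter> R" for a b
    using R_nb_unique'[OF A_N[OF v], of "g v" a b] g[OF v] that by auto
  then show ?thesis by (metis One_nat_def card_le_Suc0_iff_eq finR finite_Int)
qed

text \<open>The cost \<open>2 - x (g v)\<close> and the sharp form of \<open>D_bound\<close> give
  \<open>x (g v) \<ge> 4 / (\<rho> + 2)\<close>, which is more than \<open>2 / \<rho>\<close>. A
  vertex that heavy has at least three neighbours, all of them in its class or in
  \<open>R\<close>.\<close>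

lemma degree_two_class:
  assumes v: "v \<in> A" "card (F v) = 2" and r: "2 < \<rho>"
  shows "3 \<le> card {v' \<in> A. g v' = g v} + card (nb E (g v) \<inter> R)"
proof -
  have "2 - x (g v) \<le> D" using single_le_D[OF A_N[OF v(1)]] omega_A[OF v(1)] v(2) by simp
  then have "(2 - x (g v)) * (\<rho> + 2) \<le> D * (\<rho> + 2)" using r by (intro mult_right_mono) auto
  then have "4 \<le> x (g v) * (\<rho> + 2)" using D_bound by (simp add: algebra_simps)
  moreover have "x (g v) * (\<rho> + 2) < x (g v) * (2 * \<rho>)"
    using r x(1) g[OF v(1)] R_verts by (intro mult_strict_left_mono) auto
  ultimately have "2 < \<rho> * x (g v)" by (simp add: algebra_simps)
  then show ?thesis using x_g_le[OF v(1)] by linarith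
qed

text \<open>A common non-neighbour \<open>z\<close> lies in \<open>A\<close> by
  \<open>outside_nonneighbour_unique\<close>, and having at most two non-neighbours it has no
  others.\<close>

lemma link:
  assumes "v \<in> A" "v' \<in> A" "g v \<noteq> g v'"
  shows "v' \<in> F v \<or> (\<exists>z\<in>A. F z = {v, v'} \<and> z \<in> F v \<and> z \<in> F v')"
proof (cases "v' \<in> F v")
  case False
  then obtain z where z: "z \<in> F v" "z \<in> F v'" using different_classes[OF assms] by blast
  have ne: "v \<noteq> v'" using assms(3) by blast
  have "z \<in> A"
    using outside_nonneighbour_unique[OF assms(1,2) z(1) _ z(2)] ne by blast
  moreover have "F z = {v, v'}"
    by (rule F_pair_eq[OF F_N(1)[OF z(1)] F_sym[OF _ z(1)] F_sym[OF _ z(2)] ne])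
      (use assms A_N in auto)
  ultimately show ?thesis using z by blast
qed simp

lemma card_F_cases: "v \<in> A \<Longrightarrow> card (F v) = 1 \<or> card (F v) = 2"
  using F_nonempty[of v] card_F_le_2[OF A_N, of v] card_gt_0_iff[of "F v"] by force

text \<open>The exit of \<open>v\<close> has too few neighbours for \<open>degree_two_class\<close>,
  so \<open>F v = {z}\<close>. All links from \<open>v\<close> to other classes then pass through
  \<open>z\<close>, which forces \<open>A = {v, z, v'}\<close> and \<open>F z = {v, v'}\<close>. Now
  \<open>g z\<close> needs three neighbours, so \<open>v'\<close> shares this exit and the path
  continues; \<open>tail\<close> gives \<open>v'\<close> a non-neighbour \<open>c\<close> outside
  \<open>A\<close>, and \<open>z\<close> and \<open>c\<close> together cost 2.\<close>

lemma no_singleton_class: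
  assumes v: "v \<in> A" "\<And>v'. v' \<in> A \<Longrightarrow> g v' = g v \<Longrightarrow> v' = v"
    and a: "a1 \<in> A" "a2 \<in> A" "a1 \<noteq> v" "a2 \<noteq> v" "a1 \<noteq> a2" and r: "2 < \<rho>"
  shows False
proof -
  have "{v' \<in> A. g v' = g v} = {v}" using v by blast
  then have "card (F v) \<noteq> 2"
    using degree_two_class[OF v(1) _ r] card_tail_le_1[OF v(1)] by auto
  then have "card (F v) = 1" using card_F_cases[OF v(1)] by blast
  then obtain z where z: "F v = {z}" by (auto simp: card_1_singleton_iff)
  have Fz: "z \<in> A \<and> F z = {v, v'}" if "v' \<in> A" "v' \<noteq> v" "v' \<noteq> z" for v'
  proof -
    have "g v \<noteq> g v'" using v(2)[OF that(1)] that(2) by metis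
    then show ?thesis using link[OF v(1) that(1)] that(3) unfolding z by blast
  qed
  obtain v' where v': "v' \<in> A" "v' \<noteq> v" "v' \<noteq> z"
    using that a by (cases "a1 = z") auto
  have zA: "z \<in> A" and Fz': "F z = {v, v'}" using Fz[OF v'] by auto
  have sub: "y = v \<or> y = z \<or> y = v'" if "y \<in> A" for y
    using Fz[OF that] Fz' v' by blast
  have zv: "z \<noteq> v" using F_N(2)[of z v] z by auto
  have gz: "g z \<noteq> g v" using v(2)[OF zA] zv by blast
  have c2: "card (F z) = 2" using Fz' v'(2) by simp
  have cls: "{y \<in> A. g y = g z} \<subseteq> {z, v'}"
  proof
    fix y assume y: "y \<in> {y \<in> A. g y = g z}"
    then have "y \<noteq> v" using gz by auto
    then show "y \<in> {z, v'}" using sub[of y] y by blast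
  qed
  then have "card {y \<in> A. g y = g z} \<le> card {z, v'}" by (rule card_mono[rotated]) simp
  then have le2: "card {y \<in> A. g y = g z} \<le> 2" using v'(3) by simp
  have ge3: "3 \<le> card {y \<in> A. g y = g z} + card (nb E (g z) \<inter> R)"
    by (rule degree_two_class[OF zA c2 r])
  have "g v' = g z"
  proof (rule ccontr)
    assume "g v' \<noteq> g z"
    then have "{y \<in> A. g y = g z} \<subseteq> {z}" using cls by auto
    then have "card {y \<in> A. g y = g z} \<le> card {z}" by (rule card_mono[rotated]) simp
    then show False using ge3 card_tail_le_1[OF zA] by simp
  qed
  moreover have "nb E (g z) \<inter> R \<noteq> {}" using ge3 le2 by auto
  then obtain s where "s \<in> R" "(g z, s) \<in> E" by auto
  ultimately obtain c where c: "c \<in> F v'" "(g z, c) \<notin> E" using tail[OF v'(1), of s] by auto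
  have "c \<notin> A"
  proof
    assume "c \<in> A"
    then consider "c = v" | "c = z" | "c = v'" using sub by blast
    then show False
    proof cases
      case 1
      then show False using F_sym[OF A_N[OF v'(1)] c(1)] z v'(3) by simp
    next
      case 2
      then show False using g[OF zA] symE c(2) by blast
    next
      case 3
      then show False using F_N(2)[OF c(1)] by simp
    qed
  qed
  moreover have "c \<in> N" "v' \<in> F c" using F_N(1)[OF c(1)] F_sym[OF A_N[OF v'(1)] c(1)] .
  moreover have "c \<notin> F z" using Fz' v(1) v'(1) \<open>c \<notin> A\<close> by auto
  moreover have "z \<noteq> c" using zA \<open>c \<notin> A\<close> by blast
  ultimately show False
    using pair_le_D[OF A_N[OF zA], of c] c2 omega_le_1[OF A_N[OF zA]] omega_not_A[of c]
      card_F_pos[of v' c] D_lt_2 by simp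
qed

lemma no_large_classes:
  assumes large: "\<And>v. v \<in> A \<Longrightarrow> \<exists>v'\<in>A. v' \<noteq> v \<and> g v' = g v"
    and two: "a1 \<in> A" "a2 \<in> A" "g a1 \<noteq> g a2"
  shows False
proof -
  obtain b1 b2 where b: "b1 \<in> A" "b1 \<noteq> a1" "g b1 = g a1" "b2 \<in> A" "b2 \<noteq> a2" "g b2 = g a2"
    using large two by metis
  have "b1 \<noteq> a2" "b1 \<noteq> b2" "a1 \<noteq> b2" "a1 \<noteq> a2" using b two(3) by auto
  then have "card {a1, b1, a2, b2} = 4" using b by simp
  moreover have "card {a1, b1, a2, b2} \<le> card N"
    by (rule card_mono) (use two b A_N in auto)
  ultimately have t5: "5 \<le> t" using card_N by simp
  then have r: "12 < \<rho>\<^sup>2" "3 < \<rho>" using rho_sq_gt_12 rho_gt by auto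
  have "\<exists>v\<in>A. card (F v) = 1"
  proof (rule ccontr)
    assume "\<not> ?thesis"
    then have c2: "card (F y) = 2" if "y \<in> A" for y using card_F_cases[OF that] that by blast
    have "{b1, a2, b2} \<subseteq> F a1"
      using two_degree_two[OF A_N A_N _ c2 c2] two b \<open>a1 \<noteq> b2\<close> \<open>a1 \<noteq> a2\<close> by auto
    then have "card {b1, a2, b2} \<le> card (F a1)" by (rule card_mono[rotated]) simp
    then show False using c2[OF two(1)] b \<open>b1 \<noteq> a2\<close> \<open>b1 \<noteq> b2\<close> by simp
  qed
  then obtain v z where v: "v \<in> A" "F v = {z}" by (auto simp: card_1_singleton_iff)
  obtain c where c: "c \<in> A" "g c \<noteq> g v" using two by metis
  obtain c' where c': "c' \<in> A" "c' \<noteq> c" "g c' = g c" using large[OF c(1)] by blast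
  have other: "y = z \<or> z \<in> A \<and> F z = {v, y}" if "y \<in> A" "g y \<noteq> g v" for y
    using link[OF v(1) that(1)] that(2) unfolding v(2) by (metis singletonD)
  have ne: "y \<noteq> v" if "g y \<noteq> g v" for y using that by blast
  obtain z' where z': "z' \<in> A" "z \<in> A" "z' \<noteq> z" "g z' = g z" "g z \<noteq> g v" "F z = {v, z'}"
  proof (cases "c = z")
    case True
    then show ?thesis using that[of c'] other[of c'] c c' by auto
  next
    case False
    then have Fz: "z \<in> A" "F z = {v, c}" using other[OF c] by auto
    then have "c' = z" using other[of c'] c c' ne[of c'] ne[of c] by (auto simp: doubleton_eq_iff)
    then show ?thesis using that[of c] c c' Fz by auto
  qed
  have zz: "{y \<in> A. g y = g z} \<subseteq> {z, z'}"
  proof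
    fix y assume y: "y \<in> {y \<in> A. g y = g z}"
    then have "y = z \<or> F z = {v, y}" using other[of y] z'(5) by auto
    then show "y \<in> {z, z'}" using z'(6) ne[of y] y z'(5) by (auto simp: doubleton_eq_iff)
  qed
  have zv: "z \<noteq> v" "z' \<noteq> v" using ne[of z] ne[of z'] z' by auto
  have c2: "card (F z) = 2" using z'(6) zv by auto
  \<comment> \<open>Any further member \<open>y\<close> of the class of \<open>v\<close> must be
    linked to \<open>z'\<close> through an element of \<open>F z = {v, z'}\<close>. It cannot be
    \<open>v\<close>, so it is \<open>z'\<close>, and \<open>F z'\<close> leaves room for only one
    such \<open>y\<close>.\<close>
  have Fz'_eq: "F z' = {y, z}" if y: "y \<in> A" "y \<noteq> v" "g y = g v" for y
  proof -
    have "z \<notin> F y"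
    proof
      assume "z \<in> F y"
      then have "y \<in> F z" using F_sym A_N y by blast
      then show False using z' y by auto
    qed
    then obtain q where q: "F q = {y, z}" "q \<in> F z" using link[OF y(1) z'(2)] y(3) z'(5) by auto
    have "q \<noteq> v"
    proof
      assume "q = v"
      then have "y = z" using q(1) v(2) by auto
      then show False using y(3) z'(5) by simp
    qed
    then show ?thesis using q z'(6) by auto
  qed
  obtain v' where v': "v' \<in> A" "v' \<noteq> v" "g v' = g v" using large[OF v(1)] by blast
  have vv: "{y \<in> A. g y = g v} \<subseteq> {v, v'}"
  proof
    fix y assume y: "y \<in> {y \<in> A. g y = g v}"
    show "y \<in> {v, v'}"
    proof (cases "y = v")
      case False
      then have "{y, z} = {v', z}" using Fz'_eq[of y] Fz'_eq[OF v'] y by auto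
      then show ?thesis using y z'(5) by (auto simp: doubleton_eq_iff)
    qed simp
  qed
  have x_le: "\<rho> * x (g y) \<le> 3" if "y \<in> A" "{w \<in> A. g w = g y} \<subseteq> {p, q}" for y p q
  proof -
    have "card {w \<in> A. g w = g y} \<le> card {p, q}" using that(2) by (rule card_mono[rotated]) simp
    also have "\<dots> \<le> 2" by (cases "p = q") simp_all
    finally show ?thesis using x_g_le[OF that(1)] card_tail_le_1[OF that(1)] by linarith
  qed
  have "v' \<notin> F z" using z' v' by auto
  moreover have "v' \<noteq> z" using v'(3) z'(5) by auto
  ultimately have "real (card (F z)) - x (g z) + (real (card (F v')) - x (g v')) \<le> D"
    using pair_le_D[OF A_N[OF z'(2)] A_N[OF v'(1)]] omega_A z'(2) v'(1) by auto
  moreover have "1 \<le> card (F v')" using card_F_cases[OF v'(1)] by auto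
  ultimately have "3 - x (g z) - x (g v') \<le> D" using c2 by linarith
  then have "(3 - x (g z) - x (g v')) * \<rho> * (\<rho> + 2) \<le> D * \<rho> * (\<rho> + 2)"
    using r by (intro mult_right_mono) auto
  also have "\<dots> = \<rho> * (D * (\<rho> + 2))" by simp
  also have "\<dots> \<le> \<rho> * (2 * \<rho>)" using D_bound r by (intro mult_left_mono) auto
  finally have 1: "(3 - x (g z) - x (g v')) * \<rho> * (\<rho> + 2) \<le> 2 * \<rho>\<^sup>2"
    by (simp add: power2_eq_square)
  have "3 * \<rho> - 6 \<le> (3 - x (g z) - x (g v')) * \<rho>"
    using x_le[OF z'(2) zz] x_le[OF v'(1), of v v'] vv v'(3) by (simp add: algebra_simps)
  then have "(3 * \<rho> - 6) * (\<rho> + 2) \<le> (3 - x (g z) - x (g v')) * \<rho> * (\<rho> + 2)"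
    using r by (intro mult_right_mono) auto
  then have "(3 * \<rho> - 6) * (\<rho> + 2) \<le> 2 * \<rho>\<^sup>2" using 1 by linarith
  then have "\<rho>\<^sup>2 \<le> 12" by (simp add: algebra_simps power2_eq_square)
  then show False using r by simp
qed

text \<open>With a single exit, the path continues behind it, so \<open>tail\<close> gives each
  attached vertex a non-neighbour outside \<open>A\<close>, and only one vertex can have such a
  non-neighbour. With several exits, a third attached vertex is excluded by the two preceding
  lemmas; a link between the two attached vertices through a third is then impossible, so they are
  non-adjacent.\<close>

lemma attachment:
  obtains v1 v2 where "v1 \<in> A" "v2 \<in> F v1" "A \<subseteq> {v1, v2}" "v2 \<in> A \<Longrightarrow> g v1 \<noteq> g v2"
proof -
  have "A \<noteq> {}"
  proof
    assume "A = {}"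
    have "insert u N = V"
    proof (rule conn_closed_eq[OF connV])
      show "insert u N \<subseteq> V" using u N_verts by blast
      have "b \<in> insert u N" if "a \<in> insert u N" "(a, b) \<in> E" for a b
      proof (rule ccontr)
        assume "b \<notin> insert u N"
        then have b: "b \<in> R" using E_verts(2)[OF that(2)] by (simp add: R_def)
        then have "a \<noteq> u" using that(2) R_nonadj_u symE by blast
        then show False using g_eq[OF _ b that(2)] that(1) \<open>A = {}\<close> by blast
      qed
      then show "E `` insert u N \<inter> V \<subseteq> insert u N" by blast
    qed simp
    then show False using card_R by (simp add: R_def)
  qed
  then obtain v1 where v1: "v1 \<in> A" by blast
  show ?thesis
  proof (cases "\<forall>v\<in>A. g v = g v1")
    case True
    \<comment> \<open>\<open>R\<close> has at least two vertices and is reached from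
      \<open>N\<close> only through \<open>g v1\<close>.\<close>
    have "\<exists>s\<in>R. (g v1, s) \<in> E"
    proof (rule ccontr)
      assume no: "\<not> ?thesis"
      have "insert (g v1) (insert u N) = V"
      proof (rule conn_closed_eq[OF connV])
        show "insert (g v1) (insert u N) \<subseteq> V" using u N_verts g[OF v1] R_verts by blast
        have "b \<in> insert (g v1) (insert u N)" if "a \<in> insert (g v1) (insert u N)" "(a, b) \<in> E" for a b
        proof (rule ccontr)
          assume b: "b \<notin> insert (g v1) (insert u N)"
          then have bR: "b \<in> R" using E_verts(2)[OF that(2)] by (simp add: R_def)
          then have "a \<noteq> g v1" using no that(2) by blast
          moreover have "a \<noteq> u" using bR that(2) R_nonadj_u symE by blast
          ultimately have "a \<in> N" using that(1) by blast
          then have "a \<in> A" "g a = b" using g_eq[OF _ bR that(2)] by auto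
          then show False using True b by auto
        qed
        then show "E `` insert (g v1) (insert u N) \<inter> V \<subseteq> insert (g v1) (insert u N)" by blast
      qed simp
      then have "R \<subseteq> {g v1}" by (auto simp: R_def)
      then have "card R \<le> card {g v1}" by (rule card_mono[rotated]) simp
      then show False using card_R by simp
    qed
    then obtain s where s: "s \<in> R" "(g v1, s) \<in> E" by blast
    have out: "\<exists>z\<in>F v. z \<notin> A" if v: "v \<in> A" for v
    proof -
      have gv: "g v = g v1" using True v by blast
      then obtain z where z: "z \<in> F v" "(g v1, z) \<notin> E" using tail[OF v, of s] s by auto
      then have "z \<notin> A" using g[of z] True symE by metis
      then show ?thesis using z by blast
    qed
    obtain v2 where v2: "v2 \<in> F v1" "v2 \<notin> A" using out[OF v1] by blast
    have "v = v1" if v: "v \<in> A" for v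
    proof -
      obtain z where "z \<in> F v" "z \<notin> A" using out[OF v] by blast
      then show ?thesis using outside_nonneighbour_unique[OF v v1] v2 by blast
    qed
    then show ?thesis using that[of v1 v2] v1 v2 by blast
  next
    case False
    then obtain v2 where v2: "v2 \<in> A" "g v2 \<noteq> g v1" by blast
    have sub: "A \<subseteq> {v1, v2}"
    proof (rule ccontr)
      assume "\<not> ?thesis"
      then obtain v3 where v3: "v3 \<in> A" "v3 \<noteq> v1" "v3 \<noteq> v2" by blast
      have ne: "v1 \<noteq> v2" using v2 by blast
      have "card {v1, v2, v3} = 3" using v3 ne by simp
      moreover have "card {v1, v2, v3} \<le> card N"
        by (rule card_mono) (use v1 v2 v3 A_N in auto)
      ultimately have "4 \<le> t" using card_N by simp
      then have r: "2 < \<rho>" using rho_gt by linarith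
      have "\<exists>v'\<in>A. v' \<noteq> v \<and> g v' = g v" if v: "v \<in> A" for v
      proof (rule ccontr)
        assume no: "\<not> ?thesis"
        obtain a1 a2 where "a1 \<in> A" "a2 \<in> A" "a1 \<noteq> v" "a2 \<noteq> v" "a1 \<noteq> a2"
          using v1 v2(1) v3 ne by metis
        then show False using no_singleton_class[OF v _ _ _ _ _ _ r, of a1 a2] no by blast
      qed
      then show False using no_large_classes[of v1 v2] v1 v2 by metis
    qed
    have "v2 \<in> F v1"
    proof (rule ccontr)
      assume "v2 \<notin> F v1"
      then obtain z where z: "z \<in> A" "z \<in> F v1" "z \<in> F v2"
        using link[OF v1 v2(1)] v2(2) by metis
      then show False using sub F_N(2) by blast
    qed
    then show ?thesis using that[of v1 v2] v1 v2 sub by metis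
  qed
qed

end

section \<open>The path outside the neighbourhood of a heaviest vertex\<close>

definition consecutive :: "'a list \<Rightarrow> 'a \<Rightarrow> 'a \<Rightarrow> bool" where
  "consecutive L a b \<longleftrightarrow> (\<exists>i. Suc i < length L \<and> (a = L ! i \<and> b = L ! Suc i \<or> a = L ! Suc i \<and> b = L ! i))"

lemma consecutive_append1: "consecutive L a b \<Longrightarrow> consecutive (L @ M) a b"
  unfolding consecutive_def
  by (elim exE, rename_tac i, rule_tac x = i in exI) (auto simp: nth_append)

lemma consecutive_append2: "consecutive M a b \<Longrightarrow> consecutive (L @ M) a b"
  unfolding consecutive_def
  by (elim exE, rename_tac i, rule_tac x = "length L + i" in exI) (auto simp: nth_append)

lemma consecutive_rev: "consecutive L a b \<Longrightarrow> consecutive (rev L) a b"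
  unfolding consecutive_def
  by (elim exE, rename_tac i, rule_tac x = "length L - Suc (Suc i)" in exI)
    (auto simp: rev_nth Suc_diff_Suc)

context large_extremal_eigen
begin

text \<open>On the path \<open>v # ps\<close> the vertex \<open>(v # ps) ! i\<close> lies between \<open>ps ! (i - 2)\<close> and \<open>ps ! i\<close>.\<close>

definition arm :: "'a \<Rightarrow> 'a list \<Rightarrow> bool" where
  "arm v ps \<longleftrightarrow> distinct ps \<and> set ps \<subseteq> R \<and> conn E ({u, v} \<union> set ps)
    \<and> (\<forall>i < length ps. ((v # ps) ! i, ps ! i) \<in> E)
    \<and> (\<forall>i < length ps. \<forall>b\<in>R. ((v # ps) ! i, b) \<in> E \<longrightarrow> b = ps ! i \<or> 2 \<le> i \<and> b = ps ! (i - 2))"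

text \<open>The definition of \<open>arm\<close> restricts the neighbours of all vertices but the
  last. By symmetry the restriction at \<open>c\<close> also applies to the edge from the last
  vertex; there \<open>c = ps ! j\<close> is \<open>(v # ps) ! Suc j\<close>.\<close>

lemma arm_end_back:
  assumes arm: "arm v ps" and c: "c \<in> set ps" "((v # ps) ! length ps, c) \<in> E"
  shows "2 \<le> length ps \<and> c = ps ! (length ps - 2)"
proof -
  let ?l = "length ps"
  obtain j where j: "j < ?l" "c = ps ! j" using c(1) by (auto simp: in_set_conv_nth)
  then have l: "(v # ps) ! ?l = ps ! (?l - 1)" by (cases ps) auto
  have R: "ps ! (?l - 1) \<in> R" using arm j(1) by (auto simp: arm_def)
  have d: "distinct ps" using arm by (simp add: arm_def)
  have "Suc j \<noteq> ?l" using j l c(2) irrefl by (metis diff_Suc_1)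
  then have sj: "Suc j < ?l" using j(1) by simp
  have "(ps ! j, ps ! (?l - 1)) \<in> E" using c(2) l j(2) symE by simp
  then have e: "((v # ps) ! Suc j, ps ! (?l - 1)) \<in> E" by simp
  have "b = ps ! i \<or> 2 \<le> i \<and> b = ps ! (i - 2)"
    if "i < ?l" "b \<in> R" "((v # ps) ! i, b) \<in> E" for i b
    using arm that unfolding arm_def by blast
  from this[OF sj R e] have "ps ! (?l - 1) = ps ! Suc j \<or> 2 \<le> Suc j \<and> ps ! (?l - 1) = ps ! (Suc j - 2)"
    .
  then have "?l - 1 = Suc j \<or> ?l - 1 = Suc j - 2"
    using d sj by (auto simp: nth_eq_iff_index_eq)
  then have "j = ?l - 2 \<and> 2 \<le> ?l" using sj by linarith
  then show ?thesis using j(2) by simp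
qed

text \<open>Apart from \<open>arm_end_back\<close>, this is \<open>arm_unique\<close> with
  \<open>P = set ps\<close>: only one vertex of \<open>R\<close> outside the arm can be adjacent to
  it.\<close>

lemma arm_extend:
  assumes v: "v \<in> N" and arm: "arm v ps" and b: "b \<in> R" "b \<notin> set ps" "((v # ps) ! length ps, b) \<in> E"
  shows "arm v (ps @ [b])"
proof -
  let ?l = "length ps" and ?z = "(v # ps) ! length ps"
  have zin: "?z \<in> {u, v} \<union> set ps" by (cases ps) (auto simp: nth_Cons')
  have "conn E (insert b ({u, v} \<union> set ps))"
    by (rule conn_insert[of _ _ ?z]) (use arm zin b symE in \<open>auto simp: arm_def\<close>)
  moreover have nth: "(v # ps @ [b]) ! i = (v # ps) ! i" if "i \<le> ?l" for i
    using that by (cases i) (auto simp: nth_append)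
  moreover have "c = b \<or> 2 \<le> ?l \<and> c = ps ! (?l - 2)" if c: "c \<in> R" "(?z, c) \<in> E" for c
  proof (cases "c \<in> set ps")
    case True
    then show ?thesis using arm_end_back[OF arm _ c(2)] by blast
  next
    case False
    have "c = b"
      by (rule arm_unique[OF v, of "set ps"]) (use arm b c False zin in \<open>auto simp: arm_def\<close>)
    then show ?thesis ..
  qed
  ultimately show ?thesis
    using arm b unfolding arm_def by (auto simp: less_Suc_eq nth_append)
qed

text \<open>In a longest arm, which exists since arms are distinct lists in \<open>R\<close>, the
  restriction on neighbours extends to the last vertex, the case
  \<open>i = length ps\<close>.\<close>

lemma maximal_arm:
  assumes v: "v \<in> N"
  obtains ps where "distinct ps" "set ps \<subseteq> R"
    and "\<And>i. i < length ps \<Longrightarrow> ((v # ps) ! i, ps ! i) \<in> E"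
    and "\<And>i c. i \<le> length ps \<Longrightarrow> c \<in> R \<Longrightarrow> ((v # ps) ! i, c) \<in> E \<Longrightarrow>
      i < length ps \<and> c = ps ! i \<or> 2 \<le> i \<and> i \<le> length ps \<and> c = ps ! (i - 2)"
proof -
  have "arm v []" using conn_pair[of u v] N_adj[OF v] by (simp add: arm_def)
  moreover have "length ps < Suc (card R)" if "arm v ps" for ps
  proof -
    have "card (set ps) \<le> card R" using that by (intro card_mono) (auto simp: arm_def)
    then show ?thesis using that by (simp add: arm_def distinct_card)
  qed
  ultimately obtain ps where ps: "arm v ps" "\<And>qs. arm v qs \<Longrightarrow> length qs \<le> length ps"
    using ex_has_greatest_nat[of "arm v" "[]" length "Suc (card R)"] by blast
  have "c \<in> set ps" if "c \<in> R" "((v # ps) ! length ps, c) \<in> E" for c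
    using arm_extend[OF v ps(1) that(1) _ that(2)] ps(2)[of "ps @ [c]"] by auto
  then have last: "2 \<le> length ps \<and> c = ps ! (length ps - 2)"
    if "c \<in> R" "((v # ps) ! length ps, c) \<in> E" for c
    using arm_end_back[OF ps(1)] that by blast
  show ?thesis
  proof (rule that[of ps])
    fix i c assume "i \<le> length ps" "c \<in> R" "((v # ps) ! i, c) \<in> E"
    then show "i < length ps \<and> c = ps ! i \<or> 2 \<le> i \<and> i \<le> length ps \<and> c = ps ! (i - 2)"
      using ps(1) last by (cases "i = length ps") (auto simp: arm_def)
  qed (use ps(1) in \<open>auto simp: arm_def\<close>)
qed

lemma arm_consecutive:
  assumes "distinct ps"
    and close: "\<And>i c. i \<le> length ps \<Longrightarrow> c \<in> R \<Longrightarrow> ((v # ps) ! i, c) \<in> E \<Longrightarrow>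
      i < length ps \<and> c = ps ! i \<or> 2 \<le> i \<and> i \<le> length ps \<and> c = ps ! (i - 2)"
    and a: "a \<in> set ps" "c \<in> R" "(a, c) \<in> E"
  shows "c \<in> set ps \<and> consecutive ps a c"
proof -
  obtain j where j: "j < length ps" "a = ps ! j" using a(1) by (auto simp: in_set_conv_nth)
  then have "Suc j < length ps \<and> c = ps ! Suc j \<or> 2 \<le> Suc j \<and> c = ps ! (Suc j - 2)"
    using close[of "Suc j" c] a by auto
  then show ?thesis
  proof
    assume "Suc j < length ps \<and> c = ps ! Suc j"
    then show ?thesis using j by (auto simp: consecutive_def)
  next
    assume "2 \<le> Suc j \<and> c = ps ! (Suc j - 2)"
    then obtain k where "j = Suc k" "c = ps ! k" by (cases j) auto
    then show ?thesis using j by (auto simp: consecutive_def)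
  qed
qed

text \<open>A maximal arm is closed under neighbours in \<open>R\<close>. If the exit of
  \<open>v2\<close> lies on the arm of \<open>v1\<close>, that arm exhausts \<open>R\<close>, and by
  \<open>R_nb_unique'\<close> the exit cannot be an inner vertex. Otherwise the arms of
  \<open>v1\<close> and \<open>v2\<close> are disjoint and together exhaust
  \<open>R\<close>.\<close>

lemma outer_path:
  obtains v1 v2 L where "v1 \<in> N" "v2 \<in> F v1" "distinct L" "set L = R"
    and "\<And>a b. a \<in> R \<Longrightarrow> b \<in> R \<Longrightarrow> (a, b) \<in> E \<Longrightarrow> consecutive L a b"
    and "\<And>a b. a \<in> N \<Longrightarrow> b \<in> R \<Longrightarrow> (a, b) \<in> E \<Longrightarrow>
      a = v1 \<and> b = L ! 0 \<or> a = v2 \<and> b = L ! (length L - 1)"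
proof -
  obtain v1 v2 where v: "v1 \<in> A" "v2 \<in> F v1" "A \<subseteq> {v1, v2}" "v2 \<in> A \<Longrightarrow> g v1 \<noteq> g v2"
    using attachment by blast
  have N: "v1 \<in> N" "v2 \<in> N" using A_N v(1) F_N(1)[OF v(2)] by auto
  obtain ps where ps: "distinct ps" "set ps \<subseteq> R"
    "\<And>i. i < length ps \<Longrightarrow> ((v1 # ps) ! i, ps ! i) \<in> E"
    and close: "\<And>i c. i \<le> length ps \<Longrightarrow> c \<in> R \<Longrightarrow> ((v1 # ps) ! i, c) \<in> E \<Longrightarrow>
      i < length ps \<and> c = ps ! i \<or> 2 \<le> i \<and> i \<le> length ps \<and> c = ps ! (i - 2)"
    using maximal_arm[OF N(1)] by blast
  have cons: "c \<in> set ps \<and> consecutive ps a c" if "a \<in> set ps" "c \<in> R" "(a, c) \<in> E" for a c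
    by (rule arm_consecutive[OF ps(1) _ that]) (rule close)
  have ne: "ps \<noteq> []" "g v1 = ps ! 0" using close[of 0 "g v1"] g[OF v(1)] by auto
  have exhaust: "P = R"
    if P: "P \<subseteq> R" "\<And>a c. a \<in> P \<Longrightarrow> c \<in> R \<Longrightarrow> (a, c) \<in> E \<Longrightarrow> c \<in> P" "\<And>a. a \<in> A \<Longrightarrow> g a \<in> P" for P
  proof -
    have "insert u N \<union> P = V"
    proof (rule conn_closed_eq[OF connV])
      show "insert u N \<union> P \<subseteq> V" using u N_verts R_verts P(1) by blast
      have "b \<in> insert u N \<union> P" if "a \<in> insert u N \<union> P" "(a, b) \<in> E" for a b
      proof (rule ccontr)
        assume nb: "b \<notin> insert u N \<union> P"
        then have b: "b \<in> R" using E_verts(2)[OF that(2)] by (simp add: R_def)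
        then have "a \<noteq> u" using that(2) R_nonadj_u symE by blast
        moreover have "a \<notin> P" using P(2)[OF _ b that(2)] nb by blast
        ultimately have "a \<in> N" using that(1) by blast
        then show False using g_eq[OF _ b that(2)] P(3) nb by blast
      qed
      then show "E `` (insert u N \<union> P) \<inter> V \<subseteq> insert u N \<union> P" by blast
    qed simp
    then show ?thesis using P(1) disj by (auto simp: R_def)
  qed
  show ?thesis
  proof (cases "v2 \<in> A \<and> g v2 \<notin> set ps")
    case False
    have "set ps = R"
    proof (rule exhaust[OF ps(2)])
      show "c \<in> set ps" if "a \<in> set ps" "c \<in> R" "(a, c) \<in> E" for a c
        using cons[OF that] by blast
      show "g a \<in> set ps" if "a \<in> A" for a
        using that v(3) ne False by (cases "a = v1") auto
    qed
    moreover have "b = ps ! (length ps - 1)" if b: "v2 \<in> A" "b = g v2" for b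
    proof -
      obtain j where j: "j < length ps" "b = ps ! j" using False b by (auto simp: in_set_conv_nth)
      then have "j \<noteq> 0" using v(4) b ne by metis
      then obtain k where k: "j = Suc k" by (cases j) auto
      have "Suc j = length ps"
      proof (rule ccontr)
        assume "Suc j \<noteq> length ps"
        then have sj: "Suc j < length ps" using j by simp
        have "ps ! Suc j = ps ! k"
        proof (rule R_nb_unique'[OF N(2)])
          show "b \<in> R" "(v2, b) \<in> E" using g[OF b(1)] b(2) by auto
          show "ps ! Suc j \<in> R" "ps ! k \<in> R" using ps(2) sj k by auto
          show "(b, ps ! Suc j) \<in> E" using ps(3)[OF sj] j(2) by simp
          show "(b, ps ! k) \<in> E" using ps(3)[OF j(1)] j(2) k symE by simp
        qed
        then show False using ps(1) sj k by (simp add: nth_eq_iff_index_eq)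
      qed
      then show ?thesis using j by (metis diff_Suc_1)
    qed
    then have "a = v1 \<and> b = ps ! 0 \<or> a = v2 \<and> b = ps ! (length ps - 1)"
      if "a \<in> N" "b \<in> R" "(a, b) \<in> E" for a b
      using g_eq[OF that] v(3) ne by blast
    moreover have "consecutive ps a b" if "a \<in> R" "b \<in> R" "(a, b) \<in> E" for a b
      using cons[of a b] that \<open>set ps = R\<close> by blast
    ultimately show ?thesis using that[OF N(1) v(2) ps(1)] by blast
  next
    case True
    obtain qs where qs: "distinct qs" "set qs \<subseteq> R"
      "\<And>i. i < length qs \<Longrightarrow> ((v2 # qs) ! i, qs ! i) \<in> E"
      and close': "\<And>i c. i \<le> length qs \<Longrightarrow> c \<in> R \<Longrightarrow> ((v2 # qs) ! i, c) \<in> E \<Longrightarrow>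
        i < length qs \<and> c = qs ! i \<or> 2 \<le> i \<and> i \<le> length qs \<and> c = qs ! (i - 2)"
      using maximal_arm[OF N(2)] by blast
    have cons': "c \<in> set qs \<and> consecutive qs a c" if "a \<in> set qs" "c \<in> R" "(a, c) \<in> E" for a c
      by (rule arm_consecutive[OF qs(1) _ that]) (rule close')
    have ne': "qs \<noteq> []" "g v2 = qs ! 0" using close'[of 0 "g v2"] g True by auto
    have "qs ! i \<notin> set ps" if "i < length qs" for i
      using that
    proof (induction i)
      case 0
      then show ?case using ne' True by simp
    next
      case (Suc i)
      then have e: "(qs ! Suc i, qs ! i) \<in> E" using qs(3)[of "Suc i"] symE by simp
      have "qs ! i \<in> R" using qs(2) Suc.prems by auto
      then show ?case using cons[OF _ _ e] Suc by auto
    qed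
    then have disjoint: "set ps \<inter> set qs = {}" by (metis disjoint_iff in_set_conv_nth)
    \<comment> \<open>Reversing \<open>qs\<close> puts the exit of \<open>v2\<close> at the end of
      the list. No edge of G joins \<open>ps\<close> to \<open>qs\<close> here; the list only has to
      provide an embedding into \<open>S\<close>.\<close>
    let ?L = "ps @ rev qs"
    have L: "set ?L = R"
    proof (rule exhaust)
      show "set ?L \<subseteq> R" using ps(2) qs(2) by simp
      show "c \<in> set ?L" if "a \<in> set ?L" "c \<in> R" "(a, c) \<in> E" for a c
        using cons[OF _ that(2,3)] cons'[OF _ that(2,3)] that(1) by auto
      show "g a \<in> set ?L" if "a \<in> A" for a
        using that v(3) ne ne' by (cases "a = v1") auto
    qed
    have "consecutive ?L a b" if "a \<in> R" "b \<in> R" "(a, b) \<in> E" for a b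
    proof -
      have "a \<in> set ps \<or> a \<in> set qs" using that(1) L by auto
      then show ?thesis
        using cons[OF _ that(2,3)] cons'[OF _ that(2,3)]
          consecutive_append1 consecutive_append2 consecutive_rev by metis
    qed
    moreover have "?L ! 0 = ps ! 0" "?L ! (length ?L - 1) = qs ! 0"
      using ne(1) ne'(1) by (simp add: nth_append) (use ne'(1) in \<open>cases qs; simp add: nth_append\<close>)
    then have "a = v1 \<and> b = ?L ! 0 \<or> a = v2 \<and> b = ?L ! (length ?L - 1)"
      if "a \<in> N" "b \<in> R" "(a, b) \<in> E" for a b
      using g_eq[OF that] v(3) ne(2) ne'(2) by auto
    moreover have "distinct ?L" using ps(1) qs(1) disjoint by auto
    ultimately show ?thesis using that[OF N(1) v(2) _ L] by blast
  qed
qed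

lemma iso_S: "digraph_iso (with_proj G) (with_proj S)"
proof -
  obtain v1 v2 L where v: "v1 \<in> N" "v2 \<in> F v1" and L: "distinct L" "set L = R"
    and RR: "\<And>a b. a \<in> R \<Longrightarrow> b \<in> R \<Longrightarrow> (a, b) \<in> E \<Longrightarrow> consecutive L a b"
    and NR: "\<And>a b. a \<in> N \<Longrightarrow> b \<in> R \<Longrightarrow> (a, b) \<in> E \<Longrightarrow>
      a = v1 \<and> b = L ! 0 \<or> a = v2 \<and> b = L ! (length L - 1)"
    using outer_path by blast
  have v2: "v2 \<in> N" "v2 \<noteq> v1" "(v1, v2) \<notin> E" using v(2) by (auto simp: F_def)
  obtain cs where cs: "distinct cs" "set cs = insert u N - {v1, v2}"
    using finite_distinct_list[of "insert u N - {v1, v2}"] by auto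
  have "card (insert u N - {v1, v2}) = card (insert u N) - card {v1, v2}"
    by (rule card_Diff_subset) (use v(1) v2 in auto)
  then have lcs: "length cs = t - 2"
    using distinct_card[OF cs(1)] cs(2) v2(2) card_N disj(1) t3 by simp
  \<comment> \<open>The order imitates the layout of \<open>S\<close>: the non-adjacent pair takes
    the places 0 and 1 of the subdivided edge, and \<open>L\<close> takes the path \<open>t\<close>,
    ..., \<open>n - 1\<close>.\<close>
  let ?core = "v1 # v2 # cs"
  let ?zs = "?core @ L"
  have lcore: "length ?core = t" using lcs t3 by simp
  have core: "set ?core = insert u N" using cs(2) v(1) v2(1) by auto
  have dz: "distinct ?zs"
    using cs v2(2) L disj core by (auto simp: R_def)
  have sz: "set ?zs = V"
    unfolding set_append core L(2) R_def using u(1) N_verts by blast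
  have lz: "length ?zs = n" using distinct_card[OF dz] sz cardV by simp
  then have lL: "length L = n - t" using lcore by simp
  have bij: "bij_betw (nth ?zs) {..<n} V"
    using bij_betw_nth[OF dz, of "{..<n}" V] lz sz by simp
  define f where "f = the_inv_into {..<n} (nth ?zs)"
  have f: "bij_betw f V (pverts S)"
    unfolding f_def S_verts by (rule bij_betw_the_inv_into[OF bij])
  have f_nth: "f (?zs ! i) = i" if "i < n" for i
    unfolding f_def by (rule the_inv_into_f_f) (use bij that in \<open>auto simp: bij_betw_def\<close>)
  have nth_eq: "?zs ! i = ?zs ! j \<longleftrightarrow> i = j" if "i < n" "j < n" for i j
    using nth_eq_iff_index_eq[OF dz] that lz by simp
  have inR: "?zs ! i \<in> R \<and> ?zs ! i = L ! (i - t)" if "t \<le> i" "i < n" for i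
  proof -
    have "?zs ! i = L ! (i - t)" unfolding nth_append lcore using that by simp
    moreover have "L ! (i - t) \<in> set L" by (rule nth_mem) (use that lL in linarith)
    ultimately show ?thesis unfolding L(2) by (simp only: simp_thms)
  qed
  have inC: "?zs ! i \<in> insert u N" if "i < t" for i
  proof -
    have "?zs ! i = ?core ! i" unfolding nth_append lcore using that by simp
    moreover have "?core ! i \<in> set ?core" by (rule nth_mem) (simp only: lcore that)
    ultimately show ?thesis unfolding core by (simp only:)
  qed
  have nth_L: "?zs ! (t + k) = L ! k" if "k < n - t" for k
    using inR[of "t + k"] that by simp
  have z01: "?zs ! 0 = v1" "?zs ! 1 = v2" by auto
  have cross: "(i = 0 \<and> j = t) \<or> (i = 1 \<and> j = n - 1)"
    if "i < t" "t \<le> j" "j < n" "(?zs ! i, ?zs ! j) \<in> E" for i j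
  proof -
    have j: "?zs ! j \<in> R" using inR that by blast
    then have "?zs ! i \<noteq> u" using that(4) R_nonadj_u symE by metis
    then have "?zs ! i \<in> N" using inC[OF that(1)] by blast
    from NR[OF this j that(4)] show ?thesis
    proof
      assume "?zs ! i = v1 \<and> ?zs ! j = L ! 0"
      then have "?zs ! i = ?zs ! 0" "?zs ! j = ?zs ! (t + 0)" using z01 nth_L[of 0] nt by auto
      then show ?thesis using nth_eq[of i 0] nth_eq[of j "t + 0"] that nt by auto
    next
      assume "?zs ! i = v2 \<and> ?zs ! j = L ! (length L - 1)"
      then have "?zs ! i = ?zs ! 1" "?zs ! j = ?zs ! (t + (n - t - 1))"
        using z01 nth_L[of "n - t - 1"] nt lL by auto
      then show ?thesis using nth_eq[of i 1] nth_eq[of j "t + (n - t - 1)"] that nt t3 by auto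
    qed
  qed
  show ?thesis
  proof (rule iso_of_embedding[OF admissible_S f])
    fix a b assume ab: "(a, b) \<in> E"
    obtain i j where i: "i < n" "a = ?zs ! i" and j: "j < n" "b = ?zs ! j"
      using E_verts[OF ab] sz lz by (metis in_set_conv_nth)
    have ij: "i \<noteq> j" using ab irrefl i j by auto
    have "(i, j) \<in> parcs S"
    proof -
      consider "i < t" "j < t" | "i < t" "t \<le> j" | "t \<le> i" "j < t" | "t \<le> i" "t \<le> j" by linarith
      then show ?thesis
      proof cases
        case 1
        have "\<not> (i < 2 \<and> j < 2)"
        proof
          assume "i < 2 \<and> j < 2"
          then have "(i = 0 \<and> j = 1) \<or> (i = 1 \<and> j = 0)" using ij by auto
          then show False using ab i j z01 v2(3) symE by metis
        qed
        then show ?thesis using 1 ij by (simp add: S_arcs)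
      next
        case 2
        then show ?thesis using cross[of i j] ab i j by (auto simp: S_arcs)
      next
        case 3
        then show ?thesis using cross[of j i] symE[OF ab] i j by (auto simp: S_arcs)
      next
        case 4
        then obtain k where k: "Suc k < length L"
          "a = L ! k \<and> b = L ! Suc k \<or> a = L ! Suc k \<and> b = L ! k"
          using RR[of a b] inR i j ab unfolding consecutive_def by metis
        have kn: "t + k < n" "t + Suc k < n" using k(1) lL by linarith+
        have Lk: "L ! k = ?zs ! (t + k)" "L ! Suc k = ?zs ! (t + Suc k)"
          by (rule nth_L[symmetric]; use kn in linarith)+
        from k(2) have "i = t + k \<and> j = t + Suc k \<or> i = t + Suc k \<and> j = t + k"
          by (simp only: Lk i(2) j(2) nth_eq[OF i(1) kn(1)] nth_eq[OF i(1) kn(2)]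
            nth_eq[OF j(1) kn(1)] nth_eq[OF j(1) kn(2)])
        then show ?thesis using kn by (elim disjE) (simp_all add: S_arcs)
      qed
    qed
    then show "(f a, f b) \<in> parcs S" using f_nth i j by simp
  qed
qed

end

lemma (in large_extremal) iso_subdivided_complete_graph: "digraph_iso (with_proj G) (with_proj S)"
proof -
  obtain x where x: "\<And>v. v \<in> V \<Longrightarrow> 0 < x v" "\<And>v. v \<in> V \<Longrightarrow> (\<Sum>w\<in>nb E v. x w) = \<rho> * x v"
    using positive_eigenvector by blast
  have "V \<noteq> {}" using connV by (simp add: conn_def)
  then have "Max (x ` V) \<in> x ` V" using finV by simp
  then obtain u where u: "u \<in> V" "x u = Max (x ` V)" by auto
  have le: "x v \<le> x u" if "v \<in> V" for v using that u(2) finV by simp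
  have pos: "0 < x u" using x(1) u(1) by blast
  interpret large_extremal_eigen n t G "\<lambda>v. x v / x u" u
  proof
    show "(\<Sum>w\<in>nb E v. x w / x u) = \<rho> * (x v / x u)" if "v \<in> V" for v
      using x(2)[OF that] by (simp add: sum_divide_distrib[symmetric])
  qed (use u le pos x(1) in auto)
  show ?thesis by (rule iso_S)
qed

section \<open>Extremal graphs of order \<open>t + 1\<close>\<close>

text \<open>Among \<open>t + 1\<close> vertices, only a single vertex leaves \<open>t\<close> others
  outside.\<close>

lemma not_spreads_of_small_degree:
  assumes "finite V" "E \<subseteq> V \<times> V" "card V = t + 1" "0 < t" "\<And>v. v \<in> V \<Longrightarrow> card (nb E v) < t"
  shows "\<not> spreads t E V"
proof
  assume "spreads t E V"
  then obtain B where B: "B \<subseteq> V" "conn E B" "t \<le> card (E `` B - B)"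
    unfolding spreads_def by blast
  have fin: "finite B" and ne: "B \<noteq> {}"
    using B assms(1) finite_subset by (auto simp: conn_def)
  have "card (E `` B - B) \<le> card (V - B)"
    by (rule card_mono) (use assms(1,2) in auto)
  also have "\<dots> = t + 1 - card B" using card_Diff_subset[OF fin B(1)] assms(3) by simp
  finally have "t \<le> t + 1 - card B" using B(3) by simp
  moreover have "card B \<noteq> 0" using fin ne by simp
  ultimately have "card B = 1" using assms(4) by arith
  then obtain v where v: "B = {v}" by (auto simp: card_1_singleton_iff)
  have "finite (nb E v)" using finite_subset[OF nb_subset[OF assms(2)] assms(1)] .
  then have "card (E `` B - B) \<le> card (nb E v)"
    unfolding v by (intro card_mono) (auto simp: nb_def)
  then show False using B(1,3) assms(5)[of v] v by auto
qed

text \<open>The neighbourhood of \<open>v\<close> in the complement.\<close>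

definition conb :: "('a \<times> 'a) set \<Rightarrow> 'a set \<Rightarrow> 'a \<Rightarrow> 'a set" where
  "conb E V v = {w \<in> V. w \<noteq> v \<and> (v, w) \<notin> E}"

context fin_graph
begin

lemma finite_conb [simp]: "finite (conb E V v)"
  using finV by (simp add: conb_def)

lemma verts_split:
  assumes "v \<in> V"
  shows "V = insert v (nb E v \<union> conb E V v)" "v \<notin> nb E v \<union> conb E V v"
    "nb E v \<inter> conb E V v = {}"
  using assms E_verts irrefl by (auto simp: conb_def)

lemma card_nb_conb:
  assumes "v \<in> V"
  shows "card (nb E v) + card (conb E V v) + 1 = card V"
proof -
  have "card V = Suc (card (nb E v \<union> conb E V v))"
    using verts_split(1,2)[OF assms] by (metis card_insert_disjoint finite_Un finite_conb finite_nb)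
  then show ?thesis using verts_split(3)[OF assms] by (simp add: card_Un_disjoint)
qed

lemma sum_nb_conb:
  fixes y :: "'a \<Rightarrow> real"
  assumes "v \<in> V"
  shows "(\<Sum>w\<in>nb E v. y w) = (\<Sum>w\<in>V. y w) - y v - (\<Sum>w\<in>conb E V v. y w)"
proof -
  have "(\<Sum>w\<in>V. y w) = y v + (\<Sum>w\<in>nb E v \<union> conb E V v. y w)"
    using verts_split(1,2)[OF assms] by (metis sum.insert finite_Un finite_conb finite_nb)
  then show ?thesis using verts_split(3)[OF assms] by (simp add: sum.union_disjoint)
qed

text \<open>If \<open>X\<close> is closed and proper, a vertex in \<open>X\<close> misses all of
  \<open>V - X\<close> and a vertex outside misses all of \<open>X\<close>, so their degrees in the
  complement add up to at least \<open>card V\<close>.\<close>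

lemma conn_of_large_degree:
  assumes "V \<noteq> {}" "\<And>a b. a \<in> V \<Longrightarrow> b \<in> V \<Longrightarrow> card (conb E V a) + card (conb E V b) < card V"
  shows "conn E V"
  unfolding conn_def
proof (intro conjI allI impI assms(1))
  fix X assume X: "X \<subseteq> V" "X \<noteq> {}" "E `` X \<inter> V \<subseteq> X"
  show "X = V"
  proof (rule ccontr)
    assume "X \<noteq> V"
    then obtain a b where ab: "a \<in> X" "b \<in> V - X" using X by blast
    have "card (V - X) \<le> card (conb E V a)"
      by (rule card_mono[OF finite_conb]) (use ab X in \<open>auto simp: conb_def\<close>)
    moreover have "card X \<le> card (conb E V b)"
    proof (rule card_mono[OF finite_conb])
      have "x \<noteq> b \<and> (b, x) \<notin> E" if "x \<in> X" for x using that ab X(3) symE[of b x] by blast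
      then show "X \<subseteq> conb E V b" using X(1) by (auto simp: conb_def)
    qed
    moreover have "card X + card (V - X) = card V"
      using X(1) finV by (metis card_Diff_subset card_mono finite_subset le_add_diff_inverse)
    ultimately show False using assms(2)[of a b] ab X(1) by auto
  qed
qed

end

text \<open>A fixed-point-free involution is a perfect matching; its pairs are removed one by one.
  The index set has the shape of the labels \<open>(i, x)\<close> of
  \<open>star_forest\<close>.\<close>

lemma matching_enumeration:
  assumes "finite W" "\<And>v. v \<in> W \<Longrightarrow> h v \<in> W \<and> h v \<noteq> v \<and> h (h v) = v"
  shows "\<exists>m \<phi>. bij_betw \<phi> ({..<m::nat} \<times> {0, 1::nat}) W \<and> (\<forall>i<m. \<phi> (i, 1) = h (\<phi> (i, 0)))"
  using assms
proof (induction "card W" arbitrary: W rule: less_induct)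
  case less
  show ?case
  proof (cases "W = {}")
    case True
    show ?thesis
      by (rule exI[of _ 0], rule exI[of _ "\<lambda>_. undefined"]) (simp add: True bij_betw_def)
  next
    case False
    then obtain v where v: "v \<in> W" by blast
    let ?W = "W - {v, h v}"
    have c1: "card ?W < card W"
      by (rule psubset_card_mono[OF less.prems(1)]) (use v in blast)
    have c2: "h w \<in> ?W \<and> h w \<noteq> w \<and> h (h w) = w" if "w \<in> ?W" for w
      using less.prems(2)[of w] less.prems(2)[OF v] that by (metis DiffD1 DiffD2 DiffI insert_iff empty_iff)
    have "\<exists>m \<phi>. bij_betw \<phi> ({..<m::nat} \<times> {0, 1::nat}) ?W \<and> (\<forall>i<m. \<phi> (i, 1) = h (\<phi> (i, 0)))"
      by (rule less.hyps[OF c1 _ c2]) (use less.prems(1) in simp_all)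
    then obtain m :: nat and \<phi> where \<phi>: "bij_betw \<phi> ({..<m} \<times> {0, 1::nat}) ?W"
      "\<forall>i<m. \<phi> (i, 1) = h (\<phi> (i, 0))"
      by blast
    define \<psi> where "\<psi> = \<phi>((m, 0) := v, (m, 1) := h v)"
    have "bij_betw \<psi> ({..<m} \<times> {0, 1} \<union> {(m, 0), (m, 1)}) (?W \<union> {v, h v})"
    proof (rule bij_betw_combine)
      have "bij_betw \<psi> ({..<m} \<times> {0, 1}) ?W \<longleftrightarrow> bij_betw \<phi> ({..<m} \<times> {0, 1}) ?W"
        by (rule bij_betw_cong) (auto simp: \<psi>_def)
      then show "bij_betw \<psi> ({..<m} \<times> {0, 1}) ?W" using \<phi>(1) by blast
      show "bij_betw \<psi> {(m, 0), (m, 1)} {v, h v}"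
        using less.prems(2)[OF v] by (auto simp: bij_betw_def inj_on_def \<psi>_def)
    qed auto
    moreover have "{..<m} \<times> {0, 1} \<union> {(m, 0), (m, 1)} = {..<Suc m} \<times> {0, 1::nat}" by auto
    moreover have "?W \<union> {v, h v} = W" using v less.prems(2)[OF v] by auto
    moreover have "\<psi> (i, 1) = h (\<psi> (i, 0))" if "i < Suc m" for i
      using \<phi>(2) that by (auto simp: \<psi>_def less_Suc_eq)
    ultimately show ?thesis by metis
  qed
qed

lemma star_forest_verts: "pverts (star_forest ks) = {(i, x). i < length ks \<and> x \<le> ks ! i}"
  by (auto simp: star_forest_def star_def)

lemma star_forest_arcs: "((i, x), (j, y)) \<in> parcs (star_forest ks) \<longleftrightarrow>
    i = j \<and> i < length ks \<and> (x = 0 \<and> 1 \<le> y \<and> y \<le> ks ! i \<or> y = 0 \<and> 1 \<le> x \<and> x \<le> ks ! i)"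
  by (auto simp: star_forest_def star_def)

lemma conb_complement:
  assumes "pair_graph H" "v \<in> pverts H"
  shows "conb (parcs (complement H)) (pverts H) v = nb (parcs H) v"
proof -
  interpret fin_graph "pverts H" "parcs H" by (rule fin_graph_pair_graph[OF assms(1)])
  show ?thesis using assms(2) E_verts irrefl by (auto simp: conb_def complement_def)
qed

lemma nb_star_forest:
  assumes "(i, x) \<in> pverts (star_forest ks)"
  shows "nb (parcs (star_forest ks)) (i, x) = (if x = 0 then {i} \<times> {1..ks ! i} else {(i, 0)})"
  using assms by (auto simp: star_forest_verts star_forest_arcs)

section \<open>The complement of the star forest as a competitor\<close>

locale small_extremal = extremal +
  assumes t3: "3 \<le> t" and nt: "n = t + 1"
begin

abbreviation "H \<equiv> H_graph t"
abbreviation "K \<equiv> complement H"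

definition ks :: "nat list" where
  "ks = (if odd t then replicate ((t + 1) div 2) 1 else 2 # replicate ((t - 2) div 2) 1)"

lemma H_eq: "H = star_forest ks"
  by (simp add: H_graph_def ks_def)

lemma pg_H: "pair_graph H" and card_H: "card (pverts H) = n"
  using pair_graph_star_forest card_H_graph[of t] t3 nt by (auto simp: H_eq)

lemma ks_nth: "i < length ks \<Longrightarrow> ks ! i = (if even t \<and> i = 0 then 2 else 1)"
  by (auto simp: ks_def nth_Cons split: nat.splits)

lemma length_ks: "length ks = (if odd t then (t + 1) div 2 else t div 2)"
  using t3 by (auto simp: ks_def elim!: evenE)

lemma H_verts: "(i, x) \<in> pverts H \<longleftrightarrow> i < length ks \<and> x \<le> (if even t \<and> i = 0 then 2 else 1)"
  by (auto simp: H_eq star_forest_verts ks_nth)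

lemma nb_H:
  assumes "(i, x) \<in> pverts H"
  shows "nb (parcs H) (i, x) = (if x = 0 then {i} \<times> {1..(if even t \<and> i = 0 then 2 else 1)} else {(i, 0)})"
  using nb_star_forest[of i x ks] assms ks_nth unfolding H_eq by (auto simp: star_forest_verts)

sublocale H: fin_graph "pverts H" "parcs H"
  by (rule fin_graph_pair_graph[OF pg_H])

lemma pg_K: "pair_graph K" and K_verts: "pverts K = pverts H"
  using pair_graph_complement[OF pg_H] by (auto simp: complement_def)

sublocale K: fin_graph "pverts H" "parcs K"
  using fin_graph_pair_graph[OF pg_K] K_verts by simp

lemma conb_K: "p \<in> pverts H \<Longrightarrow> conb (parcs K) (pverts H) p = nb (parcs H) p"
  by (rule conb_complement[OF pg_H])

lemma card_nb_H:
  assumes "p \<in> pverts H"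
  shows "card (nb (parcs H) p) = (if even t \<and> p = (0, 0) then 2 else 1)"
  using assms nb_H by (cases p) auto

lemma admissible_K: "admissible n t K"
proof -
  have d: "1 \<le> card (conb (parcs K) (pverts H) p)" "card (conb (parcs K) (pverts H) p) \<le> 2"
    "odd t \<Longrightarrow> card (conb (parcs K) (pverts H) p) = 1" if "p \<in> pverts H" for p
    unfolding conb_K[OF that] card_nb_H[OF that] by auto
  have ne: "pverts H \<noteq> {}" using card_H nt by auto
  have "conn (parcs K) (pverts H)"
  proof (rule K.conn_of_large_degree[OF ne])
    fix a b assume ab: "a \<in> pverts H" "b \<in> pverts H"
    \<comment> \<open>Degrees in \<open>H\<close> are at most 2, so two of them add up to less than
      the order unless it is 4; then \<open>t\<close> is odd and all degrees are 1.\<close>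
    have "t = 3 \<or> 5 \<le> card (pverts H)" using t3 nt card_H by auto
    then show "card (conb (parcs K) (pverts H) a) + card (conb (parcs K) (pverts H) b) < card (pverts H)"
      using d[OF ab(1)] d[OF ab(2)] card_H nt by auto
  qed
  moreover have "\<not> spreads t (parcs K) (pverts H)"
  proof (rule not_spreads_of_small_degree[OF K.finV K.EV])
    show "card (nb (parcs K) p) < t" if "p \<in> pverts H" for p
      using K.card_nb_conb[OF that] d(1)[OF that] card_H nt by simp
  qed (use card_H nt t3 in simp_all)
  ultimately show ?thesis using pg_K card_H by (simp add: admissible_def K_verts)
qed

text \<open>\<open>test_vector\<close> for \<open>K\<close>, with neighbour sums in \<open>K\<close>
  rewritten as the total minus the terms missing in the complement.\<close>

lemma K_test:
  assumes y: "\<And>p. p \<in> pverts H \<Longrightarrow> 0 < y p"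
    and ge: "\<And>p. p \<in> pverts H \<Longrightarrow> \<rho> * y p \<le> sum y (pverts H) - y p - sum y (nb (parcs H) p)"
    and p: "p \<in> pverts H"
  shows "\<rho> * y p = sum y (pverts H) - y p - sum y (nb (parcs H) p)"
proof -
  have s: "sum y (nb (parcs K) q) = sum y (pverts H) - y q - sum y (nb (parcs H) q)"
    if "q \<in> pverts H" for q
    using K.sum_nb_conb[OF that, of y] conb_K[OF that] by simp
  have "sum y (nb (parcs K) p) = \<rho> * y p"
    by (rule test_vector[OF admissible_K]) (use y ge p s in \<open>auto simp: K_verts intro: less_imp_le\<close>)
  then show ?thesis using s[OF p] by simp
qed

section \<open>Degrees in the complement of an extremal graph\<close>

abbreviation "Hc \<equiv> conb E V"
abbreviation "d v \<equiv> card (Hc v)"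

lemma card_nb: "v \<in> V \<Longrightarrow> card (nb E v) + d v = t"
  using card_nb_conb[of v] cardV nt by simp

lemma d_pos:
  assumes v: "v \<in> V"
  shows "1 \<le> d v"
proof -
  have "card (E `` {v} - {v}) < t"
    using no_spread conn_singleton v unfolding spreads_def by (metis empty_subsetI insert_subset not_le)
  moreover have "E `` {v} - {v} = nb E v" using irrefl by (auto simp: nb_def)
  ultimately show ?thesis using card_nb[OF v] by simp
qed

lemma Hc_sym: "v \<in> V \<Longrightarrow> w \<in> Hc v \<Longrightarrow> w \<in> V \<and> v \<in> Hc w \<and> w \<noteq> v"
  using symE by (auto simp: conb_def)

text \<open>The constant vector has row sum \<open>t - 1\<close> in \<open>K\<close>, or
  \<open>t - 2\<close> at the centre of a star with two leaves; the inequality would be strict at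
  the leaf \<open>(0, 1)\<close>.\<close>

lemma rho_gt: "real t - 2 < \<rho>"
proof (rule ccontr)
  assume "\<not> ?thesis"
  then have le: "\<rho> \<le> real t - 2" by simp
  have c: "sum (\<lambda>_. 1::real) (pverts H) = real t + 1" using card_H nt by simp
  have c': "sum (\<lambda>_. 1::real) (nb (parcs H) p) = (if even t \<and> p = (0, 0) then 2 else 1)"
    if "p \<in> pverts H" for p using card_nb_H[OF that] by simp
  have p: "(0, 1) \<in> pverts H" using t3 by (auto simp: H_verts length_ks)
  have "\<rho> * 1 = sum (\<lambda>_. 1) (pverts H) - 1 - sum (\<lambda>_. 1) (nb (parcs H) (0, 1))"
    by (rule K_test) (use c c' le p in auto)
  then show False using c c'[OF p] le by simp
qed

text \<open>The eigenvalue equation is paired with the all-ones vector.\<close>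

lemma sum_degrees:
  assumes "\<And>v. v \<in> V \<Longrightarrow> (\<Sum>w\<in>nb E v. x w) = \<rho> * x v"
  shows "(\<Sum>v\<in>V. (real (d v) - 1) * x v) = (real t - 1 - \<rho>) * sum x V"
proof -
  have "\<rho> * sum x V = (\<Sum>v\<in>V. 1 * (\<Sum>w\<in>nb E v. x w))"
    using assms by (simp add: sum_distrib_left)
  also have "\<dots> = (\<Sum>v\<in>V. x v * (\<Sum>w\<in>nb E v. 1))" by (rule sum_nb_swap)
  also have "\<dots> = (\<Sum>v\<in>V. (real t - 1) * x v - (real (d v) - 1) * x v)"
  proof (rule sum.cong[OF refl])
    fix v assume "v \<in> V"
    then have "real (card (nb E v)) = real t - real (d v)" using card_nb[of v] by linarith
    then have s: "(\<Sum>w\<in>nb E v. 1) = real t - real (d v)" by simp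
    show "x v * (\<Sum>w\<in>nb E v. 1) = (real t - 1) * x v - (real (d v) - 1) * x v"
      unfolding s by (simp add: algebra_simps)
  qed
  also have "\<dots> = (real t - 1) * sum x V - (\<Sum>v\<in>V. (real (d v) - 1) * x v)"
    by (simp add: sum_subtractf sum_distrib_left)
  finally show ?thesis by (simp add: algebra_simps)
qed

text \<open>If the edges of \<open>H\<close> go to non-edges of G, then G embeds into
  \<open>K\<close>, and \<open>iso_of_embedding\<close> applies.\<close>

lemma iso_K_of_labelling:
  assumes \<phi>: "bij_betw \<phi> (pverts H) V" and arcs: "\<And>p q. (p, q) \<in> parcs H \<Longrightarrow> (\<phi> p, \<phi> q) \<notin> E"
  shows "digraph_iso (with_proj G) (with_proj K)"
proof (rule iso_of_embedding[OF admissible_K])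
  let ?f = "the_inv_into (pverts H) \<phi>"
  show bij: "bij_betw ?f V (pverts K)" unfolding K_verts by (rule bij_betw_the_inv_into[OF \<phi>])
  fix v w assume vw: "(v, w) \<in> E"
  have inv: "\<phi> (?f a) = a" "?f a \<in> pverts H" if "a \<in> V" for a
    using that \<phi> bij bij_betwE[OF bij] by (auto simp: f_the_inv_into_f_bij_betw K_verts)
  have V: "v \<in> V" "w \<in> V" "v \<noteq> w" using vw E_verts irrefl by auto
  have "(?f v, ?f w) \<notin> parcs H" using arcs[of "?f v" "?f w"] inv V vw by auto
  moreover have "?f v \<noteq> ?f w" using inv V by metis
  ultimately show "(?f v, ?f w) \<in> parcs K" using inv V by (auto simp: complement_def)
qed

lemma matching:
  assumes W: "W \<subseteq> V" "\<And>v. v \<in> W \<Longrightarrow> d v = 1 \<and> Hc v \<subseteq> W"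
  obtains m :: nat and \<phi> where "bij_betw \<phi> ({..<m} \<times> {0, 1::nat}) W" "card W = 2 * m"
    "\<And>i. i < m \<Longrightarrow> (\<phi> (i, 0), \<phi> (i, 1)) \<notin> E"
proof -
  define h where "h v = (SOME w. w \<in> Hc v)" for v
  have Hc: "Hc v = {h v}" if v: "v \<in> W" for v
  proof -
    obtain w where w: "Hc v = {w}" using W(2)[OF v] by (auto simp: card_1_singleton_iff)
    then show ?thesis by (simp add: h_def)
  qed
  have h: "h v \<in> W \<and> h v \<noteq> v \<and> h (h v) = v" if v: "v \<in> W" for v
  proof -
    have 1: "h v \<in> W" using W(2)[OF v] Hc[OF v] by blast
    have 2: "h v \<in> Hc v" using Hc[OF v] by blast
    then have "v \<in> Hc (h v)" "h v \<noteq> v" using Hc_sym[of v "h v"] v W(1) by blast+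
    then show ?thesis using Hc[OF 1] 1 by simp
  qed
  have fin: "finite W" using W(1) finV finite_subset by blast
  have "\<exists>m \<phi>. bij_betw \<phi> ({..<m::nat} \<times> {0, 1::nat}) W \<and> (\<forall>i<m. \<phi> (i, 1) = h (\<phi> (i, 0)))"
    by (rule matching_enumeration[OF fin]) (rule h)
  then obtain m :: nat and \<phi> where \<phi>: "bij_betw \<phi> ({..<m} \<times> {0, 1::nat}) W" "\<forall>i<m. \<phi> (i, 1) = h (\<phi> (i, 0))"
    by blast
  have "card W = 2 * m" using bij_betw_same_card[OF \<phi>(1)] by (simp add: card_cartesian_product)
  moreover have "(\<phi> (i, 0), \<phi> (i, 1)) \<notin> E" if "i < m" for i
  proof -
    have "\<phi> (i, 0) \<in> W" using bij_betwE[OF \<phi>(1)] that by auto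
    then have "h (\<phi> (i, 0)) \<in> Hc (\<phi> (i, 0))" using Hc by blast
    then show ?thesis using \<phi>(2) that by (auto simp: conb_def)
  qed
  ultimately show ?thesis using that \<phi>(1) by blast
qed

lemma iso_odd:
  assumes "odd t"
  shows "digraph_iso (with_proj G) (with_proj K)"
proof -
  \<comment> \<open>For odd \<open>t\<close> the candidate is regular of degree
    \<open>t - 1\<close>. The right side of \<open>sum_degrees\<close> is then nonpositive while all
    terms on the left are nonnegative.\<close>
  have rho: "real t - 1 \<le> \<rho>"
  proof (rule ccontr)
    assume "\<not> ?thesis"
    then have le: "\<rho> < real t - 1" by simp
    have c: "sum (\<lambda>_. 1::real) (pverts H) = real t + 1" using card_H nt by simp
    have c': "sum (\<lambda>_. 1::real) (nb (parcs H) p) = 1" if "p \<in> pverts H" for p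
      using card_nb_H[OF that] assms by simp
    have p: "(0, 1) \<in> pverts H" using t3 by (auto simp: H_verts length_ks)
    have "\<rho> * 1 = sum (\<lambda>_. 1) (pverts H) - 1 - sum (\<lambda>_. 1) (nb (parcs H) (0, 1))"
      by (rule K_test) (use c c' le p in auto)
    then show False using c c'[OF p] le by simp
  qed
  obtain x where x: "\<And>v. v \<in> V \<Longrightarrow> 0 < x v" "\<And>v. v \<in> V \<Longrightarrow> (\<Sum>w\<in>nb E v. x w) = \<rho> * x v"
    using positive_eigenvector by blast
  have "(\<Sum>v\<in>V. (real (d v) - 1) * x v) = (real t - 1 - \<rho>) * sum x V"
    by (rule sum_degrees) (rule x(2))
  also have "\<dots> \<le> 0"
  proof (rule mult_nonpos_nonneg)
    show "0 \<le> sum x V" by (rule sum_nonneg) (use x(1) less_imp_le in blast)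
  qed (use rho in simp)
  finally have "(\<Sum>v\<in>V. (real (d v) - 1) * x v) \<le> 0" .
  moreover have nn: "0 \<le> (real (d v) - 1) * x v" if "v \<in> V" for v
    using d_pos[OF that] x(1)[OF that] by simp
  ultimately have "(\<Sum>v\<in>V. (real (d v) - 1) * x v) = 0" by (meson antisym sum_nonneg)
  then have "(real (d v) - 1) * x v = 0" if "v \<in> V" for v
    using nn finV that by (simp add: sum_nonneg_eq_0_iff)
  then have d1: "d v = 1" if "v \<in> V" for v using x(1)[OF that] that by fastforce
  have "d v = 1 \<and> Hc v \<subseteq> V" if "v \<in> V" for v using d1[OF that] by (auto simp: conb_def)
  then obtain m :: nat and \<phi> where \<phi>: "bij_betw \<phi> ({..<m} \<times> {0, 1::nat}) V" "card V = 2 * m"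
    "\<And>i. i < m \<Longrightarrow> (\<phi> (i, 0), \<phi> (i, 1)) \<notin> E"
    using matching[of V] by blast
  have m: "length ks = m" using \<phi>(2) cardV nt assms by (simp add: length_ks)
  have "p \<in> pverts H \<longleftrightarrow> p \<in> {..<m} \<times> {0, 1}" for p
    using assms m by (cases p) (auto simp: H_verts)
  then have "pverts H = {..<m} \<times> {0, 1}" by blast
  moreover have "(\<phi> p, \<phi> q) \<notin> E" if "(p, q) \<in> parcs H" for p q
  proof -
    obtain i a where p: "p = (i, a)" by (cases p)
    obtain j b where q: "q = (j, b)" by (cases q)
    have "i = j" "i < m" "a = 0 \<and> b = 1 \<or> a = 1 \<and> b = 0"
      using that m assms unfolding p q H_eq by (auto simp: star_forest_arcs ks_nth)
    then show ?thesis using \<phi>(3)[of i] symE unfolding p q by auto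
  qed
  ultimately show ?thesis using iso_K_of_labelling[of \<phi>] \<phi>(1) by simp
qed

text \<open>An edge could be added between two non-adjacent vertices that both miss a second vertex.\<close>

lemma saturated:
  assumes v: "v \<in> V" "2 \<le> d v" and w: "w \<in> Hc v"
  shows "d w = 1"
proof (rule ccontr)
  assume "d w \<noteq> 1"
  have wV: "w \<in> V" "v \<in> Hc w" "w \<noteq> v" using Hc_sym[OF v(1) w] by auto
  then have w2: "2 \<le> d w" using d_pos[of w] \<open>d w \<noteq> 1\<close> by simp
  define G' where "G' = \<lparr> pverts = V, parcs = E \<union> {(v, w), (w, v)} \<rparr>"
  have G': "pverts G' = V" "parcs G' = E \<union> {(v, w), (w, v)}" by (simp_all add: G'_def)
  interpret pair_graph G by (rule pg)
  have "sym (parcs G')" using symE by (auto simp: G' sym_def)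
  then have pg': "pair_graph G'"
    using finV pair_finite_arcs wV v(1) irrefl E_verts
    by unfold_locales (auto simp: G' symmetric_def)
  interpret G': fin_graph V "parcs G'" using fin_graph_pair_graph[OF pg'] G' by simp
  have "\<not> spreads t (parcs G') V"
  proof (rule not_spreads_of_small_degree[OF finV G'.EV])
    fix a assume a: "a \<in> V"
    have "1 \<le> card (conb (parcs G') V a)"
    proof -
      have "Hc a - (if a = v then {w} else if a = w then {v} else {}) \<subseteq> conb (parcs G') V a"
        by (auto simp: conb_def G')
      then have "card (Hc a - (if a = v then {w} else if a = w then {v} else {}))
          \<le> card (conb (parcs G') V a)" by (rule card_mono[rotated]) simp
      moreover have "1 \<le> card (Hc a - (if a = v then {w} else if a = w then {v} else {}))"
        using v w wV w2 d_pos[OF a] by auto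
      ultimately show ?thesis by simp
    qed
    then show "card (nb (parcs G') a) < t" using G'.card_nb_conb[OF a] cardV nt by simp
  qed (use cardV nt t3 in simp_all)
  moreover have "conn (parcs G') V" by (rule conn_mono[OF connV]) (auto simp: G')
  ultimately have "admissible n t G'" using pg' cardV by (simp add: admissible_def G')
  \<comment> \<open>By maximality the enlarged graph would be isomorphic to G, but it has more
    arcs.\<close>
  then have "digraph_iso (with_proj G) (with_proj G')"
    by (rule iso_of_embedding[where f = id]) (auto simp: G')
  then obtain f where "parcs G' = map_prod f f ` E" using digraph_iso_pairE by metis
  then have "card (parcs G') \<le> card E" using card_image_le[OF pair_finite_arcs] by simp
  moreover have "E \<subset> parcs G'" using w by (auto simp: G' conb_def)
  then have "card E < card (parcs G')" by (rule psubset_card_mono[rotated]) (simp add: G' pair_finite_arcs)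
  ultimately show False by simp
qed

text \<open>Otherwise \<open>v\<close> has a single neighbour \<open>w\<close>. A non-neighbour
  \<open>z\<close> of \<open>w\<close> misses both \<open>w\<close> and \<open>v\<close>, against
  \<open>saturated\<close>. The bound serves to get \<open>d v < \<rho>\<close>.\<close>

lemma d_le:
  assumes v: "v \<in> V" "2 \<le> d v"
  shows "d v \<le> t - 2"
proof (rule ccontr)
  assume "\<not> ?thesis"
  then have "card (nb E v) \<le> 1" using card_nb[OF v(1)] by simp
  moreover have "nb E v \<noteq> {}"
  proof
    assume "nb E v = {}"
    then have "{v} = V" using v(1) by (intro conn_closed_eq[OF connV]) (auto simp: nb_def)
    then have "card V = card {v}" by simp
    then show False using cardV nt t3 by simp
  qed
  then have "card (nb E v) \<noteq> 0" by simp
  ultimately have "card (nb E v) = 1" by linarith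
  then obtain w where w: "nb E v = {w}" by (auto simp: card_1_singleton_iff)
  then have e: "(v, w) \<in> E" by auto
  have wV: "w \<in> V" using E_verts(2)[OF e] .
  obtain z where z: "z \<in> Hc w" using d_pos[OF wV] by (metis all_not_in_conv card.empty not_one_le_zero)
  have z': "z \<in> V" "w \<in> Hc z" "z \<noteq> w" using Hc_sym[OF wV z] by auto
  have "z \<noteq> v" using z symE[OF e] by (auto simp: conb_def)
  moreover have "z \<notin> nb E v" using z'(3) w by blast
  ultimately have zv: "z \<in> Hc v" using z'(1) by (simp add: conb_def)
  then have "v \<in> Hc z" using Hc_sym[OF v(1)] by blast
  then have "card {v, w} \<le> d z" using z'(2) by (intro card_mono) auto
  moreover have "v \<noteq> w" using e irrefl by auto
  ultimately show False using saturated[OF v zv] by simp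
qed

text \<open>
  The test vector solves the eigenvalue equations of \<open>K\<close> for the value \<open>\<rho>\<close> with its coordinate sum
  replaced by \<open>\<rho> + 2\<close>, so its actual sum cannot exceed \<open>\<rho> + 2\<close>.
\<close>

lemma rho_even_bound:
  assumes "even t"
  shows "(real t - 1 - \<rho>) * (\<rho>\<^sup>2 + 2 * \<rho> - 1) \<le> \<rho> - 1"
proof -
  define Q where "Q = \<rho>\<^sup>2 + 2 * \<rho> - 1"
  have r: "1 < \<rho>" using rho_gt t3 by simp
  have "1 < \<rho>\<^sup>2" using r by (simp add: one_less_power)
  then have Q: "0 < Q" using r unfolding Q_def by linarith
  \<comment> \<open>The values at the centre and at the two leaves solve the linear system
    \<open>eq1\<close>, \<open>eq2\<close>, whose determinant is
    \<open>Q = (\<rho> + 1)\<^sup>2 - 2\<close>. The sum \<rho> + 2 is what makes the value on the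
    single edges equal to 1.\<close>
  define \<alpha> \<beta> where "\<alpha> = (\<rho> + 2) * (\<rho> - 1) / Q" and "\<beta> = (\<rho> + 2) * \<rho> / Q"
  have pos: "0 < \<alpha>" "0 < \<beta>" using r Q by (auto simp: \<alpha>_def \<beta>_def)
  have Q\<alpha>: "\<alpha> * Q = (\<rho> + 2) * (\<rho> - 1)" and Q\<beta>: "\<beta> * Q = (\<rho> + 2) * \<rho>"
    using Q by (simp_all add: \<alpha>_def \<beta>_def)
  have eq1: "(\<rho> + 1) * \<alpha> + 2 * \<beta> = \<rho> + 2"
  proof -
    have "((\<rho> + 1) * \<alpha> + 2 * \<beta>) * Q = (\<rho> + 1) * (\<alpha> * Q) + 2 * (\<beta> * Q)"
      by (simp add: algebra_simps)
    also have "\<dots> = (\<rho> + 2) * Q"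
      unfolding Q\<alpha> Q\<beta> by (simp add: Q_def algebra_simps power2_eq_square)
    finally show ?thesis using Q by simp
  qed
  have eq2: "(\<rho> + 1) * \<beta> + \<alpha> = \<rho> + 2"
  proof -
    have "((\<rho> + 1) * \<beta> + \<alpha>) * Q = (\<rho> + 1) * (\<beta> * Q) + \<alpha> * Q"
      by (simp add: algebra_simps)
    also have "\<dots> = (\<rho> + 2) * Q"
      unfolding Q\<alpha> Q\<beta> by (simp add: Q_def algebra_simps power2_eq_square)
    finally show ?thesis using Q by simp
  qed
  define y :: "nat \<times> nat \<Rightarrow> real" where
    "y p = (if p = (0, 0) then \<alpha> else if p = (0, 1) \<or> p = (0, 2) then \<beta> else 1)" for p
  let ?C = "{(0, 0), (0, 1), (0, 2)} :: (nat \<times> nat) set"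
  have C: "?C \<subseteq> pverts H" using t3 assms by (auto simp: H_verts length_ks)
  have total: "sum y (pverts H) = \<alpha> + 2 * \<beta> + (real t - 2)"
  proof -
    have "sum y (pverts H) = sum y (pverts H - ?C) + sum y ?C"
      by (rule sum.subset_diff[OF C H.finV])
    also have "sum y (pverts H - ?C) = (\<Sum>p\<in>pverts H - ?C. 1)"
      by (rule sum.cong) (auto simp: y_def)
    also have "\<dots> = real (card (pverts H) - 3)"
      using card_Diff_subset[OF _ C] by simp
    finally show ?thesis using card_H nt t3 by (simp add: y_def)
  qed
  have nbs: "\<rho> * y p = (\<rho> + 2) - y p - sum y (nb (parcs H) p)" if p: "p \<in> pverts H" for p
  proof -
    obtain i a where ia: "p = (i, a)" by (cases p)
    consider "p = (0, 0)" | "p = (0, 1) \<or> p = (0, 2)" | "i \<noteq> 0"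
      using p assms unfolding ia
      by (auto simp: H_verts le_Suc_eq numeral_2_eq_2 split: if_splits)
    then show ?thesis
    proof cases
      case 1
      have "nb (parcs H) p = {0} \<times> {1..2}"
        using nb_H[of 0 0] p assms unfolding 1 by simp
      also have "{1..2} = {1, 2::nat}" by auto
      also have "{0} \<times> {1, 2::nat} = {(0::nat, 1), (0, 2)}" by blast
      finally have "nb (parcs H) p = {(0, 1), (0, 2)}" .
      then have "sum y (nb (parcs H) p) = 2 * \<beta>" by (simp add: y_def)
      then show ?thesis using eq1 1 by (simp add: y_def algebra_simps)
    next
      case 2
      then obtain a' where a': "p = (0, a')" "a' \<noteq> 0" "y p = \<beta>" by (auto simp: y_def)
      have "nb (parcs H) p = {(0, 0)}" using nb_H[of 0 a'] p a'(2) unfolding a'(1) by simp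
      then have "sum y (nb (parcs H) p) = \<alpha>" by (simp add: y_def)
      then show ?thesis using eq2 a'(3) by (simp add: algebra_simps)
    next
      case 3
      then have "nb (parcs H) p = (if a = 0 then {i} \<times> {1} else {(i, 0)})"
        using nb_H[of i a] p unfolding ia by simp
      moreover have "y (i, b) = 1" for b using 3 by (simp add: y_def)
      ultimately show ?thesis unfolding ia by simp
    qed
  qed
  have "sum y (pverts H) \<le> \<rho> + 2"
  proof (rule ccontr)
    assume gt: "\<not> ?thesis"
    have p: "(0, 0) \<in> pverts H" using C by blast
    have "\<rho> * y (0, 0) = sum y (pverts H) - y (0, 0) - sum y (nb (parcs H) (0, 0))"
    proof (rule K_test[OF _ _ p])
      show "0 < y p" for p using pos by (simp add: y_def)
      show "\<rho> * y p \<le> sum y (pverts H) - y p - sum y (nb (parcs H) p)" if "p \<in> pverts H" for p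
        using nbs[OF that] gt by simp
    qed
    then show False using nbs[OF p] gt by simp
  qed
  then have "\<alpha> + 2 * \<beta> \<le> \<rho> + 4 - real t" using total by simp
  then have "(\<alpha> + 2 * \<beta>) * Q \<le> (\<rho> + 4 - real t) * Q" using Q by (intro mult_right_mono) auto
  moreover have "(\<alpha> + 2 * \<beta>) * Q = \<alpha> * Q + 2 * (\<beta> * Q)" by (simp add: algebra_simps)
  then have "(\<alpha> + 2 * \<beta>) * Q = (\<rho> + 2) * (3 * \<rho> - 1)"
    unfolding Q\<alpha> Q\<beta> by (simp add: algebra_simps)
  ultimately have "(\<rho> + 2) * (3 * \<rho> - 1) \<le> (\<rho> + 4 - real t) * Q" by simp
  then show ?thesis unfolding Q_def by (simp add: algebra_simps power2_eq_square)
qed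

text \<open>Every \<open>a\<close> in \<open>Hc v\<close> misses \<open>v\<close>, which limits the
  weight missed by \<open>v\<close> and bounds \<open>x v\<close> from below. Inserted into
  \<open>sum_degrees\<close>, this makes the surplus of \<open>v\<close> alone at least what
  \<open>rho_even_bound\<close> permits in total: more if \<open>d v > 2\<close>, and with nothing
  left for the other vertices if \<open>d v = 2\<close>.\<close>

lemma unique_centre:
  assumes "even t" and v: "v \<in> V" "2 \<le> d v"
  shows "d v = 2" "\<And>w. w \<in> V \<Longrightarrow> w \<noteq> v \<Longrightarrow> d w = 1"
proof -
  obtain x where x: "\<And>v. v \<in> V \<Longrightarrow> 0 < x v" "\<And>v. v \<in> V \<Longrightarrow> (\<Sum>w\<in>nb E v. x w) = \<rho> * x v"
    using positive_eigenvector by blast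
  define T where "T = sum x V"
  have T: "0 < T" unfolding T_def using v(1) finV x(1) by (intro sum_pos) auto
  have x_eq: "(\<rho> + 1) * x a = T - sum x (Hc a)" if "a \<in> V" for a
    using sum_nb_conb[OF that, of x] x(2)[OF that] by (simp add: T_def algebra_simps)
  have r: "1 < \<rho>" "real (d v) < \<rho>" using rho_gt t3 d_le[OF v] by auto
  \<comment> \<open>\<open>Q - 2\<close> is the determinant from
    \<open>rho_even_bound\<close>.\<close>
  define Q where "Q = (\<rho> + 1)\<^sup>2"
  have "(\<rho> + 1) * sum x (Hc v) \<le> real (d v) * (T - x v)"
  proof -
    have "(\<rho> + 1) * x a \<le> T - x v" if "a \<in> Hc v" for a
    proof -
      have a: "a \<in> V" "v \<in> Hc a" using Hc_sym[OF v(1) that] by auto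
      have "x v \<le> sum x (Hc a)"
        by (rule member_le_sum) (use a x(1) Hc_sym[OF a(1)] in \<open>auto intro: less_imp_le\<close>)
      then show ?thesis using x_eq[OF a(1)] by simp
    qed
    then have "(\<Sum>a\<in>Hc v. (\<rho> + 1) * x a) \<le> (\<Sum>a\<in>Hc v. T - x v)" by (rule sum_mono)
    then show ?thesis by (simp add: sum_distrib_left)
  qed
  moreover have "Q * x v = (\<rho> + 1) * T - (\<rho> + 1) * sum x (Hc v)"
    using x_eq[OF v(1)] by (simp add: Q_def power2_eq_square mult.assoc right_diff_distrib)
  ultimately have low: "(\<rho> + 1 - real (d v)) * T \<le> (Q - real (d v)) * x v"
    by (simp add: algebra_simps)
  define R where "R = (\<Sum>w\<in>V - {v}. (real (d w) - 1) * x w)"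
  have R: "0 \<le> R" unfolding R_def using d_pos x(1) by (intro sum_nonneg mult_nonneg_nonneg) (auto intro: less_imp_le)
  have split: "(real (d v) - 1) * x v + R = (real t - 1 - \<rho>) * T"
    using sum_degrees[of x, OF x(2)] sum.remove[OF finV v(1), of "\<lambda>w. (real (d w) - 1) * x w"]
    by (simp add: R_def T_def)
  have bound: "(real t - 1 - \<rho>) * (Q - 2) \<le> \<rho> - 1"
    using rho_even_bound[OF assms(1)] by (simp add: Q_def power2_eq_square algebra_simps)
  have "(\<rho> + 1) * 2 < (\<rho> + 1) * (\<rho> + 1)" using r by (intro mult_strict_left_mono) auto
  then have Q: "Q > 2 + \<rho>" "Q - real (d v) > 0" "Q - 2 > 0"
    using r by (auto simp: Q_def power2_eq_square)
  \<comment> \<open>The last product is nonnegative because \<open>2 \<le> d v < \<rho>\<close>, and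
    it vanishes for \<open>d v = 2\<close>.\<close>
  have key: "(real (d v) - 1) * (\<rho> + 1 - real (d v)) = \<rho> - 1 + (real (d v) - 2) * (\<rho> - real (d v))"
    by (simp add: algebra_simps)
  have "(\<rho> - 1) * T \<le> (real (d v) - 1) * (\<rho> + 1 - real (d v)) * T"
    unfolding key using T r v(2) by (intro mult_right_mono) auto
  also have "\<dots> = (real (d v) - 1) * ((\<rho> + 1 - real (d v)) * T)" by simp
  also have "\<dots> \<le> (real (d v) - 1) * ((Q - real (d v)) * x v)"
    using low v(2) by (intro mult_left_mono) auto
  also have "\<dots> = (Q - real (d v)) * ((real (d v) - 1) * x v)" by simp
  also have "(real (d v) - 1) * x v = (real t - 1 - \<rho>) * T - R" using split by linarith
  finally have main: "(\<rho> - 1) * T + (Q - real (d v)) * R \<le> (Q - real (d v)) * (real t - 1 - \<rho>) * T"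
    by (simp add: algebra_simps)
  have QR: "0 \<le> (Q - real (d v)) * R" using Q R by simp
  have up: "(Q - 2) * (real t - 1 - \<rho>) * T \<le> (\<rho> - 1) * T"
    using bound T by (intro mult_right_mono) (auto simp: mult.commute)
  show d2: "d v = 2"
  proof (rule ccontr)
    assume "d v \<noteq> 2"
    then have "Q - real (d v) < Q - 2" using v(2) by simp
    moreover have "0 < (\<rho> - 1) * T" using r T by simp
    then have "0 < (Q - real (d v)) * ((real t - 1 - \<rho>) * T)" using main QR by (simp add: mult.assoc)
    then have "0 < (real t - 1 - \<rho>) * T" using Q(2) by (simp add: zero_less_mult_iff)
    ultimately have "(Q - real (d v)) * ((real t - 1 - \<rho>) * T) < (Q - 2) * ((real t - 1 - \<rho>) * T)"
      by (rule mult_strict_right_mono)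
    then show False using main QR up by (simp add: mult.assoc)
  qed
  have "(Q - 2) * R \<le> 0" using main up unfolding d2 by simp
  then have "R = 0" using R Q(3) by (simp add: mult_le_0_iff)
  then have "(real (d w) - 1) * x w = 0" if "w \<in> V - {v}" for w
    unfolding R_def using that d_pos x(1) finV
    by (subst (asm) sum_nonneg_eq_0_iff) (auto intro!: mult_nonneg_nonneg intro: less_imp_le)
  then show "d w = 1" if "w \<in> V" "w \<noteq> v" for w
    using that x(1)[OF that(1)] by fastforce
qed

lemma iso_even:
  assumes "even t"
  shows "digraph_iso (with_proj G) (with_proj K)"
proof -
  \<comment> \<open>The order \<open>t + 1\<close> is odd, so the complement cannot be a perfect
    matching.\<close>
  have "\<exists>v\<in>V. 2 \<le> d v"
  proof (rule ccontr)
    assume "\<not> ?thesis"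
    then have "d v = 1 \<and> Hc v \<subseteq> V" if "v \<in> V" for v
      using d_pos[OF that] that by (force simp: conb_def)
    then obtain m where "card V = 2 * m" using matching[of V] by blast
    then show False using cardV nt assms by presburger
  qed
  then obtain c where c: "c \<in> V" "2 \<le> d c" by blast
  have dc: "d c = 2" and d1: "\<And>w. w \<in> V \<Longrightarrow> w \<noteq> c \<Longrightarrow> d w = 1"
    using unique_centre[OF assms c] by auto
  obtain p q where pq: "Hc c = {p, q}" "p \<noteq> q" using dc by (auto simp: card_2_iff)
  have p: "p \<in> V" "p \<noteq> c" "Hc p = {c}" and q: "q \<in> V" "q \<noteq> c" "Hc q = {c}"
    using Hc_sym[OF c(1), of p] Hc_sym[OF c(1), of q] pq d1[of p] d1[of q]
    by (auto simp: card_1_singleton_iff)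
  let ?C = "{c, p, q}" and ?W = "V - {c, p, q}"
  have "d v = 1 \<and> Hc v \<subseteq> ?W" if v: "v \<in> ?W" for v
  proof -
    have "w \<notin> ?C" if "w \<in> Hc v" for w
      using Hc_sym[of v w] that v pq p(3) q(3) by auto
    then show ?thesis using d1[of v] v by (auto simp: conb_def)
  qed
  then obtain m :: nat and \<phi> where \<phi>: "bij_betw \<phi> ({..<m} \<times> {0, 1::nat}) ?W" "card ?W = 2 * m"
    "\<And>i. i < m \<Longrightarrow> (\<phi> (i, 0), \<phi> (i, 1)) \<notin> E"
    using matching[of ?W] by blast
  have "card ?W = card V - card ?C" by (rule card_Diff_subset) (use c p q in auto)
  then have m: "2 * m = t - 2" using \<phi>(2) cardV nt p q pq(2) by simp
  then have lk: "length ks = Suc m" using assms t3 by (auto simp: length_ks)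
  \<comment> \<open>Component 0 is the star with two leaves, so the pairs enumerated by \<phi> move
    up by one index.\<close>
  define \<psi> :: "nat \<times> nat \<Rightarrow> 'a" where
    "\<psi> = (\<lambda>(i, a). if i = 0 then (if a = 0 then c else if a = 1 then p else q) else \<phi> (i - 1, a))"
  let ?A = "{(0, 0), (0, 1), (0, 2)} :: (nat \<times> nat) set" and ?B = "{1..m} \<times> {0, 1::nat}"
  have "bij_betw \<psi> (?A \<union> ?B) (?C \<union> ?W)"
  proof (rule bij_betw_combine)
    show "bij_betw \<psi> ?A ?C"
      using p(2) q(2) pq(2) by (auto simp: bij_betw_def inj_on_def \<psi>_def)
    have "bij_betw (\<lambda>(i, a). (i - 1, a)) ?B ({..<m} \<times> {0, 1::nat})"
      by (rule bij_betw_byWitness[where f' = "\<lambda>(i, a). (Suc i, a)"]) auto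
    from bij_betw_trans[OF this \<phi>(1)] show "bij_betw \<psi> ?B ?W"
      by (rule bij_betw_cong[THEN iffD1, rotated]) (auto simp: \<psi>_def)
  qed auto
  moreover have "z \<in> pverts H \<longleftrightarrow> z \<in> ?A \<union> ?B" for z
    using assms lk by (cases z) (auto simp: H_verts le_Suc_eq numeral_2_eq_2)
  then have "pverts H = ?A \<union> ?B" by blast
  moreover have "?C \<union> ?W = V" using c p q by auto
  moreover have "(\<psi> r, \<psi> s) \<notin> E" if "(r, s) \<in> parcs H" for r s
  proof -
    obtain i a where r: "r = (i, a)" by (cases r)
    obtain j b where s: "s = (j, b)" by (cases s)
    have ij: "i = j" "i < Suc m"
      and ab: "a = 0 \<and> 1 \<le> b \<and> b \<le> (if i = 0 then 2 else 1) \<or> b = 0 \<and> 1 \<le> a \<and> a \<le> (if i = 0 then 2 else 1)"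
      using that lk assms unfolding r s H_eq by (auto simp: star_forest_arcs ks_nth)
    show ?thesis
    proof (cases "i = 0")
      case True
      have "(c, p) \<notin> E" "(c, q) \<notin> E" "(p, c) \<notin> E" "(q, c) \<notin> E"
        using pq(1) p(3) q(3) by (auto simp: conb_def)
      then show ?thesis using True ij ab unfolding r s by (auto simp: \<psi>_def)
    next
      case False
      then have "a = 0 \<and> b = 1 \<or> a = 1 \<and> b = 0" using ab by auto
      moreover have "i - 1 < m" using ij False by linarith
      then have "(\<phi> (i - 1, 0), \<phi> (i - 1, 1)) \<notin> E" "(\<phi> (i - 1, 1), \<phi> (i - 1, 0)) \<notin> E"
        using \<phi>(3) symE by blast+
      ultimately show ?thesis using False ij(1) unfolding r s by (auto simp: \<psi>_def)
    qed
  qed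
  ultimately show ?thesis using iso_K_of_labelling[of \<psi>] by simp
qed

lemma iso_complement_H_graph: "digraph_iso (with_proj G) (with_proj K)"
  using iso_odd iso_even by blast

end

theorem theorem1p3:
  fixes t n :: nat and G :: "'a pair_pre_digraph"
  assumes "t \<ge> 3" and "n \<ge> t + 1"
    and "is_arg_max graph_spectral_radius
           (\<lambda>H. pair_graph H \<and> card (pverts H) = n \<and> Digraph_Component.connected H
                \<and> minor_free (star t) H) G"
  shows "(n = t + 1 \<longrightarrow> digraph_iso G (complement (H_graph t)))
       \<and> (n \<ge> t + 2 \<longrightarrow> digraph_iso G (subdivided_complete_graph (n - t) t))"
proof (intro conjI impI)
  have n: "n > 0" using assms(2) by simp
  interpret extremal n t G by (rule extremalI[OF assms(3) n])
  show "digraph_iso G (complement (H_graph t))" if "n = t + 1"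
  proof -
    interpret small_extremal n t G by unfold_locales (use assms(1) that in auto)
    show ?thesis by (rule iso_complement_H_graph)
  qed
  show "digraph_iso G (subdivided_complete_graph (n - t) t)" if "t + 2 \<le> n"
  proof -
    interpret large_extremal n t G by unfold_locales (use assms(1) that in auto)
    show ?thesis by (rule iso_subdivided_complete_graph)
  qed
qed

end
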